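(* Let $\Omega$ be an open, bounded and connected subset of $\mathbb{R}^N$ having Lipschitz boundary and satisfying the uniform interior sphere condition. Let $a:\Omega\times\mathbb{R}\times\mathbb{R}^N\to\mathbb{R}^N$ be a Carathéodory function satisfying, for some $\beta>0$, $$|a(x,s,\xi)|\leq \beta(1+|\xi|)\qquad \text{for all } (s,\xi)\in\mathbb{R}\times\mathbb{R}^N,\ \text{for a.e. } x\in\Omega.$$ Let $p>2$, $\lambda>0$, and let $f\in L^q(\Omega)$ for some $q\ge1$ with $q>\frac{N}{p}$. Let $u\in W^{1,p}_{\rm loc}(\Omega)$ be a subsolution, in the sense of distributions, of $$\lambda u+|\nabla u|^p\leq \operatorname{div}(a(x,u,\nabla u))+f(x)\qquad\text{in }\Omega.$$ Assume in addition that one of the following two conditions holds: (i) $a(x,s,\xi)\cdot\xi\geq 0$ for every $(s,\xi)\in\mathbb{R}\times\mathbb{R}^N$ and a.e. $x\in\Omega$; (ii) $u\geq 0$ in $\Omega$. Then $u^+\in L^\infty(\Omega)$ and $$\|u^+\|_{L^\infty(\Omega)}\leq M,$$ where $M=M(\beta,q,p,N,\lambda^{-1},\Omega,\|f\|_{L^q(\Omega)})$ depends only on the quantities indicated.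
   Context: Carathéodory function: measurable in $x$ for every fixed $(s,\xi)$ and continuous in $(s,\xi)$ for a.e. $x$. $u^+=\max\{u,0\}$. Subsolution in the sense of distributions means that for every $\varphi\in C^\infty_0(\Omega)$ (smooth, compactly supported) with $\varphi\ge0$, $$\int_\Omega a(x,u,\nabla u)\cdot\nabla\varphi\,dx+\lambda\int_\Omega u\,\varphi\,dx+\int_\Omega|\nabla u|^p\varphi\,dx\leq\int_\Omega f\varphi\,dx.$$ Uniform interior sphere condition: there is $r>0$ such that every $x_0\in\partial\Omega$ lies on the boundary of some ball of radius $r$ contained in $\Omega$. *)

theory Defs
  imports "HOL-Analysis.Analysis" "HOL-Probability.Essential_Supremum"
begin

section \<open>Lebesgue spaces\<close>

text \<open>The spaces consist of functions rather than of classes of functions, and only the values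
  on \<open>S\<close> matter. The exponent ranges over \<open>[1,\<infinity>]\<close>; the essential supremum of the norm is taken
  in the extended nonnegative reals, so that it vanishes on a null set.\<close>

definition Lspace :: "(real^'n) set \<Rightarrow> ennreal \<Rightarrow> (real^'n \<Rightarrow> 'b::euclidean_space) set" where
  "Lspace S q = {f. f \<in> borel_measurable (lebesgue_on S) \<and>
     (if q = \<infinity> then esssup (lebesgue_on S) (\<lambda>x. ennreal (norm (f x))) < \<infinity>
      else integrable (lebesgue_on S) (\<lambda>x. norm (f x) powr enn2real q))}"

text \<open>Meaningful only for members of \<^term>\<open>Lspace S q\<close>.\<close>

definition Lnorm :: "(real^'n) set \<Rightarrow> ennreal \<Rightarrow> (real^'n \<Rightarrow> 'b::euclidean_space) \<Rightarrow> real" where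
  "Lnorm S q f =
     (if q = \<infinity> then enn2real (esssup (lebesgue_on S) (\<lambda>x. ennreal (norm (f x))))
      else (\<integral>x. norm (f x) powr enn2real q \<partial>lebesgue_on S) powr (1 / enn2real q))"

definition Lspace_loc :: "(real^'n) set \<Rightarrow> ennreal \<Rightarrow> (real^'n \<Rightarrow> 'b::euclidean_space) set" where
  "Lspace_loc \<Omega> q = {f. \<forall>K. compact K \<and> K \<subseteq> \<Omega> \<longrightarrow> f \<in> Lspace K q}"

section \<open>Test functions\<close>

fun C_k :: "nat \<Rightarrow> (real^'n \<Rightarrow> real) \<Rightarrow> bool" where
  "C_k 0 f \<longleftrightarrow> continuous_on UNIV f"
| "C_k (Suc k) f \<longleftrightarrow> (\<forall>x. f differentiable (at x)) \<and>
     (\<forall>v. C_k k (\<lambda>x. frechet_derivative f (at x) v))"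

text \<open>Functions in \<open>C\<^sub>0\<^sup>\<infinity>(\<Omega>)\<close> are regarded as extended by zero to the whole space.\<close>

definition test_functions :: "(real^'n) set \<Rightarrow> (real^'n \<Rightarrow> real) set" where
  "test_functions \<Omega> =
     {\<phi>. (\<forall>k. C_k k \<phi>) \<and> compact (closure {x. \<phi> x \<noteq> 0}) \<and> closure {x. \<phi> x \<noteq> 0} \<subseteq> \<Omega>}"

definition grad :: "(real^'n \<Rightarrow> real) \<Rightarrow> real^'n \<Rightarrow> real^'n" where
  "grad \<phi> x = (\<chi> i. frechet_derivative \<phi> (at x) (axis i 1))"

section \<open>Sobolev functions\<close>

definition has_weak_gradient :: "(real^'n) set \<Rightarrow> (real^'n \<Rightarrow> real) \<Rightarrow> (real^'n \<Rightarrow> real^'n) \<Rightarrow> bool" where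
  "has_weak_gradient \<Omega> u G \<longleftrightarrow> u \<in> Lspace_loc \<Omega> 1 \<and> G \<in> Lspace_loc \<Omega> 1 \<and>
     (\<forall>\<phi> \<in> test_functions \<Omega>.
        (\<integral>x. u x *\<^sub>R grad \<phi> x \<partial>lebesgue_on \<Omega>) = - (\<integral>x. \<phi> x *\<^sub>R G x \<partial>lebesgue_on \<Omega>))"

text \<open>A weak gradient is unique only up to null sets; this picks a representative.\<close>

definition weak_grad :: "(real^'n) set \<Rightarrow> (real^'n \<Rightarrow> real) \<Rightarrow> real^'n \<Rightarrow> real^'n" where
  "weak_grad \<Omega> u = (SOME G. has_weak_gradient \<Omega> u G)"

definition W1_loc :: "(real^'n) set \<Rightarrow> real \<Rightarrow> (real^'n \<Rightarrow> real) set" where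
  "W1_loc \<Omega> p = {u. (\<exists>G. has_weak_gradient \<Omega> u G) \<and>
     u \<in> Lspace_loc \<Omega> (ennreal p) \<and> weak_grad \<Omega> u \<in> Lspace_loc \<Omega> (ennreal p)}"

section \<open>Domains\<close>

text \<open>Near each boundary point \<open>\<Omega>\<close> is the region above the graph of a Lipschitz function \<open>g\<close>, in
  coordinates consisting of a unit vector \<open>e\<close> and its orthogonal complement.\<close>

definition lipschitz_boundary :: "(real^'n) set \<Rightarrow> bool" where
  "lipschitz_boundary \<Omega> \<longleftrightarrow> (\<forall>x0 \<in> frontier \<Omega>. \<exists>r>0. \<exists>e g L. norm e = 1 \<and>
     L-lipschitz_on {y. y \<bullet> e = 0} g \<and>
     (\<forall>x \<in> ball x0 r. x \<in> \<Omega> \<longleftrightarrow> g (x - (x \<bullet> e) *\<^sub>R e) < x \<bullet> e))"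

definition uniform_interior_sphere :: "(real^'n) set \<Rightarrow> bool" where
  "uniform_interior_sphere \<Omega> \<longleftrightarrow>
     (\<exists>r>0. \<forall>x0 \<in> frontier \<Omega>. \<exists>y. x0 \<in> sphere y r \<and> ball y r \<subseteq> \<Omega>)"

section \<open>The differential inequality\<close>

definition caratheodory :: "(real^'n) set \<Rightarrow> (real^'n \<Rightarrow> real \<Rightarrow> real^'n \<Rightarrow> real^'n) \<Rightarrow> bool" where
  "caratheodory \<Omega> a \<longleftrightarrow>
     (\<forall>s \<xi>. (\<lambda>x. a x s \<xi>) \<in> borel_measurable (lebesgue_on \<Omega>)) \<and>
     (AE x in lebesgue_on \<Omega>. continuous_on UNIV (\<lambda>(s, \<xi>). a x s \<xi>))"

definition subsolution ::
  "(real^'n) set \<Rightarrow> (real^'n \<Rightarrow> real \<Rightarrow> real^'n \<Rightarrow> real^'n) \<Rightarrow> real \<Rightarrow> real \<Rightarrow>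
    (real^'n \<Rightarrow> real) \<Rightarrow> (real^'n \<Rightarrow> real) \<Rightarrow> bool" where
  "subsolution \<Omega> a lam p f u \<longleftrightarrow>
     (\<forall>\<phi> \<in> test_functions \<Omega>. (\<forall>x. 0 \<le> \<phi> x) \<longrightarrow>
        (\<integral>x. a x (u x) (weak_grad \<Omega> u x) \<bullet> grad \<phi> x \<partial>lebesgue_on \<Omega>)
        + lam * (\<integral>x. u x * \<phi> x \<partial>lebesgue_on \<Omega>)
        + (\<integral>x. norm (weak_grad \<Omega> u x) powr p * \<phi> x \<partial>lebesgue_on \<Omega>)
        \<le> (\<integral>x. f x * \<phi> x \<partial>lebesgue_on \<Omega>))"

end

theory Submission
  imports Defs
begin

text \<open>Testing with cutoff functions on balls \<open>B\<^sub>R\<close> contained in \<open>\<Omega>\<close> and absorbing the flux by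
  Young's inequality (here \<open>p > 2\<close> beats the linear growth of \<open>a\<close>) gives, uniformly up to the
  boundary, \<open>\<integral>\<bar>\<nabla>u\<^sup>+\<bar>\<^sup>p + \<lambda> \<integral>u\<^sup>+ \<le> C R powr (N - \<sigma>)\<close> on the half ball with \<open>\<sigma> = max (N / q) (p / (p - 1)) < p\<close>.
  Hence \<open>\<integral>\<bar>\<nabla>u\<^sup>+\<bar> \<le> C R powr (N - \<tau>)\<close> with \<open>\<tau> = \<sigma> / p < 1\<close>.
  The Lipschitz boundary provides, locally with a fixed direction \<open>e\<close>, cones
  \<open>\<Union>t\<le>T. cball (x + t e) (2 c t)\<close> inside \<open>\<Omega>\<close> with vertex at any point \<open>x\<close>. The weighted average
  \<open>A t\<close> of \<open>u\<^sup>+\<close> over \<open>cball (x + t e) (c t)\<close> satisfies \<open>\<bar>A' t\<bar> \<le> C t powr (- \<tau>)\<close>, which is integrable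
  at \<open>0\<close>; \<open>A T\<close> is bounded by the zeroth order term and \<open>A t\<close> tends to \<open>u\<^sup>+ x\<close> for almost every \<open>x\<close>.\<close>

text \<open>The obstacle is that test functions have compact support in \<open>\<Omega>\<close> and
  \<open>u\<close> has no boundary values, so nothing can be tested across the boundary. The
  interior energy estimates, however, have constants that do not depend on the position of the ball:
  they blow up only as a power of the radius, and a cone consists of balls whose radius is
  comparable to the distance from the vertex. Both conditions on the exponents say
  \<open>\<sigma> < p\<close>: the one on \<open>q\<close> is \<open>N / q < p\<close>, and for
  \<open>p > 1\<close> the inequality \<open>p / (p - 1) < p\<close> is equivalent to
  \<open>p > 2\<close>. A nonnegative \<open>u\<close> satisfies the inequality in
  \<open>energy\<close> directly. Under the sign condition on the flux a convex function of
  \<open>u\<close> takes the place of the positive part, and the sign discards the term that its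
  second derivative produces. In both cases \<open>M\<close> is fixed before \<open>a\<close>,
  \<open>f\<close> and \<open>u\<close>: the cones come from \<open>\<Omega>\<close>, all other
  constants from the listed quantities.\<close>

section \<open>Smooth bump functions\<close>

text \<open>The powers of \<open>1 / s\<close> make the family closed under differentiation up to
  linear combinations, so smoothness of all members is one induction on the order.\<close>

definition flat_exp :: "nat \<Rightarrow> real \<Rightarrow> real" where
  "flat_exp k s = (if s > 0 then (1 / s) ^ k * exp (- (1 / s)) else 0)"

text \<open>A single term of the exponential series is at most its sum.\<close>

lemma power_mult_exp_neg_le: "x ^ k * exp (- x) \<le> fact k" if "x \<ge> 0" for x :: real
proof -
  have "x ^ k / fact k \<le> exp x"
  proof -
    have "(\<lambda>n. x ^ n / fact n) sums exp x"
      using exp_converges[of x] by (simp add: field_simps)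
    then show ?thesis
      using that sum_le_suminf[of "\<lambda>n. x ^ n / fact n" "{k}"] by (auto simp: sums_iff)
  qed
  then show ?thesis by (simp add: field_simps exp_minus)
qed

lemma flat_exp_nonneg: "flat_exp k s \<ge> 0"
  by (auto simp: flat_exp_def)

lemma flat_exp_le: "flat_exp k s \<le> fact k"
  using power_mult_exp_neg_le[of "1 / s" k] by (auto simp: flat_exp_def)

lemma flat_exp_0_le_1: "flat_exp 0 s \<le> 1"
  using flat_exp_le[of 0 s] by simp

lemma flat_exp_Suc_mult: "s * flat_exp (Suc k) s = flat_exp k s"
  by (auto simp: flat_exp_def)

lemma flat_exp_le_linear: "flat_exp k s \<le> fact (Suc k) * \<bar>s\<bar>"
proof -
  have "flat_exp k s = s * flat_exp (Suc k) s" by (simp add: flat_exp_Suc_mult)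
  also have "\<dots> \<le> \<bar>s\<bar> * fact (Suc k)"
    by (intro mult_mono flat_exp_le flat_exp_nonneg) auto
  finally show ?thesis by (simp add: mult.commute)
qed

text \<open>For \<open>s > 0\<close> this is the chain rule through \<open>1 / s\<close>. At
  \<open>0\<close> the difference quotient of index \<open>k\<close> is
  \<open>flat_exp (Suc k)\<close>, which tends to \<open>0\<close> by the linear bound.\<close>

lemma flat_exp_has_derivative:
  "(flat_exp k has_field_derivative (flat_exp (k + 2) s - of_nat k * flat_exp (Suc k) s)) (at s)"
proof -
  consider "s > 0" | "s < 0" | "s = 0" by linarith
  then show ?thesis
  proof cases
    case 1
    have "((\<lambda>x. x ^ k * exp (- x)) has_field_derivative
        of_nat k * (1 / s) ^ (k - 1) * exp (- (1 / s)) - (1 / s) ^ k * exp (- (1 / s))) (at (1 / s))"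
      by (auto intro!: derivative_eq_intros)
    moreover have "((\<lambda>s. 1 / s) has_field_derivative - (1 / s * (1 / s))) (at s)"
      using 1 by (auto intro!: derivative_eq_intros)
    ultimately have "((\<lambda>s. (1 / s) ^ k * exp (- (1 / s))) has_field_derivative
        (of_nat k * (1 / s) ^ (k - 1) * exp (- (1 / s)) - (1 / s) ^ k * exp (- (1 / s)))
        * (- (1 / s * (1 / s)))) (at s)"
      by (rule DERIV_chain2)
    moreover have "(of_nat k * (1 / s) ^ (k - 1) * exp (- (1 / s)) - (1 / s) ^ k * exp (- (1 / s)))
        * (- (1 / s * (1 / s))) = flat_exp (k + 2) s - of_nat k * flat_exp (Suc k) s"
      \<comment> \<open>The case split removes the truncated subtraction in
        \<open>k - 1\<close>.\<close>
      using 1 by (cases k) (simp_all add: flat_exp_def algebra_simps flip: add_divide_distrib)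
    ultimately have "((\<lambda>s. (1 / s) ^ k * exp (- (1 / s))) has_field_derivative
        (flat_exp (k + 2) s - of_nat k * flat_exp (Suc k) s)) (at s)"
      by (simp only:)
    moreover have "eventually (\<lambda>t. t \<in> {0<..}) (nhds s)"
      using 1 by (intro eventually_nhds_in_open) auto
    ultimately show ?thesis
      by (subst DERIV_cong_ev[OF refl _ refl])
        (auto elim!: eventually_mono simp: flat_exp_def)
  next
    case 2
    have "eventually (\<lambda>t. t \<in> {..<0}) (nhds s)"
      using 2 by (intro eventually_nhds_in_open) auto
    then show ?thesis using 2
      by (subst DERIV_cong_ev[OF refl _ refl, of _ "\<lambda>_. 0"])
        (auto elim!: eventually_mono simp: flat_exp_def)
  next
    case 3
    have "((\<lambda>h. flat_exp k h / h) \<longlongrightarrow> 0) (at 0)"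
    proof (rule Lim_null_comparison)
      show "eventually (\<lambda>h. norm (flat_exp k h / h) \<le> fact (Suc (Suc k)) * \<bar>h\<bar>) (at 0)"
      proof (intro always_eventually allI)
        fix h :: real
        have "flat_exp k h / h = flat_exp (Suc k) h"
          by (auto simp: flat_exp_def)
        then show "norm (flat_exp k h / h) \<le> fact (Suc (Suc k)) * \<bar>h\<bar>"
          using flat_exp_le_linear[of "Suc k" h] flat_exp_nonneg[of "Suc k" h]
          by (simp del: fact_Suc)
      qed
      show "((\<lambda>h. fact (Suc (Suc k)) * \<bar>h\<bar> :: real) \<longlongrightarrow> 0) (at 0)"
        by (auto intro!: tendsto_eq_intros)
    qed
    then show ?thesis using 3
      by (simp add: DERIV_def flat_exp_def)
  qed
qed

lemma flat_exp_0_has_derivative: "(flat_exp 0 has_field_derivative flat_exp 2 s) (at s)"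
  using flat_exp_has_derivative[of 0 s] by (simp add: numeral_2_eq_2)

lemma continuous_on_flat_exp: "continuous_on A (flat_exp k)"
  using flat_exp_has_derivative[THEN DERIV_isCont] by (simp add: continuous_at_imp_continuous_on)

lemma flat_exp_mono: "s \<le> t \<Longrightarrow> flat_exp 0 s \<le> flat_exp 0 t"
  by (rule DERIV_nonneg_imp_nondecreasing) (use flat_exp_0_has_derivative flat_exp_nonneg in blast)+

section \<open>Calculus of \<open>C_k\<close> functions and their gradients\<close>

definition smooth_fun :: "(real^'n \<Rightarrow> real) \<Rightarrow> bool" where
  "smooth_fun f \<longleftrightarrow> (\<forall>k. C_k k f)"

lemma frechet_derivative_eqI: "(f has_derivative D) (at x) \<Longrightarrow> frechet_derivative f (at x) = D"
  using frechet_derivative_at by metis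

text \<open>The recursion in \<open>C_k\<close> does not list the lower orders. The descent is an
  induction that ends in the continuity of differentiable functions.\<close>

lemma C_k_SucD: "C_k (Suc k) f \<Longrightarrow> C_k k f"
proof (induction k arbitrary: f)
  case 0
  then show ?case
    by (auto intro!: continuous_at_imp_continuous_on differentiable_imp_continuous_within)
next
  case (Suc k)
  have "C_k (Suc k) (\<lambda>x. frechet_derivative f (at x) v)" for v
    using Suc.prems by simp
  then show ?case using Suc by simp
qed

text \<open>Any family \<open>D\<close> of derivatives may be supplied, so that
  \<open>frechet_derivative\<close> never has to be computed.\<close>

lemma C_k_SucI:
  assumes "\<And>x. (f has_derivative D x) (at x)" "\<And>v. C_k k (\<lambda>x. D x v)"
  shows "C_k (Suc k) f"
proof -
  have "frechet_derivative f (at x) = D x" for x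
    by (rule frechet_derivative_eqI[OF assms(1)])
  with assms show ?thesis by (auto simp: differentiable_def)
qed

lemma C_k_has_derivative:
  "C_k (Suc k) f \<Longrightarrow> (f has_derivative frechet_derivative f (at x)) (at x)"
  using frechet_derivative_works by auto

lemma C_k_const: "C_k k (\<lambda>x. c)"
proof (induction k arbitrary: c)
  case (Suc k)
  show ?case by (rule C_k_SucI) (auto intro: derivative_eq_intros Suc)
qed auto

lemma C_k_add: "C_k k f \<Longrightarrow> C_k k g \<Longrightarrow> C_k k (\<lambda>x. f x + g x)"
proof (induction k arbitrary: f g)
  case (Suc k)
  show ?case
    by (rule C_k_SucI[where D="\<lambda>x v. frechet_derivative f (at x) v + frechet_derivative g (at x) v"])
      (use Suc in \<open>auto intro!: has_derivative_add C_k_has_derivative\<close>)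
qed (auto intro!: continuous_intros)

lemma C_k_mult: "C_k k f \<Longrightarrow> C_k k g \<Longrightarrow> C_k k (\<lambda>x. f x * g x)"
proof (induction k arbitrary: f g)
  case (Suc k)
  show ?case
  proof (rule C_k_SucI[where D="\<lambda>x v. f x * frechet_derivative g (at x) v + frechet_derivative f (at x) v * g x"])
    show "((\<lambda>x. f x * g x) has_derivative
      (\<lambda>v. f x * frechet_derivative g (at x) v + frechet_derivative f (at x) v * g x)) (at x)" for x
      by (intro has_derivative_mult C_k_has_derivative[OF Suc.prems(1)] C_k_has_derivative[OF Suc.prems(2)])
  next
    fix v
    note 1 = Suc.prems[THEN C_k_SucD]
    have 2: "C_k k (\<lambda>x. frechet_derivative f (at x) v)" "C_k k (\<lambda>x. frechet_derivative g (at x) v)"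
      using Suc.prems by (auto simp: C_k.simps(2)[of k])
    show "C_k k (\<lambda>x. f x * frechet_derivative g (at x) v + frechet_derivative f (at x) v * g x)"
      by (intro C_k_add Suc.IH 1 2)
  qed
qed (auto intro!: continuous_intros)

lemma C_k_inner: "C_k k (\<lambda>x. x \<bullet> w)"
proof (cases k)
  case (Suc j)
  show ?thesis unfolding Suc
    by (rule C_k_SucI[where D="\<lambda>x v. v \<bullet> w"]) (auto intro!: derivative_eq_intros C_k_const)
qed (auto intro!: continuous_intros)

lemma C_k_inner_self: "C_k k (\<lambda>x. x \<bullet> x)"
proof (cases k)
  case (Suc j)
  show ?thesis unfolding Suc
  proof (rule C_k_SucI[where D="\<lambda>x v. 2 * (x \<bullet> v)"])
    show "((\<lambda>x. x \<bullet> x) has_derivative (\<lambda>v. 2 * (x \<bullet> v))) (at x)" for x :: "real^'n"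
      by (auto intro!: derivative_eq_intros simp: inner_commute)
  qed (intro C_k_mult C_k_const C_k_inner)
qed (auto intro!: continuous_intros)

text \<open>The derivative of index \<open>j\<close> involves the indices \<open>j + 1\<close> and
  \<open>j + 2\<close>, hence the induction runs over all \<open>j\<close> at once.\<close>

lemma C_k_flat_exp: "smooth_fun f \<Longrightarrow> C_k k (\<lambda>x. flat_exp j (f x))"
proof (induction k arbitrary: j)
  case 0
  then have "continuous_on UNIV f" unfolding smooth_fun_def using C_k.simps(1) by blast
  from continuous_on_compose2[OF continuous_on_flat_exp this subset_UNIV, of j]
  show ?case by simp
next
  case (Suc k)
  have f: "C_k n f" for n using Suc.prems unfolding smooth_fun_def by blast
  show ?case
  proof (rule C_k_SucI[where D="\<lambda>x v. (flat_exp (j + 2) (f x) + (- of_nat j) * flat_exp (Suc j) (f x))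
             * frechet_derivative f (at x) v"])
    fix x
    show "((\<lambda>x. flat_exp j (f x)) has_derivative
       (\<lambda>v. (flat_exp (j + 2) (f x) + (- of_nat j) * flat_exp (Suc j) (f x))
             * frechet_derivative f (at x) v)) (at x)"
    proof -
      have "(flat_exp j has_derivative
          (\<lambda>d. (flat_exp (j + 2) (f x) + (- of_nat j) * flat_exp (Suc j) (f x)) * d)) (at (f x))"
        using flat_exp_has_derivative[of j "f x"] by (simp add: has_field_derivative_def)
      from has_derivative_compose[OF C_k_has_derivative[OF f] this] show ?thesis .
    qed
  next
    fix v
    show "C_k k (\<lambda>x. (flat_exp (j + 2) (f x) + (- of_nat j) * flat_exp (Suc j) (f x))
             * frechet_derivative f (at x) v)"
    proof (intro C_k_mult C_k_add C_k_const Suc.IH Suc.prems)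
      show "C_k k (\<lambda>x. frechet_derivative f (at x) v)"
        using f[of "Suc k"] unfolding C_k.simps by blast
    qed
  qed
qed

lemma C_k_affine: "C_k k f \<Longrightarrow> C_k k (\<lambda>x. f (r *\<^sub>R x + z))"
proof (induction k arbitrary: f)
  case 0
  then show ?case by (auto intro!: continuous_on_compose2[of UNIV f] continuous_intros)
next
  case (Suc k)
  show ?case
  proof (rule C_k_SucI)
    fix x
    have "((\<lambda>x. r *\<^sub>R x + z) has_derivative (\<lambda>v. r *\<^sub>R v)) (at x)"
      by (auto intro!: derivative_eq_intros)
    from has_derivative_compose[OF this C_k_has_derivative[OF Suc.prems]]
    show "((\<lambda>x. f (r *\<^sub>R x + z)) has_derivative (\<lambda>v. frechet_derivative f (at (r *\<^sub>R x + z)) (r *\<^sub>R v))) (at x)" .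
  next
    fix v
    show "C_k k (\<lambda>x. frechet_derivative f (at (r *\<^sub>R x + z)) (r *\<^sub>R v))"
      using Suc.IH[of "\<lambda>x. frechet_derivative f (at x) (r *\<^sub>R v)"] Suc.prems by simp
  qed
qed

lemma smooth_const: "smooth_fun (\<lambda>x. c)"
  and smooth_add: "smooth_fun f \<Longrightarrow> smooth_fun g \<Longrightarrow> smooth_fun (\<lambda>x. f x + g x)"
  and smooth_mult: "smooth_fun f \<Longrightarrow> smooth_fun g \<Longrightarrow> smooth_fun (\<lambda>x. f x * g x)"
  and smooth_inner: "smooth_fun (\<lambda>x. x \<bullet> w)"
  and smooth_inner_self: "smooth_fun (\<lambda>x. x \<bullet> x)"
  and smooth_flat_exp: "smooth_fun f \<Longrightarrow> smooth_fun (\<lambda>x. flat_exp j (f x))"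
  and smooth_affine: "smooth_fun f \<Longrightarrow> smooth_fun (\<lambda>x. f (r *\<^sub>R x + z))"
  by (auto simp: smooth_fun_def C_k_const C_k_add C_k_mult C_k_inner C_k_inner_self C_k_affine
      intro: C_k_flat_exp)

lemma smooth_continuous: "smooth_fun f \<Longrightarrow> continuous_on A f"
  unfolding smooth_fun_def using C_k.simps(1) continuous_on_subset[of UNIV f A] by blast

lemma inner_grad: "(f has_derivative D) (at x) \<Longrightarrow> grad f x \<bullet> v = D v"
proof -
  assume D: "(f has_derivative D) (at x)"
  then interpret bounded_linear D by (rule has_derivative_bounded_linear)
  have "D v = D (\<Sum>i\<in>UNIV. (v $ i) *\<^sub>R axis i 1)"
    by (simp add: basis_expansion flip: scalar_mult_eq_scaleR)
  also have "\<dots> = (\<Sum>i\<in>UNIV. (v $ i) * D (axis i 1))"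
    by (simp add: sum scaleR)
  finally show ?thesis
    by (simp add: grad_def frechet_derivative_eqI[OF D] inner_vec_def mult.commute)
qed

lemma grad_eqI: "(f has_derivative (\<lambda>v. g \<bullet> v)) (at x) \<Longrightarrow> grad f x = g"
  by (subst vector_eq_rdot[symmetric]) (auto dest: inner_grad)

lemma smooth_has_derivative: "smooth_fun f \<Longrightarrow> (f has_derivative (\<lambda>v. grad f x \<bullet> v)) (at x)"
proof -
  assume "smooth_fun f"
  then have "(f has_derivative frechet_derivative f (at x)) (at x)"
    unfolding smooth_fun_def using C_k_has_derivative by blast
  with inner_grad[OF this] show ?thesis by simp
qed

lemma smooth_grad_nth: "smooth_fun f \<Longrightarrow> smooth_fun (\<lambda>x. grad f x $ i)"
proof -
  assume f: "smooth_fun f"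
  have "C_k k (\<lambda>x. grad f x $ i)" for k
  proof -
    have "C_k (Suc k) f" using f unfolding smooth_fun_def by blast
    then show ?thesis by (simp add: grad_def)
  qed
  then show ?thesis by (simp add: smooth_fun_def)
qed

lemma continuous_on_grad: "smooth_fun f \<Longrightarrow> continuous_on A (grad f)"
proof -
  assume "smooth_fun f"
  then have "continuous_on A (\<lambda>x. \<chi> i. grad f x $ i)"
    by (intro continuous_on_vec_lambda smooth_continuous smooth_grad_nth)
  then show ?thesis by simp
qed

text \<open>Any compact superset of the support inside \<open>\<Omega>\<close> is a sufficient
  witness; closures of supports disappear from the later proofs.\<close>

lemma test_functions_iff:
  "\<phi> \<in> test_functions \<Omega> \<longleftrightarrow> smooth_fun \<phi> \<and> (\<exists>K. compact K \<and> K \<subseteq> \<Omega> \<and> (\<forall>x. x \<notin> K \<longrightarrow> \<phi> x = 0))"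
proof
  assume "\<phi> \<in> test_functions \<Omega>"
  then show "smooth_fun \<phi> \<and> (\<exists>K. compact K \<and> K \<subseteq> \<Omega> \<and> (\<forall>x. x \<notin> K \<longrightarrow> \<phi> x = 0))"
    using closure_subset[of "{x. \<phi> x \<noteq> 0}"]
    by (auto simp: test_functions_def smooth_fun_def intro!: exI[of _ "closure {x. \<phi> x \<noteq> 0}"])
next
  assume "smooth_fun \<phi> \<and> (\<exists>K. compact K \<and> K \<subseteq> \<Omega> \<and> (\<forall>x. x \<notin> K \<longrightarrow> \<phi> x = 0))"
  then obtain K where K: "smooth_fun \<phi>" "compact K" "K \<subseteq> \<Omega>" "\<And>x. x \<notin> K \<Longrightarrow> \<phi> x = 0" by auto
  then have "closure {x. \<phi> x \<noteq> 0} \<subseteq> K"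
    by (intro closure_minimal) (auto simp: compact_imp_closed)
  moreover have "bounded {x. \<phi> x \<noteq> 0}"
    by (rule bounded_subset[OF compact_imp_bounded[OF K(2)]]) (use K in blast)
  ultimately show "\<phi> \<in> test_functions \<Omega>"
    using K(1,3) unfolding test_functions_def smooth_fun_def by (simp add: compact_closure)
qed

lemma grad_eq_0_outside:
  assumes "closed K" "\<And>x. x \<notin> K \<Longrightarrow> \<phi> x = 0" "x \<notin> K"
  shows "grad \<phi> x = 0"
proof (rule grad_eqI)
  have "(\<phi> has_derivative (\<lambda>v. 0)) (at x)"
    by (rule has_derivative_transform_within_open[where f="\<lambda>_. 0" and s="- K"]) (use assms in auto)
  then show "(\<phi> has_derivative (\<lambda>v. 0 \<bullet> v)) (at x)" by (simp only: inner_zero_left)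
qed

text \<open>The squared norm is a polynomial, which keeps the radial function smooth at its
  centre.\<close>

definition bump :: "real^'n \<Rightarrow> real \<Rightarrow> real^'n \<Rightarrow> real" where
  "bump z R y = flat_exp 0 (1 - (norm (y - z))\<^sup>2 / R\<^sup>2)"

lemma smooth_bump: "smooth_fun (bump z R)"
proof -
  have "smooth_fun (\<lambda>y. 1 + (- 1 / R\<^sup>2) * ((1 *\<^sub>R y + (- z)) \<bullet> (1 *\<^sub>R y + (- z))))"
    by (intro smooth_add smooth_mult smooth_const smooth_affine smooth_inner_self)
  moreover have "(\<lambda>y. 1 + (- 1 / R\<^sup>2) * ((1 *\<^sub>R y + (- z)) \<bullet> (1 *\<^sub>R y + (- z))))
      = (\<lambda>y. 1 - (norm (y - z))\<^sup>2 / R\<^sup>2)"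
    by (simp add: power2_norm_eq_inner)
  ultimately show ?thesis
    using smooth_flat_exp[of _ 0] unfolding bump_def by simp
qed

lemma bump_nonneg: "bump z R y \<ge> 0" and bump_le_1: "bump z R y \<le> 1"
  by (auto simp: bump_def flat_exp_nonneg flat_exp_0_le_1)

lemma bump_eq_0: "R > 0 \<Longrightarrow> norm (y - z) \<ge> R \<Longrightarrow> bump z R y = 0"
proof -
  assume R: "R > 0" "norm (y - z) \<ge> R"
  then have "R\<^sup>2 \<le> (norm (y - z))\<^sup>2" by (intro power_mono) auto
  then have "1 - (norm (y - z))\<^sup>2 / R\<^sup>2 \<le> 0" using R by auto
  then show ?thesis unfolding bump_def flat_exp_def by simp
qed

text \<open>On the half ball the argument of \<open>flat_exp 0\<close> is at least
  \<open>1 - 1/4 = 3/4\<close>, and \<open>flat_exp 0 (3/4)\<close> is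
  \<open>exp (- (4/3))\<close>.\<close>

lemma bump_ge: "R > 0 \<Longrightarrow> norm (y - z) \<le> R / 2 \<Longrightarrow> bump z R y \<ge> exp (- (4/3))"
proof -
  assume a: "R > 0" "norm (y - z) \<le> R / 2"
  then have "(norm (y - z))\<^sup>2 \<le> (R / 2)\<^sup>2" by (intro power_mono) auto
  then have "1 - (norm (y - z))\<^sup>2 / R\<^sup>2 \<ge> 3 / 4"
    using a by (auto simp: field_simps power2_eq_square)
  then have "flat_exp 0 (3/4) \<le> bump z R y" unfolding bump_def by (rule flat_exp_mono)
  then show ?thesis by (simp add: flat_exp_def)
qed

lemma bump_has_derivative:
  "(bump z R has_derivative
     (\<lambda>v. (- 2 / R\<^sup>2 * flat_exp 2 (1 - (norm (y - z))\<^sup>2 / R\<^sup>2)) *\<^sub>R (y - z) \<bullet> v)) (at y)"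
proof -
  have "((\<lambda>y. 1 - (y - z) \<bullet> (y - z) / R\<^sup>2) has_derivative (\<lambda>v. - ((2 * ((y - z) \<bullet> v)) / R\<^sup>2))) (at y)"
    by (cases "R = 0") (auto intro!: derivative_eq_intros simp: inner_commute field_simps)
  from has_derivative_compose[OF this flat_exp_0_has_derivative[unfolded has_field_derivative_def]]
  show ?thesis unfolding bump_def power2_norm_eq_inner by (simp add: mult_ac)
qed

lemma grad_bump: "grad (bump z R) y = (- 2 / R\<^sup>2 * flat_exp 2 (1 - (norm (y - z))\<^sup>2 / R\<^sup>2)) *\<^sub>R (y - z)"
  by (rule grad_eqI[OF bump_has_derivative])

text \<open>Inside the ball the factors are \<open>2 / R\<^sup>2\<close>, the bound
  \<open>fact 2\<close> on \<open>flat_exp 2\<close>, and \<open>norm (y - z) < R\<close>; outside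
  it \<open>flat_exp 2\<close> vanishes.\<close>

lemma norm_grad_bump: "R > 0 \<Longrightarrow> norm (grad (bump z R) y) \<le> 4 / R"
proof -
  assume R: "R > 0"
  show ?thesis
  proof (cases "norm (y - z) < R")
    case True
    have "norm (grad (bump z R) y) = 2 / R\<^sup>2 * flat_exp 2 (1 - (norm (y - z))\<^sup>2 / R\<^sup>2) * norm (y - z)"
      by (simp add: grad_bump abs_mult flat_exp_nonneg)
    also have "\<dots> \<le> 2 / R\<^sup>2 * 2 * R"
      using True flat_exp_le[of 2] R by (intro mult_mono) (auto simp: numeral_2_eq_2 flat_exp_nonneg)
    finally show ?thesis using R by (simp add: power2_eq_square)
  next
    case False
    then have "1 - (norm (y - z))\<^sup>2 / R\<^sup>2 \<le> 0" using R power_mono[of R "norm (y - z)" 2] by auto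
    then have "flat_exp 2 (1 - (norm (y - z))\<^sup>2 / R\<^sup>2) = 0" unfolding flat_exp_def by simp
    then show ?thesis using R by (simp add: grad_bump)
  qed
qed

lemma grad_mult: "smooth_fun f \<Longrightarrow> smooth_fun g \<Longrightarrow>
   grad (\<lambda>x. f x * g x) x = f x *\<^sub>R grad g x + g x *\<^sub>R grad f x"
  by (rule grad_eqI) (use has_derivative_mult[OF smooth_has_derivative smooth_has_derivative]
      in \<open>auto simp: inner_add_left mult.commute\<close>)

section \<open>Translations and mollification\<close>

lemma nn_integral_shift:
  fixes f :: "'a::euclidean_space \<Rightarrow> ennreal"
  assumes [measurable]: "f \<in> borel_measurable borel"
  shows "(\<integral>\<^sup>+x. f (x + h) \<partial>lborel) = (\<integral>\<^sup>+x. f x \<partial>lborel)"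
proof -
  have "(\<integral>\<^sup>+x. f x \<partial>lborel) = (\<integral>\<^sup>+x. f x \<partial>distr lborel borel ((+) h))"
    by (simp add: lborel_distr_plus)
  also have "\<dots> = (\<integral>\<^sup>+x. f (x + h) \<partial>lborel)"
    by (subst nn_integral_distr) (auto simp: add.commute)
  finally show ?thesis by simp
qed

lemma
  fixes f :: "'a::euclidean_space \<Rightarrow> 'b::{banach, second_countable_topology}"
  assumes [measurable]: "f \<in> borel_measurable borel" and t: "t \<noteq> 0"
  shows integrable_affine_iff:
      "integrable lborel (\<lambda>z. f (x + t *\<^sub>R z)) \<longleftrightarrow> integrable lborel f"
    and integral_affine:
      "(LBINT z. f (x + t *\<^sub>R z)) = (1 / \<bar>t\<bar> ^ DIM('a)) *\<^sub>R (LBINT y. f y)"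
proof -
  let ?D = "distr lborel borel (\<lambda>z. x + t *\<^sub>R z) :: 'a measure"
  have eq: "(lborel :: 'a measure) = density ?D (\<lambda>_. ennreal (\<bar>t\<bar> ^ DIM('a)))"
    using lborel_affine[OF t, of x] by simp
  have "integrable lborel f \<longleftrightarrow> integrable ?D (\<lambda>z. (\<bar>t\<bar> ^ DIM('a)) *\<^sub>R f z)"
    by (subst eq, subst integrable_density) auto
  also have "\<dots> \<longleftrightarrow> integrable lborel (\<lambda>z. (\<bar>t\<bar> ^ DIM('a)) *\<^sub>R f (x + t *\<^sub>R z))"
    by (subst integrable_distr_eq) auto
  also have "\<dots> \<longleftrightarrow> integrable lborel (\<lambda>z. f (x + t *\<^sub>R z))"
    using t integrable_scaleR_right[of "1 / \<bar>t\<bar> ^ DIM('a)" lborel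
        "\<lambda>z. (\<bar>t\<bar> ^ DIM('a)) *\<^sub>R f (x + t *\<^sub>R z)"] by auto
  finally show "integrable lborel (\<lambda>z. f (x + t *\<^sub>R z)) \<longleftrightarrow> integrable lborel f" by simp
  have "(LBINT y. f y) = (\<integral>z. (\<bar>t\<bar> ^ DIM('a)) *\<^sub>R f z \<partial>?D)"
    by (subst eq, subst integral_density) auto
  also have "\<dots> = (LBINT z. (\<bar>t\<bar> ^ DIM('a)) *\<^sub>R f (x + t *\<^sub>R z))"
    by (subst integral_distr) auto
  finally show "(LBINT z. f (x + t *\<^sub>R z)) = (1 / \<bar>t\<bar> ^ DIM('a)) *\<^sub>R (LBINT y. f y)"
    using t by simp
qed

text \<open>Squeeze \<open>A\<close> between a compact \<open>K\<close> and an open \<open>U\<close>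
  with \<open>U - K\<close> small. A shift shorter than the distance from \<open>K\<close> to the
  complement of \<open>U\<close> changes the indicator only on \<open>U - K\<close> and on its
  translate.\<close>

lemma translation_indicator_L1:
  fixes A :: "'a::euclidean_space set" and c :: "'b::{banach, second_countable_topology}"
  assumes A: "A \<in> sets lborel" "emeasure lborel A < \<infinity>" and "e > (0::real)"
  shows "\<exists>d>0. \<forall>h. norm h < d \<longrightarrow>
    (\<integral>\<^sup>+x. norm (indicator A (x + h) *\<^sub>R c - indicator A x *\<^sub>R c) \<partial>lborel) \<le> ennreal e"
proof -
  \<comment> \<open>The \<open>4\<close> pays for two copies of \<open>U - K\<close>, each of
    measure at most \<open>2 * r\<close>; the added \<open>1\<close> covers
    \<open>c = 0\<close>.\<close>
  define r where "r = e / (4 * (norm c + 1))"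
  have r: "r > 0" using \<open>e > 0\<close> by (simp add: r_def add_nonneg_pos)
  have A': "A \<in> sets borel" "A \<in> sets lebesgue" using A by auto
  \<comment> \<open>Inner regularity asks for a finite measure, so Lebesgue measure is first
    restricted to \<open>A\<close>.\<close>
  let ?M = "density lborel (indicator A)"
  have MB: "emeasure ?M B = emeasure lborel (A \<inter> B)" if "B \<in> sets borel" for B
  proof -
    have "emeasure ?M B = (\<integral>\<^sup>+x. indicator (A \<inter> B) x \<partial>lborel)"
      using that A by (simp add: emeasure_density indicator_inter_arith)
    also have "\<dots> = emeasure lborel (A \<inter> B)"
      using that A by (intro nn_integral_indicator) auto
    finally show ?thesis .
  qed
  have "emeasure ?M A = (SUP K\<in>{K. K \<subseteq> A \<and> compact K}. emeasure ?M K)"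
    using A MB[of UNIV] by (intro inner_regular) (auto simp: less_top[symmetric])
  then have "emeasure lborel A = (SUP K\<in>{K. K \<subseteq> A \<and> compact K}. emeasure ?M K)"
    using A' MB[of A] by simp
  note sup = this
  have "\<exists>K\<in>{K. K \<subseteq> A \<and> compact K}. emeasure lborel A < emeasure ?M K + ennreal r"
  proof (rule SUP_approx_ennreal[OF r _ sup])
    show "{K. K \<subseteq> A \<and> compact K} \<noteq> {}" by (auto intro: exI[of _ "{}"])
    show "emeasure lborel A \<noteq> \<infinity>" using A(2) by simp
  qed
  then obtain K where K: "K \<subseteq> A" "compact K" "emeasure lborel A < emeasure ?M K + ennreal r"
    by blast
  have Kb: "K \<in> sets borel" using K(2) by (simp add: compact_imp_closed)
  have MK: "emeasure ?M K = emeasure lborel K" using MB[OF Kb] K(1) by (simp add: Int_absorb1)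
  have AK: "emeasure lborel (A - K) \<le> ennreal r"
  proof -
    have fin: "emeasure lborel K < \<infinity>"
      using emeasure_mono[OF K(1), of lborel] A by (auto intro: le_less_trans)
    have "emeasure lborel (A - K) = emeasure lborel A - emeasure lborel K"
      using Kb A K(1) fin by (intro emeasure_Diff) auto
    also have "\<dots> \<le> ennreal r"
      using K(3) fin unfolding MK by (simp add: ennreal_minus_le_iff less_top add.commute)
    finally show ?thesis .
  qed
  obtain U where U: "open U" "A \<subseteq> U" "emeasure lebesgue (U - A) < ennreal r"
    using sets_lebesgue_outer_open[OF A'(2) r] by metis
  have UA: "emeasure lborel (U - A) \<le> ennreal r"
    using U A' by (simp add: emeasure_completion main_part_sets)
  have UK: "emeasure lborel (U - K) \<le> ennreal (2 * r)"
  proof -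
    have "emeasure lborel (U - K) \<le> emeasure lborel ((A - K) \<union> (U - A))"
      using A' Kb U(1) by (intro emeasure_mono) auto
    also have "\<dots> \<le> emeasure lborel (A - K) + emeasure lborel (U - A)"
      using A' Kb U(1) by (intro emeasure_subadditive) auto
    also have "\<dots> \<le> ennreal r + ennreal r" by (intro add_mono AK UA)
    also have "\<dots> = ennreal (2 * r)" using r by (simp flip: ennreal_plus)
    finally show ?thesis .
  qed
  obtain d where d: "d > 0" "\<And>x y. x \<in> K \<Longrightarrow> y \<in> - U \<Longrightarrow> d \<le> dist x y"
  proof -
    have "closed (- U)" "K \<inter> - U = {}" using U K(1) by auto
    from separate_compact_closed[OF K(2) this] show ?thesis using that by blast
  qed
  have [measurable]: "U - K \<in> sets borel" "A \<in> sets borel" using U(1) Kb A' by auto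
  show ?thesis
  proof (intro exI conjI allI impI)
    show "d > 0" by fact
    fix h :: 'a assume h: "norm h < d"
    have near: "x + h \<in> U" if "x \<in> K" for x
      using d(2)[OF that, of "x + h"] h by (force simp: dist_norm)
    have near': "x \<in> U" if "x + h \<in> K" for x
      using d(2)[OF that, of x] h by (force simp: dist_norm)
    have *: "norm (indicator A (x + h) *\<^sub>R c - indicator A x *\<^sub>R c)
        \<le> norm c * (indicator (U - K) x + indicator (U - K) (x + h))" for x
      using near near' U(2) K(1) by (auto simp: indicator_def)
    then have "(\<integral>\<^sup>+x. norm (indicator A (x + h) *\<^sub>R c - indicator A x *\<^sub>R c) \<partial>lborel)
        \<le> (\<integral>\<^sup>+x. ennreal (norm c) * (indicator (U - K) x + indicator (U - K) (x + h)) \<partial>lborel)"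
    proof (intro nn_integral_mono)
      fix x
      have "ennreal (norm c) * (indicator (U - K) x + indicator (U - K) (x + h))
          = ennreal (norm c * (indicator (U - K) x + indicator (U - K) (x + h)))"
        by (simp add: ennreal_mult' ennreal_indicator)
      then show "ennreal (norm (indicator A (x + h) *\<^sub>R c - indicator A x *\<^sub>R c))
          \<le> ennreal (norm c) * (indicator (U - K) x + indicator (U - K) (x + h))"
        using * by (simp only: ennreal_leI)
    qed
    also have "\<dots> = ennreal (norm c) * (2 * emeasure lborel (U - K))"
      using nn_integral_shift[of "indicator (U - K)" h]
      by (simp add: nn_integral_cmult nn_integral_add mult_2)
    also have "\<dots> \<le> ennreal (norm c) * (2 * ennreal (2 * r))"
      by (intro mult_left_mono UK) auto
    also have "\<dots> = ennreal (norm c * 4 * r)"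
    proof -
      have "ennreal (norm c * 4 * r) = ennreal (norm c * (2 * (2 * r)))" by (simp add: mult.assoc)
      also have "\<dots> = ennreal (norm c) * (ennreal 2 * ennreal (2 * r))"
        using r by (simp only: ennreal_mult norm_ge_zero mult_nonneg_nonneg less_imp_le zero_less_numeral)
      finally show ?thesis by simp
    qed
    also have "\<dots> \<le> ennreal e"
    proof (intro ennreal_leI)
      have "norm c * 4 * r \<le> (norm c + 1) * 4 * r" using r by (intro mult_right_mono) auto
      also have "\<dots> = e" using norm_ge_zero[of c] by (simp add: r_def field_simps add_nonneg_eq_0_iff)
      finally show "norm c * 4 * r \<le> e" .
    qed
    finally show "(\<integral>\<^sup>+x. norm (indicator A (x + h) *\<^sub>R c - indicator A x *\<^sub>R c) \<partial>lborel) \<le> ennreal e" .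
  qed
qed

text \<open>The property passes from indicators to sums, and to dominated limits because a
  translation preserves the \<open>L\<^sup>1\<close> distance: two thirds of \<open>e\<close> go to
  the approximation, one third to the shifted approximant.\<close>

lemma translation_L1:
  fixes g :: "'a::euclidean_space \<Rightarrow> 'b::{banach, second_countable_topology}"
  assumes "integrable lborel g" "e > (0::real)"
  shows "\<exists>d>0. \<forall>h. norm h < d \<longrightarrow> (\<integral>\<^sup>+x. norm (g (x + h) - g x) \<partial>lborel) \<le> ennreal e"
  using assms
proof (induction g arbitrary: e rule: integrable_induct)
  case (base A c)
  then show ?case by (intro translation_indicator_L1)
next
  case (add f g)
  have [measurable]: "f \<in> borel_measurable borel" "g \<in> borel_measurable borel" using add by auto
  have e2: "e / 2 > 0" using \<open>e > 0\<close> by simp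
  obtain d1 where d1: "d1 > 0"
    "\<And>h. norm h < d1 \<Longrightarrow> (\<integral>\<^sup>+x. norm (f (x + h) - f x) \<partial>lborel) \<le> ennreal (e / 2)"
    using add.IH(1)[OF e2] by blast
  obtain d2 where d2: "d2 > 0"
    "\<And>h. norm h < d2 \<Longrightarrow> (\<integral>\<^sup>+x. norm (g (x + h) - g x) \<partial>lborel) \<le> ennreal (e / 2)"
    using add.IH(2)[OF e2] by blast
  note d = d1 d2
  show ?case
  proof (intro exI conjI allI impI)
    show "min d1 d2 > 0" using d by simp
    fix h :: 'a assume h: "norm h < min d1 d2"
    have "(\<integral>\<^sup>+x. norm (f (x + h) + g (x + h) - (f x + g x)) \<partial>lborel)
       \<le> (\<integral>\<^sup>+x. ennreal (norm (f (x + h) - f x)) + ennreal (norm (g (x + h) - g x)) \<partial>lborel)"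
      by (intro nn_integral_mono)
         (auto simp: ennreal_plus[symmetric] add_diff_add simp del: ennreal_plus intro!: ennreal_leI norm_triangle_ineq)
    also have "\<dots> = (\<integral>\<^sup>+x. norm (f (x + h) - f x) \<partial>lborel) + (\<integral>\<^sup>+x. norm (g (x + h) - g x) \<partial>lborel)"
      by (intro nn_integral_add) auto
    also have "\<dots> \<le> ennreal (e / 2) + ennreal (e / 2)" using h d by (intro add_mono) auto
    also have "\<dots> = ennreal e" using \<open>e > 0\<close> by (simp flip: ennreal_plus)
    finally show "(\<integral>\<^sup>+x. norm (f (x + h) + g (x + h) - (f x + g x)) \<partial>lborel) \<le> ennreal e" .
  qed
next
  case (lim f s)
  have [measurable]: "f \<in> borel_measurable borel" "\<And>i. s i \<in> borel_measurable borel" using lim by auto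
  have "(\<lambda>i. \<integral>\<^sup>+x. norm (f x - s i x) \<partial>lborel) \<longlonglongrightarrow> 0"
  proof (rule nn_integral_dominated_convergence_norm[where w="\<lambda>x. 2 * norm (f x)"])
    show "(\<integral>\<^sup>+x. ennreal (2 * norm (f x)) \<partial>lborel) < \<infinity>"
      using lim.hyps(4) by (auto simp: integrable_iff_bounded ennreal_mult' nn_integral_cmult ennreal_mult_less_top)
  qed (use lim.hyps in auto)
  then have "eventually (\<lambda>i. (\<integral>\<^sup>+x. norm (f x - s i x) \<partial>lborel) < ennreal (e / 3)) sequentially"
    using \<open>e > 0\<close> by (intro order_tendstoD) auto
  then obtain i where i: "(\<integral>\<^sup>+x. norm (f x - s i x) \<partial>lborel) \<le> ennreal (e / 3)"
    by (auto simp: eventually_sequentially intro: less_imp_le)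
  from lim.IH[of "e / 3" i] \<open>e > 0\<close> obtain d where d: "d > 0"
    "\<And>h. norm h < d \<Longrightarrow> (\<integral>\<^sup>+x. norm (s i (x + h) - s i x) \<partial>lborel) \<le> ennreal (e / 3)" by auto
  show ?case
  proof (intro exI conjI allI impI)
    show "d > 0" by fact
    fix h :: 'a assume h: "norm h < d"
    have "norm (f (x + h) - f x)
      \<le> norm (f (x + h) - s i (x + h)) + (norm (s i (x + h) - s i x) + norm (f x - s i x))" for x
      by norm
    then have "(\<integral>\<^sup>+x. norm (f (x + h) - f x) \<partial>lborel)
       \<le> (\<integral>\<^sup>+x. ennreal (norm (f (x + h) - s i (x + h)))
           + (ennreal (norm (s i (x + h) - s i x)) + ennreal (norm (f x - s i x))) \<partial>lborel)"
      by (intro nn_integral_mono)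
         (auto simp: ennreal_plus[symmetric] simp del: ennreal_plus intro!: ennreal_leI)
    also have "\<dots> = (\<integral>\<^sup>+x. norm (f (x + h) - s i (x + h)) \<partial>lborel)
      + ((\<integral>\<^sup>+x. norm (s i (x + h) - s i x) \<partial>lborel) + (\<integral>\<^sup>+x. norm (f x - s i x) \<partial>lborel))"
      by (simp add: nn_integral_add)
    also have "(\<integral>\<^sup>+x. norm (f (x + h) - s i (x + h)) \<partial>lborel) = (\<integral>\<^sup>+x. norm (f x - s i x) \<partial>lborel)"
      by (intro nn_integral_shift[where f="\<lambda>x. ennreal (norm (f x - s i x))"]) auto
    also have "(\<integral>\<^sup>+x. norm (f x - s i x) \<partial>lborel)
      + ((\<integral>\<^sup>+x. norm (s i (x + h) - s i x) \<partial>lborel) + (\<integral>\<^sup>+x. norm (f x - s i x) \<partial>lborel))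
      \<le> ennreal (e / 3) + (ennreal (e / 3) + ennreal (e / 3))"
      using h d i by (intro add_mono) auto
    also have "\<dots> = ennreal e" using \<open>e > 0\<close> by (simp flip: ennreal_plus)
    finally show "(\<integral>\<^sup>+x. norm (f (x + h) - f x) \<partial>lborel) \<le> ennreal e" .
  qed
qed

text \<open>The average of \<open>g\<close> near \<open>x\<close> at scale \<open>t\<close> with
  profile \<open>k\<close>. The profile may sit away from the origin, and then the average is over a
  ball displaced in the direction of a cone.\<close>

definition smear :: "('a::euclidean_space \<Rightarrow> real) \<Rightarrow> real \<Rightarrow> ('a \<Rightarrow> 'b::euclidean_space) \<Rightarrow> 'a \<Rightarrow> 'b" where
  "smear k t g x = (LBINT z. k z *\<^sub>R g (x + t *\<^sub>R z))"

definition mass_kernel :: "('a::euclidean_space \<Rightarrow> real) \<Rightarrow> bool" where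
  "mass_kernel k \<longleftrightarrow> k \<in> borel_measurable borel \<and> (\<forall>z. 0 \<le> k z) \<and> (\<exists>B. \<forall>z. k z \<le> B) \<and>
     (\<exists>r. \<forall>z. norm z > r \<longrightarrow> k z = 0) \<and> integrable lborel k \<and> (LBINT z. k z) = 1"

lemma smear_measurable:
  assumes [measurable]: "k \<in> borel_measurable borel" "g \<in> borel_measurable borel"
  shows "smear k t g \<in> borel_measurable borel"
proof -
  have "(\<lambda>x. LBINT z. k z *\<^sub>R g (x + t *\<^sub>R z)) \<in> borel_measurable borel"
    by (rule lborel.borel_measurable_lebesgue_integral) measurable
  then show ?thesis by (simp add: smear_def[abs_def])
qed

lemma smear_integrable:
  fixes g :: "'a::euclidean_space \<Rightarrow> 'b::euclidean_space"
  assumes k: "mass_kernel k" and g: "integrable lborel g" and t: "t \<noteq> 0"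
  shows "integrable lborel (\<lambda>z. k z *\<^sub>R g (x + t *\<^sub>R z))"
proof -
  have [measurable]: "g \<in> borel_measurable borel" using g by auto
  obtain B where B: "\<And>z. k z \<le> B" and k0: "\<And>z. k z \<ge> 0" and [measurable]: "k \<in> borel_measurable borel"
    using k unfolding mass_kernel_def by auto
  have "integrable lborel (\<lambda>z. B *\<^sub>R g (x + t *\<^sub>R z))"
    using g t by (simp add: integrable_affine_iff)
  then show ?thesis
    by (rule Bochner_Integration.integrable_bound)
      (use B k0 order_trans[OF k0 B] in \<open>auto intro!: mult_right_mono\<close>)
qed

text \<open>By Fubini the distance is at most the \<open>k\<close>-weighted mean of the translation
  distances by \<open>t *\<^sub>R z\<close>, and \<open>k\<close> confines \<open>z\<close> to a
  bounded set.\<close>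

lemma mollify_L1:
  fixes g :: "'a::euclidean_space \<Rightarrow> 'b::euclidean_space"
  assumes k: "mass_kernel k" and g: "integrable lborel g" and e: "e > (0::real)"
  shows "\<exists>d>0. \<forall>t. t \<noteq> 0 \<longrightarrow> \<bar>t\<bar> < d \<longrightarrow> (\<integral>\<^sup>+x. norm (smear k t g x - g x) \<partial>lborel) \<le> ennreal e"
proof -
  obtain d0 where d0: "d0 > 0"
      "\<And>h. norm h < d0 \<Longrightarrow> (\<integral>\<^sup>+x. norm (g (x + h) - g x) \<partial>lborel) \<le> ennreal e"
    using translation_L1[OF g e] by auto
  obtain r where r: "\<And>z. norm z > r \<Longrightarrow> k z = 0" using k unfolding mass_kernel_def by auto
  have k0: "\<And>z. k z \<ge> 0" and kint: "integrable lborel k" and k1: "(LBINT z. k z) = 1"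
    and [measurable]: "k \<in> borel_measurable borel"
    using k unfolding mass_kernel_def by auto
  have [measurable]: "g \<in> borel_measurable borel" using g by auto
  \<comment> \<open>Nothing makes \<open>r\<close> positive; the maximum is a legitimate
    divisor.\<close>
  define R where "R = max r 1"
  show ?thesis
  proof (intro exI conjI allI impI)
    show "d0 / R > 0" using d0 by (simp add: R_def)
    fix t :: real assume t0: "t \<noteq> 0" and t: "\<bar>t\<bar> < d0 / R"
    have "(\<integral>\<^sup>+x. norm (smear k t g x - g x) \<partial>lborel)
       \<le> (\<integral>\<^sup>+x. \<integral>\<^sup>+z. ennreal (k z) * ennreal (norm (g (x + t *\<^sub>R z) - g x)) \<partial>lborel \<partial>lborel)"
    proof (intro nn_integral_mono)
      fix x
      have i1: "integrable lborel (\<lambda>z. k z *\<^sub>R g (x + t *\<^sub>R z))" by (rule smear_integrable[OF k g t0])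
      have i2: "integrable lborel (\<lambda>z. k z *\<^sub>R g x)" using kint by simp
      have "smear k t g x - g x = (LBINT z. k z *\<^sub>R g (x + t *\<^sub>R z) - k z *\<^sub>R g x)"
        using i1 i2 k1 kint by (simp add: smear_def)
      then have "ennreal (norm (smear k t g x - g x))
          \<le> (\<integral>\<^sup>+z. norm (k z *\<^sub>R g (x + t *\<^sub>R z) - k z *\<^sub>R g x) \<partial>lborel)"
        using integral_norm_bound_ennreal[OF Bochner_Integration.integrable_diff[OF i1 i2]] by simp
      also have "\<dots> = (\<integral>\<^sup>+z. ennreal (k z) * ennreal (norm (g (x + t *\<^sub>R z) - g x)) \<partial>lborel)"
        using k0 by (intro nn_integral_cong) (simp add: ennreal_mult'[symmetric] flip: scaleR_diff_right)
      finally show "ennreal (norm (smear k t g x - g x)) \<le> \<dots>" .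
    qed
    also have "\<dots> = (\<integral>\<^sup>+z. \<integral>\<^sup>+x. ennreal (k z) * ennreal (norm (g (x + t *\<^sub>R z) - g x)) \<partial>lborel \<partial>lborel)"
      by (rule lborel_pair.Fubini'[symmetric]) measurable
    also have "\<dots> \<le> (\<integral>\<^sup>+z. ennreal (k z) * ennreal e \<partial>lborel)"
    proof (intro nn_integral_mono)
      fix z
      have "(\<integral>\<^sup>+x. ennreal (k z) * ennreal (norm (g (x + t *\<^sub>R z) - g x)) \<partial>lborel)
         = ennreal (k z) * (\<integral>\<^sup>+x. ennreal (norm (g (x + t *\<^sub>R z) - g x)) \<partial>lborel)"
        by (rule nn_integral_cmult) measurable
      also have "\<dots> \<le> ennreal (k z) * ennreal e"
      proof (cases "norm z > r")
        case False
        have "norm (t *\<^sub>R z) \<le> \<bar>t\<bar> * R" using False by (auto simp: R_def intro!: mult_left_mono)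
        also have "\<dots> < d0" using t by (simp add: R_def field_simps)
        finally show ?thesis by (intro mult_left_mono d0) auto
      qed (simp add: r)
      finally show "(\<integral>\<^sup>+x. ennreal (k z) * ennreal (norm (g (x + t *\<^sub>R z) - g x)) \<partial>lborel)
        \<le> ennreal (k z) * ennreal e" .
    qed
    also have "\<dots> = ennreal e"
      using k0 kint k1 by (simp add: nn_integral_multc nn_integral_eq_integral)
    finally show "(\<integral>\<^sup>+x. norm (smear k t g x - g x) \<partial>lborel) \<le> ennreal e" .
  qed
qed

text \<open>Jensen's inequality for the probability density \<open>k\<close>, obtained from
  Cauchy-Schwarz by splitting \<open>k\<close> into two square roots, followed by Fubini and
  translation invariance.\<close>

lemma smear_square_le:
  fixes g :: "'a::euclidean_space \<Rightarrow> 'b::euclidean_space"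
  assumes k: "mass_kernel k" and [measurable]: "g \<in> borel_measurable borel"
  shows "(\<integral>\<^sup>+x. (ennreal (norm (smear k t g x)))\<^sup>2 \<partial>lborel) \<le> (\<integral>\<^sup>+x. (ennreal (norm (g x)))\<^sup>2 \<partial>lborel)"
proof -
  have k0: "\<And>z. k z \<ge> 0" and kint: "integrable lborel k" and k1: "(LBINT z. k z) = 1"
    and [measurable]: "k \<in> borel_measurable borel"
    using k unfolding mass_kernel_def by auto
  have k1': "(\<integral>\<^sup>+z. ennreal (k z) \<partial>lborel) = 1"
    using k0 kint k1 by (simp add: nn_integral_eq_integral)
  have "(\<integral>\<^sup>+x. (ennreal (norm (smear k t g x)))\<^sup>2 \<partial>lborel)
     \<le> (\<integral>\<^sup>+x. \<integral>\<^sup>+z. ennreal (k z) * (ennreal (norm (g (x + t *\<^sub>R z))))\<^sup>2 \<partial>lborel \<partial>lborel)"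
  proof (intro nn_integral_mono)
    fix x
    have "ennreal (norm (smear k t g x)) \<le> (\<integral>\<^sup>+z. norm (k z *\<^sub>R g (x + t *\<^sub>R z)) \<partial>lborel)"
      unfolding smear_def
      \<comment> \<open>If the integrand is not integrable, the Bochner integral is \<open>0\<close>
        by convention and the bound is trivial.\<close>
      by (cases "integrable lborel (\<lambda>z. k z *\<^sub>R g (x + t *\<^sub>R z))")
        (auto intro: integral_norm_bound_ennreal simp: not_integrable_integral_eq simp del: norm_scaleR)
    also have "\<dots> = (\<integral>\<^sup>+z. ennreal (sqrt (k z)) * ennreal (sqrt (k z) * norm (g (x + t *\<^sub>R z))) \<partial>lborel)"
      using k0 by (intro nn_integral_cong) (simp flip: ennreal_mult mult.assoc)
    finally have "(ennreal (norm (smear k t g x)))\<^sup>2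
       \<le> (\<integral>\<^sup>+z. ennreal (sqrt (k z)) * ennreal (sqrt (k z) * norm (g (x + t *\<^sub>R z))) \<partial>lborel)\<^sup>2"
      by (intro power_mono) auto
    also have "\<dots> \<le> (\<integral>\<^sup>+z. (ennreal (sqrt (k z)))\<^sup>2 \<partial>lborel)
        * (\<integral>\<^sup>+z. (ennreal (sqrt (k z) * norm (g (x + t *\<^sub>R z))))\<^sup>2 \<partial>lborel)"
      by (rule Cauchy_Schwarz_nn_integral) measurable
    also have "(\<integral>\<^sup>+z. (ennreal (sqrt (k z)))\<^sup>2 \<partial>lborel) = 1"
      using k0 k1' by (simp add: ennreal_power)
    also have "1 * (\<integral>\<^sup>+z. (ennreal (sqrt (k z) * norm (g (x + t *\<^sub>R z))))\<^sup>2 \<partial>lborel)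
       = (\<integral>\<^sup>+z. ennreal (k z) * (ennreal (norm (g (x + t *\<^sub>R z))))\<^sup>2 \<partial>lborel)"
      using k0 by (simp add: ennreal_power power_mult_distrib ennreal_mult)
    finally show "(ennreal (norm (smear k t g x)))\<^sup>2 \<le> \<dots>" .
  qed
  also have "\<dots> = (\<integral>\<^sup>+z. \<integral>\<^sup>+x. ennreal (k z) * (ennreal (norm (g (x + t *\<^sub>R z))))\<^sup>2 \<partial>lborel \<partial>lborel)"
    by (rule lborel_pair.Fubini'[symmetric]) measurable
  also have "\<dots> = (\<integral>\<^sup>+z. ennreal (k z) * (\<integral>\<^sup>+x. (ennreal (norm (g x)))\<^sup>2 \<partial>lborel) \<partial>lborel)"
    by (intro nn_integral_cong, subst nn_integral_cmult)
       (auto simp: nn_integral_shift[where f="\<lambda>x. (ennreal (norm (g x)))\<^sup>2"])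
  also have "\<dots> = (\<integral>\<^sup>+x. (ennreal (norm (g x)))\<^sup>2 \<partial>lborel)"
    by (simp add: nn_integral_multc k1')
  finally show ?thesis .
qed

text \<open>By the mean value inequality the remainder of the difference quotient is at most
  \<open>2 * B\<close>, so dominated convergence with \<open>2 * B * \<bar>g y\<bar>\<close> applies
  along every sequence of increments. The parameter is a point of space in one later use and the
  scale \<open>t\<close> in another.\<close>

lemma has_derivative_lebesgue_integral:
  fixes K :: "'p::real_normed_vector \<Rightarrow> 'a \<Rightarrow> real" and g :: "'a \<Rightarrow> real"
  assumes d: "d > 0"
    and D: "\<And>p y. p \<in> ball p0 d \<Longrightarrow> ((\<lambda>p. K p y) has_derivative D p y) (at p)"
    and B: "\<And>p y v. p \<in> ball p0 d \<Longrightarrow> \<bar>D p y v\<bar> \<le> B * norm v"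
    and [measurable]: "\<And>p. K p \<in> borel_measurable M" "\<And>v. (\<lambda>y. D p0 y v) \<in> borel_measurable M"
    and g: "integrable M g"
    and Kg: "\<And>p. integrable M (\<lambda>y. K p y * g y)"
  shows "((\<lambda>p. \<integral>y. K p y * g y \<partial>M) has_derivative (\<lambda>v. \<integral>y. D p0 y v * g y \<partial>M)) (at p0)"
proof -
  have [measurable]: "g \<in> borel_measurable M" using g by auto
  have p0: "p0 \<in> ball p0 d" using d by simp
  interpret D: bounded_linear "D p0 y" for y
    using D[OF p0] by (rule has_derivative_bounded_linear)
  have Dg: "integrable M (\<lambda>y. D p0 y v * g y)" for v
  proof (rule Bochner_Integration.integrable_bound)
    show "integrable M (\<lambda>y. (B * norm v) * g y)" using g by simp
    show "AE y in M. norm (D p0 y v * g y) \<le> norm (B * norm v * g y)"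
    proof (intro AE_I2)
      fix y
      have "\<bar>D p0 y v\<bar> \<le> \<bar>B * norm v\<bar>" using B[OF p0, of y v] by linarith
      then show "norm (D p0 y v * g y) \<le> norm (B * norm v * g y)"
        by (simp only: norm_mult real_norm_def abs_mult mult_right_mono abs_ge_zero)
    qed
  qed measurable
  have lin: "bounded_linear (\<lambda>v. \<integral>y. D p0 y v * g y \<partial>M)"
  proof (rule bounded_linear_intro[where K="B * (\<integral>y. \<bar>g y\<bar> \<partial>M)"])
    show "(\<integral>y. D p0 y (v + w) * g y \<partial>M) = (\<integral>y. D p0 y v * g y \<partial>M) + (\<integral>y. D p0 y w * g y \<partial>M)" for v w
      using Dg by (simp add: D.add distrib_right)
    show "(\<integral>y. D p0 y (r *\<^sub>R v) * g y \<partial>M) = r *\<^sub>R (\<integral>y. D p0 y v * g y \<partial>M)" for r v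
      by (simp add: D.scaleR mult.assoc)
    show "norm (\<integral>y. D p0 y v * g y \<partial>M) \<le> norm v * (B * (\<integral>y. \<bar>g y\<bar> \<partial>M))" for v
    proof -
      have "norm (\<integral>y. D p0 y v * g y \<partial>M) \<le> (\<integral>y. norm (D p0 y v * g y) \<partial>M)"
        by (rule integral_norm_bound)
      also have "\<dots> \<le> (\<integral>y. (B * norm v) * \<bar>g y\<bar> \<partial>M)"
      proof (rule integral_mono)
        show "integrable M (\<lambda>y. norm (D p0 y v * g y))" by (intro integrable_norm Dg)
        show "integrable M (\<lambda>y. B * norm v * \<bar>g y\<bar>)" using g by simp
        show "norm (D p0 y v * g y) \<le> B * norm v * \<bar>g y\<bar>" for y
          using B[OF p0, of y v] by (simp add: abs_mult mult_right_mono)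
      qed
      finally show ?thesis using g by (simp add: mult_ac)
    qed
  qed
  show ?thesis
    unfolding has_derivative_at
  proof (intro conjI lin)
    let ?F = "\<lambda>p. \<integral>y. K p y * g y \<partial>M"
    let ?q = "\<lambda>h y. (K (p0 + h) y - K p0 y - D p0 y h) / norm h"
    have eq: "norm (?F (p0 + h) - ?F p0 - (\<integral>y. D p0 y h * g y \<partial>M)) / norm h
        = \<bar>\<integral>y. ?q h y * g y \<partial>M\<bar>" for h
    proof -
      have "(\<integral>y. ?q h y * g y \<partial>M) = (\<integral>y. (K (p0 + h) y * g y - K p0 y * g y - D p0 y h * g y) / norm h \<partial>M)"
        by (intro Bochner_Integration.integral_cong) (auto simp: algebra_simps diff_divide_distrib)
      also have "\<dots> = (?F (p0 + h) - ?F p0 - (\<integral>y. D p0 y h * g y \<partial>M)) / norm h"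
        using Kg Dg by simp
      finally show ?thesis by (simp only: abs_divide abs_norm_cancel real_norm_def)
    qed
    have "((\<lambda>h. \<integral>y. ?q h y * g y \<partial>M) \<longlongrightarrow> 0) (at 0)"
      unfolding tendsto_at_iff_sequentially comp_def
    proof (intro allI impI)
      fix X :: "nat \<Rightarrow> 'p" assume X: "\<forall>i. X i \<in> UNIV - {0}" "X \<longlonglongrightarrow> 0"
      \<comment> \<open>The bound on the quotients holds only for increments inside the ball, so
        finitely many terms are dropped.\<close>
      then have "eventually (\<lambda>i. norm (X i) < d) sequentially"
        using d by (auto dest!: tendstoD simp: dist_norm)
      then obtain n0 where n0: "\<And>i. norm (X (i + n0)) < d"
        by (auto simp: eventually_sequentially) (metis le_add2)
      have lim: "(\<lambda>i. ?q (X (i + n0)) y * g y) \<longlonglongrightarrow> 0" for y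
      proof -
        have "((\<lambda>h. ?q h y) \<longlongrightarrow> 0) (at 0)"
          using D[OF p0, of y] unfolding has_derivative_at
          by (intro tendsto_norm_zero_cancel[of "\<lambda>h. ?q h y"]) (simp add: abs_mult)
        then have "(\<lambda>i. ?q (X i) y) \<longlonglongrightarrow> 0"
          using X unfolding tendsto_at_iff_sequentially comp_def by blast
        from LIMSEQ_ignore_initial_segment[OF this, of n0] show ?thesis
          by (intro tendsto_mult_left_zero)
      qed
      have bd: "\<bar>?q (X (i + n0)) y\<bar> \<le> 2 * B" for i y
      proof -
        let ?h = "X (i + n0)"
        have h: "norm ?h > 0" "p0 + ?h \<in> ball p0 d" using X n0 by (auto simp: dist_norm)
        \<comment> \<open>The sign of \<open>B\<close> is not assumed; a nonzero increment forces
          it.\<close>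
        have "0 \<le> B * norm ?h" using B[OF p0, of y ?h] by linarith
        with h(1) have B0: "B \<ge> 0" by (simp add: zero_le_mult_iff)
        have "norm (K (p0 + ?h) y - K p0 y) \<le> B * norm (p0 + ?h - p0)"
        proof (rule differentiable_bound[of "ball p0 d"])
          show "((\<lambda>p. K p y) has_derivative D p y) (at p within ball p0 d)" if "p \<in> ball p0 d" for p
            using D[OF that] by (rule has_derivative_at_withinI)
          show "onorm (D p y) \<le> B" if "p \<in> ball p0 d" for p
            using B0 B[OF that] by (intro onorm_bound) auto
        qed (use h p0 in auto)
        then have "\<bar>K (p0 + ?h) y - K p0 y - D p0 y ?h\<bar> \<le> B * norm ?h + B * norm ?h"
          using B[OF p0, of y ?h] by simp
        then show ?thesis using h(1) by (simp add: field_simps)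
      qed
      have "(\<lambda>i. \<integral>y. ?q (X (i + n0)) y * g y \<partial>M) \<longlonglongrightarrow> (\<integral>y. 0 \<partial>M)"
      proof (rule integral_dominated_convergence[where w="\<lambda>y. 2 * B * \<bar>g y\<bar>"])
        show "integrable M (\<lambda>y. 2 * B * \<bar>g y\<bar>)" using g by simp
        show "AE y in M. norm (?q (X (i + n0)) y * g y) \<le> 2 * B * \<bar>g y\<bar>" for i
        proof (intro AE_I2)
          fix y
          show "norm (?q (X (i + n0)) y * g y) \<le> 2 * B * \<bar>g y\<bar>"
            unfolding real_norm_def abs_mult by (rule mult_right_mono[OF bd abs_ge_zero])
        qed
      qed (use lim in auto)
      then show "(\<lambda>i. \<integral>y. ?q (X i) y * g y \<partial>M) \<longlonglongrightarrow> 0"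
        by (intro LIMSEQ_offset[where k=n0 and f="\<lambda>i. \<integral>y. ?q (X i) y * g y \<partial>M"]) simp
    qed
    then show "(\<lambda>h. norm (?F (p0 + h) - ?F p0 - (\<integral>y. D p0 y h * g y \<partial>M)) / norm h) \<midarrow>0\<rightarrow> 0"
      unfolding eq by (rule tendsto_rabs_zero)
  qed
qed

section \<open>Smoothness of convolutions with compactly supported kernels\<close>

lemma smooth_grad_inner:
  assumes f: "smooth_fun f" shows "smooth_fun (\<lambda>x. grad f x \<bullet> v)"
proof -
  have "C_k k (\<lambda>x. grad f x \<bullet> v)" for k
  proof -
    have "C_k (Suc k) f" using f unfolding smooth_fun_def by blast
    moreover have "grad f x \<bullet> v = frechet_derivative f (at x) v" for x
      using frechet_derivative_eqI[OF smooth_has_derivative[OF f, of x]] by simp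
    ultimately show ?thesis by simp
  qed
  then show ?thesis by (simp add: smooth_fun_def)
qed

lemma continuous_compact_support_bounded:
  fixes f :: "'a::euclidean_space \<Rightarrow> 'b::real_normed_vector"
  assumes "continuous_on UNIV f" "compact K" "\<And>x. x \<notin> K \<Longrightarrow> f x = 0"
  shows "\<exists>B>0. \<forall>x. norm (f x) \<le> B"
proof -
  have "compact (f ` K)" using assms by (intro compact_continuous_image) (auto intro: continuous_on_subset)
  then obtain B where B: "\<And>x. x \<in> K \<Longrightarrow> norm (f x) \<le> B"
    using bounded_iff[of "f ` K"] compact_imp_bounded by blast
  have "norm (f x) \<le> max B 1" for x
    using B[of x] assms(3)[of x] by (cases "x \<in> K") (auto simp: le_max_iff_disj)
  then show ?thesis by (intro exI[of _ "max B 1"]) auto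
qed

lemma borel_measurable_smooth: "smooth_fun f \<Longrightarrow> f \<in> borel_measurable borel"
  by (intro borel_measurable_continuous_onI smooth_continuous)

lemma borel_measurable_grad: "smooth_fun f \<Longrightarrow> grad f \<in> borel_measurable borel"
  by (intro borel_measurable_continuous_onI continuous_on_grad)

lemma grad_affine:
  assumes f: "smooth_fun f"
  shows "grad (\<lambda>y. f (r *\<^sub>R (y - x))) y = r *\<^sub>R grad f (r *\<^sub>R (y - x))"
proof (rule grad_eqI)
  have "((\<lambda>y. r *\<^sub>R (y - x)) has_derivative (\<lambda>v. r *\<^sub>R v)) (at y)"
    by (auto intro!: derivative_eq_intros)
  from has_derivative_compose[OF this smooth_has_derivative[OF f]]
  show "((\<lambda>y. f (r *\<^sub>R (y - x))) has_derivative (\<lambda>v. (r *\<^sub>R grad f (r *\<^sub>R (y - x))) \<bullet> v)) (at y)"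
    by simp
qed

lemma smooth_dilate: "smooth_fun f \<Longrightarrow> smooth_fun (\<lambda>y. f (r *\<^sub>R (y - x)))"
  using smooth_affine[of f r "- r *\<^sub>R x"] by (simp add: scaleR_diff_right)

text \<open>The variable \<open>x\<close> occurs only in the kernel, which takes the derivative,
  while \<open>g\<close> is merely integrable.\<close>

lemma conv_has_derivative:
  fixes \<rho> :: "real^'n \<Rightarrow> real" and g :: "real^'n \<Rightarrow> real"
  assumes \<rho>: "smooth_fun \<rho>" and K: "compact K" "\<And>z. z \<notin> K \<Longrightarrow> \<rho> z = 0" and g: "integrable lborel g"
  shows "((\<lambda>x. LBINT y. \<rho> (r *\<^sub>R (y - x)) * g y) has_derivative
     (\<lambda>v. LBINT y. (- r * (grad \<rho> (r *\<^sub>R (y - x)) \<bullet> v)) * g y)) (at x)"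
proof -
  obtain B where B: "\<And>z. norm (\<rho> z) \<le> B"
    using continuous_compact_support_bounded[OF smooth_continuous[OF \<rho>] K] by blast
  obtain B' where B': "\<And>z. norm (grad \<rho> z) \<le> B'"
    using continuous_compact_support_bounded[OF continuous_on_grad[OF \<rho>] K(1)
      grad_eq_0_outside[OF compact_imp_closed[OF K(1)] K(2)]] by blast
  have [measurable]: "\<rho> \<in> borel_measurable borel" "grad \<rho> \<in> borel_measurable borel"
    using \<rho> by (auto intro: borel_measurable_smooth borel_measurable_grad)
  have [measurable]: "g \<in> borel_measurable borel" using g by auto
  show ?thesis
  proof (rule has_derivative_lebesgue_integral[where d=1 and B="\<bar>r\<bar> * B'"])
    fix p y v :: "real^'n"
    have "((\<lambda>p. r *\<^sub>R (y - p)) has_derivative (\<lambda>v. - r *\<^sub>R v)) (at p)"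
      by (auto intro!: derivative_eq_intros)
    from has_derivative_compose[OF this smooth_has_derivative[OF \<rho>]]
    show "((\<lambda>p. \<rho> (r *\<^sub>R (y - p))) has_derivative (\<lambda>v. - r * (grad \<rho> (r *\<^sub>R (y - p)) \<bullet> v))) (at p)"
      by simp
    have "\<bar>grad \<rho> (r *\<^sub>R (y - p)) \<bullet> v\<bar> \<le> B' * norm v"
      using Cauchy_Schwarz_ineq2[of "grad \<rho> (r *\<^sub>R (y - p))" v] B'[of "r *\<^sub>R (y - p)"]
      by (meson mult_right_mono norm_ge_zero order_trans)
    then show "\<bar>- r * (grad \<rho> (r *\<^sub>R (y - p)) \<bullet> v)\<bar> \<le> \<bar>r\<bar> * B' * norm v"
      by (simp add: abs_mult mult.assoc mult_left_mono)
  next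
    fix p :: "real^'n"
    show "integrable lborel (\<lambda>y. \<rho> (r *\<^sub>R (y - p)) * g y)"
    proof (rule Bochner_Integration.integrable_bound)
      show "integrable lborel (\<lambda>y. B * g y)" using g by simp
      show "AE y in lborel. norm (\<rho> (r *\<^sub>R (y - p)) * g y) \<le> norm (B * g y)"
      proof (intro AE_I2)
        fix y
        show "norm (\<rho> (r *\<^sub>R (y - p)) * g y) \<le> norm (B * g y)"
          using B[of "r *\<^sub>R (y - p)"] unfolding norm_mult by (intro mult_right_mono) auto
      qed
    qed measurable
  qed (use g in auto)
qed

text \<open>A directional derivative is again a convolution, with kernel
  \<open>- r * (grad \<rho> z \<bullet> v)\<close> supported in the same \<open>K\<close>; the
  induction therefore varies \<open>\<rho>\<close>.\<close>

lemma C_k_conv: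
  fixes \<rho> :: "real^'n \<Rightarrow> real" and g :: "real^'n \<Rightarrow> real"
  assumes "smooth_fun \<rho>" "compact K" "\<And>z. z \<notin> K \<Longrightarrow> \<rho> z = 0" and g: "integrable lborel g"
  shows "C_k k (\<lambda>x. LBINT y. \<rho> (r *\<^sub>R (y - x)) * g y)"
  using assms(1,3)
proof (induction k arbitrary: \<rho>)
  case 0
  then show ?case
    using has_derivative_continuous[OF conv_has_derivative[OF 0(1) assms(2) 0(2) g]]
    by (auto intro!: continuous_at_imp_continuous_on)
next
  case (Suc k)
  show ?case
  proof (rule C_k_SucI[OF conv_has_derivative[OF Suc.prems(1) assms(2) Suc.prems(2) g]])
    fix v
    have "C_k k (\<lambda>x. LBINT y. (\<lambda>z. - r * (grad \<rho> z \<bullet> v)) (r *\<^sub>R (y - x)) * g y)"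
    proof (rule Suc.IH)
      show "smooth_fun (\<lambda>z. - r * (grad \<rho> z \<bullet> v))"
        by (intro smooth_mult smooth_const smooth_grad_inner Suc.prems)
      show "- r * (grad \<rho> z \<bullet> v) = 0" if "z \<notin> K" for z
        using grad_eq_0_outside[OF compact_imp_closed[OF assms(2)] Suc.prems(2) that] by simp
    qed
    then show "C_k k (\<lambda>x. LBINT y. (- r * (grad \<rho> (r *\<^sub>R (y - x)) \<bullet> v)) * g y)" by simp
  qed
qed

text \<open>Centre \<open>0\<close> gives the usual mollifier; a unit vector \<open>e\<close> as
  centre gives the averages along a cone with axis \<open>e\<close>.\<close>

definition nbump :: "real^'n \<Rightarrow> real \<Rightarrow> real^'n \<Rightarrow> real" where
  "nbump e c z = bump e c z / (LBINT y. bump e c y)"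

lemma bump_integrable: "c > 0 \<Longrightarrow> integrable lborel (bump e c)"
proof -
  assume c: "c > 0"
  have "integrable lborel (\<lambda>z. indicator (cball e c) z *\<^sub>R bump e c z)"
    using borel_integrable_compact[OF compact_cball smooth_continuous[OF smooth_bump]] by simp
  moreover have "(\<lambda>z. indicator (cball e c) z *\<^sub>R bump e c z) = bump e c"
    using bump_eq_0[OF c, of _ e] by (intro ext) (auto simp: indicator_def dist_norm norm_minus_commute)
  ultimately show ?thesis by simp
qed

lemma bump_integral_pos: "c > 0 \<Longrightarrow> (LBINT y. bump e c y) > 0"
proof -
  assume c: "c > 0"
  have "0 < exp (- (4/3)) * measure lborel (cball e (c / 2))" using c by (simp add: content_cball)
  also have "\<dots> = (LBINT y. exp (- (4/3)) * indicator (cball e (c / 2)) y)"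
    by simp
  also have "\<dots> \<le> (LBINT y. bump e c y)"
  proof (rule integral_mono)
    show "exp (- (4/3)) * indicator (cball e (c / 2)) y \<le> bump e c y" for y
      using bump_ge[OF c, of y e] bump_nonneg[of e c y]
      by (auto simp: indicator_def dist_norm norm_minus_commute)
  qed (use bump_integrable[OF c] in \<open>auto intro!: integrable_real_indicator emeasure_bounded_finite\<close>)
  finally show ?thesis .
qed

lemma smooth_nbump: "smooth_fun (nbump e c)"
  using smooth_mult[OF smooth_const[of "1 / (LBINT y. bump e c y)"] smooth_bump[of e c]]
  by (simp add: nbump_def[abs_def])

lemma nbump_eq_0: fixes z :: "real^'n" shows "c > 0 \<Longrightarrow> z \<notin> cball e c \<Longrightarrow> nbump e c z = 0"
  by (auto simp: nbump_def dist_norm norm_minus_commute intro!: bump_eq_0)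

lemma mass_kernel_nbump: fixes e :: "real^'n" assumes "c > 0" shows "mass_kernel (nbump e c)"
  unfolding mass_kernel_def
proof (intro conjI)
  note p = bump_integral_pos[OF assms, of e]
  show "nbump e c \<in> borel_measurable borel" by (intro borel_measurable_smooth smooth_nbump)
  show "\<forall>z. 0 \<le> nbump e c z" using p by (auto simp: nbump_def bump_nonneg)
  show "\<exists>B. \<forall>z. nbump e c z \<le> B"
    using p bump_le_1 by (auto simp: nbump_def intro!: exI[of _ "1 / (LBINT y. bump e c y)"] divide_right_mono)
  show "\<exists>r. \<forall>z. norm z > r \<longrightarrow> nbump e c z = 0"
  proof (intro exI[of _ "norm e + c"] allI impI)
    fix z :: "real^'n" assume "norm z > norm e + c"
    then have "z \<notin> cball e c" using norm_triangle_ineq2[of z e] by (auto simp: dist_norm norm_minus_commute)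
    then show "nbump e c z = 0" by (rule nbump_eq_0[OF assms])
  qed
  show "integrable lborel (nbump e c)"
    unfolding nbump_def[abs_def] by (intro integrable_divide bump_integrable assms)
  show "(LBINT z. nbump e c z) = 1"
    unfolding nbump_def using p by simp
qed

text \<open>The substitution \<open>y = x + t *\<^sub>R z\<close> moves \<open>x\<close> and
  \<open>t\<close> from \<open>g\<close> into the smooth kernel, where they can be
  differentiated.\<close>

lemma smear_eq_conv:
  fixes g :: "real^'n \<Rightarrow> 'b::euclidean_space"
  assumes [measurable]: "k \<in> borel_measurable borel" "g \<in> borel_measurable borel" and t: "t > 0"
  shows "smear k t g x = (LBINT y. (k ((1 / t) *\<^sub>R (y - x)) / t ^ CARD('n)) *\<^sub>R g y)"
proof -
  have "smear k t g x = (LBINT z. (\<lambda>y. k ((1 / t) *\<^sub>R (y - x)) *\<^sub>R g y) (x + t *\<^sub>R z))"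
    using t by (simp add: smear_def)
  also have "\<dots> = (1 / t ^ CARD('n)) *\<^sub>R (LBINT y. k ((1 / t) *\<^sub>R (y - x)) *\<^sub>R g y)"
    using t by (subst integral_affine) auto
  also have "\<dots> = (LBINT y. (1 / t ^ CARD('n)) *\<^sub>R (k ((1 / t) *\<^sub>R (y - x)) *\<^sub>R g y))"
    by (rule integral_scaleR_right[symmetric])
  finally show ?thesis by (simp add: divide_inverse mult.commute)
qed

text \<open>The weak gradient relation for Borel functions on the whole space, where translations
  and Fubini apply. Test functions vanish off \<open>\<Omega>\<close>, so the values there have no
  influence on the identity.\<close>

definition weak_pair :: "(real^'n) set \<Rightarrow> (real^'n \<Rightarrow> real) \<Rightarrow> (real^'n \<Rightarrow> real^'n) \<Rightarrow> bool" where
  "weak_pair \<Omega> u G \<longleftrightarrow> u \<in> borel_measurable borel \<and> G \<in> borel_measurable borel \<and>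
     (\<forall>K. compact K \<and> K \<subseteq> \<Omega> \<longrightarrow> integrable lborel (\<lambda>x. indicator K x *\<^sub>R u x) \<and>
        integrable lborel (\<lambda>x. indicator K x *\<^sub>R G x)) \<and>
     (\<forall>\<phi> \<in> test_functions \<Omega>.
        (LBINT x. u x *\<^sub>R grad \<phi> x) = - (LBINT x. \<phi> x *\<^sub>R G x))"

lemma integrable_bounded_mult:
  fixes h :: "'a::euclidean_space \<Rightarrow> real" and g :: "'a \<Rightarrow> 'b::euclidean_space"
  assumes g: "integrable lborel (\<lambda>x. indicator K x *\<^sub>R g x)"
    and [measurable]: "h \<in> borel_measurable borel" "g \<in> borel_measurable borel"
    and h: "\<And>x. x \<notin> K \<Longrightarrow> h x = 0" "\<And>x. \<bar>h x\<bar> \<le> B"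
  shows "integrable lborel (\<lambda>x. h x *\<^sub>R g x)"
proof (rule Bochner_Integration.integrable_bound)
  show "integrable lborel (\<lambda>x. B *\<^sub>R (indicator K x *\<^sub>R g x))" by (rule integrable_scaleR_right) (rule g)
  show "AE x in lborel. norm (h x *\<^sub>R g x) \<le> norm (B *\<^sub>R (indicator K x *\<^sub>R g x))"
  proof (intro AE_I2)
    fix x
    have "\<bar>h x\<bar> \<le> \<bar>B\<bar>" using h(2)[of x] by linarith
    then show "norm (h x *\<^sub>R g x) \<le> norm (B *\<^sub>R (indicator K x *\<^sub>R g x))"
      using h(1)[of x] by (auto simp: indicator_def intro!: mult_right_mono)
  qed
qed measurable

lemma integrable_bounded_mult2:
  fixes h :: "'a::euclidean_space \<Rightarrow> 'b::euclidean_space" and g :: "'a \<Rightarrow> real"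
  assumes g: "integrable lborel (\<lambda>x. indicator K x *\<^sub>R g x)"
    and [measurable]: "h \<in> borel_measurable borel" "g \<in> borel_measurable borel"
    and h: "\<And>x. x \<notin> K \<Longrightarrow> h x = 0" "\<And>x. norm (h x) \<le> B"
  shows "integrable lborel (\<lambda>x. g x *\<^sub>R h x)"
proof (rule Bochner_Integration.integrable_bound)
  show "integrable lborel (\<lambda>x. B *\<^sub>R (indicator K x *\<^sub>R g x))" by (rule integrable_scaleR_right) (rule g)
  show "AE x in lborel. norm (g x *\<^sub>R h x) \<le> norm (B *\<^sub>R (indicator K x *\<^sub>R g x))"
  proof (intro AE_I2)
    fix x
    have "norm (h x) \<le> \<bar>B\<bar>" using h(2)[of x] by linarith
    then show "norm (g x *\<^sub>R h x) \<le> norm (B *\<^sub>R (indicator K x *\<^sub>R g x))"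
      using h(1)[of x] by (auto simp: indicator_def abs_mult mult.commute[of "\<bar>B\<bar>"] intro!: mult_left_mono)
  qed
qed measurable

lemma test_function_bounds:
  assumes "\<phi> \<in> test_functions \<Omega>"
  shows "\<exists>K B. compact K \<and> K \<subseteq> \<Omega> \<and> (\<forall>x. x \<notin> K \<longrightarrow> \<phi> x = 0) \<and> (\<forall>x. x \<notin> K \<longrightarrow> grad \<phi> x = 0) \<and>
    (\<forall>x. \<bar>\<phi> x\<bar> \<le> B) \<and> (\<forall>x. norm (grad \<phi> x) \<le> B) \<and> smooth_fun \<phi> \<and>
    \<phi> \<in> borel_measurable borel \<and> grad \<phi> \<in> borel_measurable borel"
proof -
  obtain K where K: "smooth_fun \<phi>" "compact K" "K \<subseteq> \<Omega>" "\<And>x. x \<notin> K \<Longrightarrow> \<phi> x = 0"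
    using assms by (auto simp: test_functions_iff)
  have g0: "\<And>x. x \<notin> K \<Longrightarrow> grad \<phi> x = 0"
    using grad_eq_0_outside[OF compact_imp_closed[OF K(2)]] K(4) by blast
  obtain B1 where B1: "\<And>x. norm (\<phi> x) \<le> B1"
    using continuous_compact_support_bounded[OF smooth_continuous[OF K(1)] K(2,4)] by blast
  obtain B2 where B2: "\<And>x. norm (grad \<phi> x) \<le> B2"
    using continuous_compact_support_bounded[OF continuous_on_grad[OF K(1)] K(2) g0] by blast
  have B: "\<bar>\<phi> x\<bar> \<le> max B1 B2" "norm (grad \<phi> x) \<le> max B1 B2" for x
    using B1[of x] B2[of x] by auto
  show ?thesis
    by (intro exI[of _ K] exI[of _ "max B1 B2"] conjI allI impI K g0 B
        borel_measurable_smooth borel_measurable_grad)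
qed

text \<open>For fixed \<open>x\<close> the kernel, as a function of \<open>y\<close>, is a test
  function when the ball around \<open>x\<close> lies in \<open>K'\<close>. Differentiating in
  \<open>x\<close> instead of \<open>y\<close> gives one minus sign, the weak gradient relation the
  other.\<close>

lemma
  fixes u :: "real^'n \<Rightarrow> real"
  assumes wp: "weak_pair \<Omega> u G" and K': "compact K'" "K' \<subseteq> \<Omega>" and d: "d > 0"
  defines "v \<equiv> smear (nbump 0 1) d (\<lambda>y. indicator K' y *\<^sub>R u y)"
  shows smooth_mollified: "smooth_fun v"
    and grad_mollified: "\<And>x. cball x d \<subseteq> K' \<Longrightarrow>
      grad v x = smear (nbump 0 1) d (\<lambda>y. indicator K' y *\<^sub>R G y) x"
proof -
  have [measurable]: "u \<in> borel_measurable borel" "G \<in> borel_measurable borel" "K' \<in> sets borel"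
    and iu: "integrable lborel (\<lambda>x. indicator K' x *\<^sub>R u x)"
    and iG: "integrable lborel (\<lambda>x. indicator K' x *\<^sub>R G x)"
    using wp K' by (auto simp: weak_pair_def compact_imp_closed)
  define \<rho> :: "real^'n \<Rightarrow> real" where "\<rho> z = (1 / d ^ CARD('n)) * nbump 0 1 z" for z
  have \<rho>: "smooth_fun \<rho>" unfolding \<rho>_def[abs_def] by (intro smooth_mult smooth_const smooth_nbump)
  have [measurable]: "\<rho> \<in> borel_measurable borel" "grad \<rho> \<in> borel_measurable borel"
    "nbump 0 1 \<in> borel_measurable (borel :: (real^'n) measure)"
    using \<rho> smooth_nbump by (auto intro: borel_measurable_smooth borel_measurable_grad)
  have \<rho>0: "\<rho> z = 0" if "z \<notin> cball 0 1" for z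
    using nbump_eq_0[of 1 z 0] that by (simp add: \<rho>_def)
  have conv: "smear (nbump 0 1) d g x = (LBINT y. \<rho> ((1 / d) *\<^sub>R (y - x)) *\<^sub>R g y)"
    if [measurable]: "g \<in> borel_measurable borel" for g :: "real^'n \<Rightarrow> 'c::euclidean_space" and x
    by (subst smear_eq_conv) (use d in \<open>auto simp: \<rho>_def\<close>)
  have v: "v = (\<lambda>x. LBINT y. \<rho> ((1 / d) *\<^sub>R (y - x)) * (indicator K' y *\<^sub>R u y))"
    by (rule ext) (simp add: v_def conv)
  show "smooth_fun v"
    unfolding v smooth_fun_def using C_k_conv[OF \<rho> compact_cball \<rho>0 iu] by blast
  show "grad v x = smear (nbump 0 1) d (\<lambda>y. indicator K' y *\<^sub>R G y) x" if x: "cball x d \<subseteq> K'" for x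
  proof -
    define \<phi> where "\<phi> y = \<rho> ((1 / d) *\<^sub>R (y - x))" for y
    have out: "(1 / d) *\<^sub>R (y - x) \<notin> cball 0 1" if "y \<notin> cball x d" for y
    proof -
      have "norm ((1 / d) *\<^sub>R (y - x)) = norm (y - x) / d" using d by simp
      then show ?thesis using that d by (simp add: dist_norm norm_minus_commute del: norm_scaleR)
    qed
    have \<phi>0: "\<phi> y = 0" if "y \<notin> cball x d" for y
      unfolding \<phi>_def by (rule \<rho>0[OF out[OF that]])
    have \<phi>: "\<phi> \<in> test_functions \<Omega>"
      unfolding test_functions_iff
    proof (intro conjI exI[of _ "cball x d"] allI impI)
      show "smooth_fun \<phi>" unfolding \<phi>_def[abs_def] by (rule smooth_dilate[OF \<rho>])
    qed (use x K' \<phi>0 in auto)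
    have g\<phi>: "grad \<phi> y = (1 / d) *\<^sub>R grad \<rho> ((1 / d) *\<^sub>R (y - x))" for y
      unfolding \<phi>_def[abs_def] by (rule grad_affine[OF \<rho>])
    have g0c: "grad \<phi> y = 0" if "y \<notin> cball x d" for y
      by (rule grad_eq_0_outside[where K="cball x d"]) (use \<phi>0 that in auto)
    have g0: "grad \<phi> y = 0" if "y \<notin> K'" for y
      using g0c[of y] x that by blast
    have sm: "smooth_fun \<phi>" using \<phi> by (simp add: test_functions_iff)
    obtain B where B: "\<And>y. norm (grad \<phi> y) \<le> B"
      using continuous_compact_support_bounded[OF continuous_on_grad[OF sm] compact_cball g0c] by blast
    have mg: "grad \<phi> \<in> borel_measurable borel"
      using \<phi> by (auto simp: test_functions_iff intro: borel_measurable_grad)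
    have ig: "integrable lborel (\<lambda>y. u y *\<^sub>R grad \<phi> y)"
      by (rule integrable_bounded_mult2[OF iu mg _ g0 B]) auto
    have "grad v x \<bullet> w = smear (nbump 0 1) d (\<lambda>y. indicator K' y *\<^sub>R G y) x \<bullet> w" for w
    proof -
      have "grad v x \<bullet> w = (LBINT y. (- (1 / d) * (grad \<rho> ((1 / d) *\<^sub>R (y - x)) \<bullet> w)) * (indicator K' y *\<^sub>R u y))"
        unfolding v by (rule inner_grad[OF conv_has_derivative[OF \<rho> compact_cball \<rho>0 iu]])
      also have "\<dots> = (LBINT y. - ((u y *\<^sub>R grad \<phi> y) \<bullet> w))"
      proof (rule Bochner_Integration.integral_cong[OF refl])
        fix y
        show "(- (1 / d) * (grad \<rho> ((1 / d) *\<^sub>R (y - x)) \<bullet> w)) * (indicator K' y *\<^sub>R u y)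
          = - ((u y *\<^sub>R grad \<phi> y) \<bullet> w)"
          using g0[of y] d unfolding g\<phi> by (auto simp: indicator_def)
      qed
      also have "\<dots> = - ((LBINT y. u y *\<^sub>R grad \<phi> y) \<bullet> w)"
        by (simp only: integral_minus integral_inner_left[OF ig])
      also have "\<dots> = (LBINT y. \<phi> y *\<^sub>R G y) \<bullet> w"
        using wp \<phi> by (simp add: weak_pair_def)
      also have "(LBINT y. \<phi> y *\<^sub>R G y) = smear (nbump 0 1) d (\<lambda>y. indicator K' y *\<^sub>R G y) x"
      proof -
        have "\<phi> y *\<^sub>R G y = \<rho> ((1 / d) *\<^sub>R (y - x)) *\<^sub>R (indicator K' y *\<^sub>R G y)" for y
        proof (cases "y \<in> K'")
          case False
          then have "\<phi> y = 0" using x by (intro \<phi>0) blast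
          then show ?thesis by (simp add: \<phi>_def)
        qed (simp add: \<phi>_def)
        then have "(LBINT y. \<phi> y *\<^sub>R G y)
            = (LBINT y. \<rho> ((1 / d) *\<^sub>R (y - x)) *\<^sub>R (indicator K' y *\<^sub>R G y))" by (simp only:)
        then show ?thesis by (subst conv) auto
      qed
      finally show ?thesis .
    qed
    then show ?thesis by (subst vector_eq_rdot[symmetric]) blast
  qed
qed

section \<open>Interior energy estimates\<close>

text \<open>Compare \<open>s powr (p - 1)\<close> with \<open>2 * k\<close>: if it is larger, half
  of \<open>s powr p\<close> absorbs the product; otherwise \<open>s\<close> is at most
  \<open>(2 * k) powr (1 / (p - 1))\<close>.\<close>

lemma young_half:
  fixes s k p :: real
  assumes "s \<ge> 0" "k \<ge> 0" "p > 1"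
  shows "k * s \<le> s powr p / 2 + (2 * k) powr (p / (p - 1))"
proof (cases "s powr (p - 1) \<ge> 2 * k")
  case True
  have "2 * k * s \<le> s powr (p - 1) * s" using True assms by (intro mult_right_mono) auto
  also have "\<dots> = s powr p" using assms by (cases "s = 0") (auto simp: powr_mult_base powr_diff)
  finally show ?thesis using powr_ge_zero[of "2 * k" "p / (p - 1)"] by linarith
next
  case False
  then have k: "k > 0" using powr_ge_zero[of s "p - 1"] by linarith
  have "s = (s powr (p - 1)) powr (1 / (p - 1))" using assms by (simp add: powr_powr)
  also have "\<dots> \<le> (2 * k) powr (1 / (p - 1))" using False assms by (intro powr_mono2) auto
  finally have "k * s \<le> (2 * k) * (2 * k) powr (1 / (p - 1))" using k assms by (intro mult_mono) auto
  also have "\<dots> = (2 * k) powr (1 + 1 / (p - 1))" using k by (simp add: powr_mult_base)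
  also have "1 + 1 / (p - 1) = p / (p - 1)" using assms by (simp add: field_simps)
  finally show ?thesis using powr_ge_zero[of s p] by linarith
qed

text \<open>Above the level \<open>\<kappa>\<close> the factor
  \<open>(g / \<kappa>) powr (p - 1)\<close> is at least \<open>1\<close>, below it
  \<open>\<kappa>\<close> is the bound. The level is free and is tuned to the radius later.\<close>

lemma le_powr_split:
  fixes g \<kappa> p :: real
  assumes "g \<ge> 0" "\<kappa> > 0" "p \<ge> 1"
  shows "g \<le> \<kappa> powr (1 - p) * g powr p + \<kappa>"
proof (cases "g \<ge> \<kappa>")
  case True
  then have g: "g > 0" using assms by linarith
  have "g = g powr (1 - p) * g powr p" using g by (simp flip: powr_add)
  also have "\<dots> \<le> \<kappa> powr (1 - p) * g powr p"
    using True assms by (intro mult_right_mono powr_mono2') auto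
  finally show ?thesis using assms by linarith
next
  case False
  have "0 \<le> \<kappa> powr (1 - p) * g powr p" by simp
  then show ?thesis using False by linarith
qed

text \<open>What both alternatives of the theorem provide for a nonnegative function
  \<open>w\<close>. The vector field \<open>a\<close> survives only through the growth bound on its
  flux, and the source only through its growth on balls, recorded by \<open>s\<close> and
  \<open>F\<close>; bounds in terms of these parameters are thus uniform in \<open>a\<close>,
  \<open>f\<close> and \<open>u\<close>.\<close>

definition energy ::
  "(real^'n) set \<Rightarrow> real \<Rightarrow> real \<Rightarrow> real \<Rightarrow> real \<Rightarrow> real \<Rightarrow> (real^'n \<Rightarrow> real) \<Rightarrow>
    (real^'n \<Rightarrow> real) \<Rightarrow> (real^'n \<Rightarrow> real^'n) \<Rightarrow> bool"
where
  "energy \<Omega> \<beta> lam p s F f w W \<longleftrightarrow> weak_pair \<Omega> w W \<and> (\<forall>x. 0 \<le> w x) \<and> f \<in> borel_measurable borel \<and>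
    (\<forall>K. compact K \<and> K \<subseteq> \<Omega> \<longrightarrow> integrable lborel (\<lambda>x. indicator K x *\<^sub>R (norm (W x) powr p)) \<and>
      integrable lborel (\<lambda>x. indicator K x *\<^sub>R \<bar>f x\<bar>)) \<and>
    (\<forall>z R. 0 < R \<and> R \<le> 1 \<and> cball z R \<subseteq> \<Omega> \<longrightarrow>
       (LBINT x. indicator (cball z R) x *\<^sub>R \<bar>f x\<bar>) \<le> F * R powr (real CARD('n) - s)) \<and>
    (\<forall>\<phi> \<in> test_functions \<Omega>. (\<forall>x. 0 \<le> \<phi> x) \<longrightarrow>
       (LBINT x. \<phi> x * norm (W x) powr p) + lam * (LBINT x. \<phi> x * w x)
       \<le> (LBINT x. \<phi> x * \<bar>f x\<bar>) + \<beta> * (LBINT x. norm (grad \<phi> x) * (1 + norm (W x))))"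

lemma energyD:
  assumes "energy \<Omega> \<beta> lam p s F f w (W :: real^'n \<Rightarrow> real^'n)"
  shows "weak_pair \<Omega> w W" "0 \<le> w x" "f \<in> borel_measurable borel"
    "compact K \<Longrightarrow> K \<subseteq> \<Omega> \<Longrightarrow> integrable lborel (\<lambda>x. indicator K x *\<^sub>R (norm (W x) powr p))"
    "compact K \<Longrightarrow> K \<subseteq> \<Omega> \<Longrightarrow> integrable lborel (\<lambda>x. indicator K x *\<^sub>R \<bar>f x\<bar>)"
    "0 < R \<Longrightarrow> R \<le> 1 \<Longrightarrow> cball z R \<subseteq> \<Omega> \<Longrightarrow>
       (LBINT x. indicator (cball z R) x *\<^sub>R \<bar>f x\<bar>) \<le> F * R powr (real CARD('n) - s)"
    "\<phi> \<in> test_functions \<Omega> \<Longrightarrow> (\<And>x. 0 \<le> \<phi> x) \<Longrightarrow>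
       (LBINT x. \<phi> x * norm (W x) powr p) + lam * (LBINT x. \<phi> x * w x)
       \<le> (LBINT x. \<phi> x * \<bar>f x\<bar>) + \<beta> * (LBINT x. norm (grad \<phi> x) * (1 + norm (W x)))"
  using assms by (simp_all add: energy_def)

lemma measure_cball_eq:
  "r \<ge> 0 \<Longrightarrow> measure lborel (cball (z::real^'n) r) = unit_ball_vol (real CARD('n)) * r powr (real CARD('n))"
  using content_cball[of r z] by (cases "r = 0") (auto simp: powr_realpow)

lemma integrable_cball_const: "integrable lborel (\<lambda>x. indicator (cball z r) x * (c::real))"
  by (intro integrable_mult_left integrable_real_indicator emeasure_bounded_finite) auto

text \<open>Testing with the square of a bump leaves half of the gradient energy on the left. The
  \<open>8\<close> is \<open>2 * 4\<close>, from the derivative of a square and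
  \<open>norm_grad_bump\<close>; the \<open>16\<close> is the doubling in \<open>young_half\<close>;
  and \<open>exp (8 / 3)\<close> inverts the square of the lower bound in
  \<open>bump_ge\<close>.\<close>

lemma ball_energy:
  fixes w :: "real^'n \<Rightarrow> real"
  assumes en: "energy \<Omega> \<beta> lam p s F f w W" and \<beta>: "\<beta> > 0" and p: "p > 2" and lam: "lam > 0"
    and z: "cball z R \<subseteq> \<Omega>" and R: "0 < R" "R \<le> 1" and F: "F \<ge> 0"
    and \<sigma>: "\<sigma> \<ge> s" "\<sigma> \<ge> p / (p - 1)"
  defines "C1 \<equiv> F + unit_ball_vol (real CARD('n)) * (8 * \<beta> + (16 * \<beta>) powr (p / (p - 1)))"
  shows "(LBINT x. indicator (cball z (R / 2)) x * norm (W x) powr p)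
      \<le> 2 * exp (8 / 3) * C1 * R powr (real CARD('n) - \<sigma>)" (is ?W)
    and "(LBINT x. indicator (cball z (R / 2)) x * w x)
      \<le> exp (8 / 3) * C1 / lam * R powr (real CARD('n) - \<sigma>)" (is ?w)
    and "integrable lborel (\<lambda>x. indicator (cball z (R / 2)) x * norm (W x) powr p)"
proof -
  define p' where "p' = p / (p - 1)"
  have p': "p' \<ge> 1" using p by (simp add: p'_def field_simps)
  let ?N = "real CARD('n)" and ?V = "unit_ball_vol (real CARD('n))"
  have V: "?V > 0" by (rule unit_ball_vol_pos) simp
  note wp = energyD(1)[OF en] and w0 = energyD(2)[OF en] and Wp = energyD(4)[OF en]
    and fi = energyD(5)[OF en] and fF = energyD(6)[OF en] and E = energyD(7)[OF en]
  have [measurable]: "f \<in> borel_measurable borel" by (rule energyD(3)[OF en])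
  have [measurable]: "w \<in> borel_measurable borel" "W \<in> borel_measurable borel"
    using wp by (auto simp: weak_pair_def)
  let ?K = "cball z R"
  have wi: "integrable lborel (\<lambda>x. indicator ?K x *\<^sub>R w x)" and Wi: "integrable lborel (\<lambda>x. indicator ?K x *\<^sub>R W x)"
    using wp z by (auto simp: weak_pair_def)
  define b where "b = bump z R"
  \<comment> \<open>The square makes \<open>norm (grad \<phi>)\<close> at most a multiple of \<open>\<phi> powr (1 / p)\<close>, as the absorption
    of the gradient term requires.\<close>
  define \<phi> where "\<phi> x = b x * b x" for x
  have bK: "bump z R x = 0" if "x \<notin> cball z R" for x
    using that by (intro bump_eq_0 R) (simp add: dist_norm norm_minus_commute)
  have b: "smooth_fun b" "\<And>x. 0 \<le> b x" "\<And>x. b x \<le> 1" "\<And>x. x \<notin> ?K \<Longrightarrow> b x = 0" "\<And>x. norm (grad b x) \<le> 4 / R"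
    unfolding b_def by (rule smooth_bump bump_nonneg bump_le_1 bK norm_grad_bump[OF R(1)] | assumption)+
  have \<phi>: "smooth_fun \<phi>" unfolding \<phi>_def[abs_def] by (intro smooth_mult b)
  have \<phi>t: "\<phi> \<in> test_functions \<Omega>" unfolding test_functions_iff
    by (intro conjI \<phi> exI[of _ ?K]) (use z b(4) in \<open>auto simp: \<phi>_def\<close>)
  have \<phi>0: "0 \<le> \<phi> x" "\<phi> x \<le> 1" "\<bar>\<phi> x\<bar> \<le> 1" for x
    using b(2,3)[of x] by (auto simp: \<phi>_def mult_le_one abs_mult)
  have \<phi>K: "\<phi> x = 0" if "x \<notin> ?K" for x using b(4)[OF that] by (simp add: \<phi>_def)
  have [measurable]: "\<phi> \<in> borel_measurable borel" "grad \<phi> \<in> borel_measurable borel"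
    using \<phi> by (auto intro: borel_measurable_smooth borel_measurable_grad)
  have g\<phi>: "norm (grad \<phi> x) \<le> 8 / R * b x" for x
  proof -
    have "norm (grad \<phi> x) = 2 * b x * norm (grad b x)"
      unfolding \<phi>_def[abs_def] grad_mult[OF b(1) b(1)] using b(2)[of x]
      by (simp flip: scaleR_add_left)
    also have "\<dots> \<le> 2 * b x * (4 / R)" using b(2,5)[of x] by (intro mult_left_mono) auto
    finally show ?thesis by simp
  qed
  have i1: "integrable lborel (\<lambda>x. \<phi> x * norm (W x) powr p)"
    using integrable_bounded_mult[OF Wp[OF compact_cball z] _ _ \<phi>K \<phi>0(3)] by simp
  have i2: "integrable lborel (\<lambda>x. \<phi> x * w x)"
    using integrable_bounded_mult[OF wi _ _ \<phi>K \<phi>0(3)] by simp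
  have i3: "integrable lborel (\<lambda>x. \<phi> x * \<bar>f x\<bar>)"
    using integrable_bounded_mult[OF fi[OF compact_cball z] _ _ \<phi>K \<phi>0(3)] by simp
  define Q where "Q = 8 * \<beta> / R + (16 * \<beta> / R) powr p'"
  have Q0: "Q \<ge> 0" using \<beta> R by (simp add: Q_def)
  have pt: "\<beta> * (norm (grad \<phi> x) * (1 + norm (W x))) \<le> (\<phi> x * norm (W x) powr p) / 2 + indicator ?K x * Q" for x
  proof (cases "x \<in> ?K")
    case True
    define k where "k = 8 * \<beta> / R"
    have k: "k \<ge> 0" using \<beta> R by (simp add: k_def)
    have "\<beta> * (norm (grad \<phi> x) * (1 + norm (W x))) \<le> \<beta> * ((8 / R * b x) * (1 + norm (W x)))"
      using \<beta> g\<phi> by (intro mult_left_mono mult_right_mono) auto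
    also have "\<dots> = k * b x + k * (b x * norm (W x))" by (simp add: k_def algebra_simps add_divide_distrib)
    also have "k * b x \<le> k" using k b(3)[of x] by (simp add: mult_left_le)
    also have "k * (b x * norm (W x)) \<le> (b x * norm (W x)) powr p / 2 + (2 * k) powr p'"
      unfolding p'_def using b(2)[of x] k p by (intro young_half) auto
    also have "(b x * norm (W x)) powr p \<le> \<phi> x * norm (W x) powr p"
    proof -
      \<comment> \<open>Young's inequality leaves the power \<open>p\<close> on \<open>b x\<close>,
        while \<open>\<phi>\<close> carries only the square; \<open>b x \<le> 1\<close> and
        \<open>p > 2\<close> make the former smaller.\<close>
      have "b x powr p \<le> b x powr 2"
        using b(2,3)[of x] p by (intro powr_mono') auto
      also have "\<dots> = \<phi> x" using b(2)[of x] by (cases "b x = 0") (auto simp: \<phi>_def power2_eq_square)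
      finally show ?thesis using b(2)[of x] by (simp add: powr_mult mult_right_mono)
    qed
    finally show ?thesis using True by (simp add: Q_def k_def)
  next
    case False
    have "norm (grad \<phi> x) \<le> 0" using g\<phi>[of x] b(4)[OF False] by simp
    then show ?thesis using \<phi>K[OF False] False by simp
  qed
  have m: "measure lborel ?K = ?V * R powr ?N" using R by (intro measure_cball_eq) auto
  have "\<beta> * (LBINT x. norm (grad \<phi> x) * (1 + norm (W x)))
     = (LBINT x. \<beta> * (norm (grad \<phi> x) * (1 + norm (W x))))" by simp
  also have "\<dots> \<le> (LBINT x. (\<phi> x * norm (W x) powr p) / 2 + indicator ?K x * Q)"
  proof (rule integral_mono_AE')
    show "integrable lborel (\<lambda>x. (\<phi> x * norm (W x) powr p) / 2 + indicator ?K x * Q)"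
      using i1 integrable_cball_const by (intro Bochner_Integration.integrable_add integrable_divide) auto
    show "AE x in lborel. 0 \<le> (\<phi> x * norm (W x) powr p) / 2 + indicator ?K x * Q"
      using \<phi>0 Q0 by simp
  qed (use pt in auto)
  also have "\<dots> = (LBINT x. \<phi> x * norm (W x) powr p) / 2 + ?V * R powr ?N * Q"
    using i1 integrable_cball_const[of z R Q] m by simp
  finally have grad_le: "\<beta> * (LBINT x. norm (grad \<phi> x) * (1 + norm (W x)))
    \<le> (LBINT x. \<phi> x * norm (W x) powr p) / 2 + ?V * R powr ?N * Q" .
  have "(LBINT x. \<phi> x * \<bar>f x\<bar>) \<le> (LBINT x. indicator ?K x *\<^sub>R \<bar>f x\<bar>)"
  proof (rule integral_mono[OF i3 fi[OF compact_cball z]])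
    show "\<phi> x * \<bar>f x\<bar> \<le> indicator ?K x *\<^sub>R \<bar>f x\<bar>" for x
      using \<phi>0(2)[of x] \<phi>K[of x] by (auto simp: indicator_def intro!: mult_left_le_one_le \<phi>0)
  qed
  also have "\<dots> \<le> F * R powr (?N - s)" by (rule fF[OF R z])
  \<comment> \<open>For \<open>R \<le> 1\<close> a larger exponent in the loss only weakens the
    bound, so both error terms can be written with the common \<open>\<sigma>\<close>.\<close>
  also have "\<dots> \<le> F * R powr (?N - \<sigma>)" using F R \<sigma> by (intro mult_left_mono powr_mono') auto
  finally have f_le: "(LBINT x. \<phi> x * \<bar>f x\<bar>) \<le> F * R powr (?N - \<sigma>)" .
  have Q_le: "?V * R powr ?N * Q \<le> ?V * (8 * \<beta> + (16 * \<beta>) powr p') * R powr (?N - \<sigma>)"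
  proof -
    have r1: "1 / R \<le> R powr (- p')"
    proof -
      have "1 / R = R powr (- 1)" using R by (simp add: powr_minus_divide)
      also have "\<dots> \<le> R powr (- p')" using R p' by (intro powr_mono') auto
      finally show ?thesis .
    qed
    have "8 * \<beta> / R = 8 * \<beta> * (1 / R)" by simp
    also have "\<dots> \<le> 8 * \<beta> * R powr (- p')" using r1 \<beta> by (intro mult_left_mono) auto
    finally have "8 * \<beta> / R \<le> 8 * \<beta> * R powr (- p')" .
    moreover have "(16 * \<beta> / R) powr p' = (16 * \<beta>) powr p' * R powr (- p')"
      using R \<beta> by (simp add: powr_divide powr_minus_divide)
    ultimately have "Q \<le> (8 * \<beta> + (16 * \<beta>) powr p') * R powr (- p')"
      by (simp add: Q_def distrib_right)
    then have "?V * R powr ?N * Q \<le> ?V * R powr ?N * ((8 * \<beta> + (16 * \<beta>) powr p') * R powr (- p'))"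
      using V by (intro mult_left_mono) auto
    also have "\<dots> = ?V * (8 * \<beta> + (16 * \<beta>) powr p') * R powr (?N - p')"
      by (simp add: powr_diff powr_minus_divide)
    also have "\<dots> \<le> ?V * (8 * \<beta> + (16 * \<beta>) powr p') * R powr (?N - \<sigma>)"
      using V \<beta> R \<sigma> by (intro mult_left_mono powr_mono') (auto simp: p'_def)
    finally show ?thesis .
  qed
  have main: "(LBINT x. \<phi> x * norm (W x) powr p) / 2 + lam * (LBINT x. \<phi> x * w x) \<le> C1 * R powr (?N - \<sigma>)"
    using E[OF \<phi>t \<phi>0(1)] grad_le f_le Q_le by (simp add: C1_def p'_def algebra_simps)
  have pos1: "0 \<le> (LBINT x. \<phi> x * norm (W x) powr p)" and pos2: "0 \<le> (LBINT x. \<phi> x * w x)"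
    using \<phi>0 w0 by (auto intro!: integral_nonneg_AE)
  have b0: "indicator (cball z (R / 2)) x \<le> exp (8 / 3) * \<phi> x" for x
  proof (cases "x \<in> cball z (R / 2)")
    case True
    then have "exp (- (4 / 3)) \<le> b x" unfolding b_def
      by (intro bump_ge R) (auto simp: dist_norm norm_minus_commute)
    then have "exp (- (4 / 3)) * exp (- (4 / 3)) \<le> \<phi> x" unfolding \<phi>_def using b(2)[of x] by (intro mult_mono) auto
    then have "exp (8 / 3) * (exp (- (4 / 3)) * exp (- (4 / 3))) \<le> exp (8 / 3) * \<phi> x" by simp
    then show ?thesis using True by (simp flip: exp_add)
  qed (simp add: \<phi>0)
  show iW: "integrable lborel (\<lambda>x. indicator (cball z (R / 2)) x * norm (W x) powr p)"
    using Wp[OF compact_cball, of z "R / 2"] z R by (simp add: subset_trans[of _ "cball z R"] subset_cball)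
  have "(LBINT x. indicator (cball z (R / 2)) x * norm (W x) powr p)
     \<le> (LBINT x. exp (8 / 3) * (\<phi> x * norm (W x) powr p))"
  proof (rule integral_mono[OF iW integrable_mult_right[OF i1]])
    show "indicator (cball z (R / 2)) x * norm (W x) powr p \<le> exp (8 / 3) * (\<phi> x * norm (W x) powr p)" for x
      unfolding mult.assoc[symmetric] by (intro mult_right_mono b0) simp
  qed
  also have "\<dots> = exp (8 / 3) * (LBINT x. \<phi> x * norm (W x) powr p)" by simp
  also have "\<dots> \<le> exp (8 / 3) * (2 * (C1 * R powr (?N - \<sigma>)))"
    using main pos2 lam mult_nonneg_nonneg[of lam "LBINT x. \<phi> x * w x"]
    by (intro mult_left_mono) (auto simp del: mult_nonneg_nonneg)
  finally show ?W by (simp add: mult_ac)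
  have "cball z (R / 2) \<subseteq> \<Omega>" using z R by (auto intro: subset_trans[OF _ z])
  then have iw: "integrable lborel (\<lambda>x. indicator (cball z (R / 2)) x * w x)"
    using wp by (simp add: weak_pair_def)
  have "(LBINT x. indicator (cball z (R / 2)) x * w x)
     \<le> (LBINT x. exp (8 / 3) * (\<phi> x * w x))"
  proof (rule integral_mono[OF iw integrable_mult_right[OF i2]])
    show "indicator (cball z (R / 2)) x * w x \<le> exp (8 / 3) * (\<phi> x * w x)" for x
      unfolding mult.assoc[symmetric] by (intro mult_right_mono b0 w0)
  qed
  also have "\<dots> = exp (8 / 3) * (LBINT x. \<phi> x * w x)" by simp
  also have "\<dots> \<le> exp (8 / 3) * (C1 * R powr (?N - \<sigma>) / lam)"
    using main pos1 lam by (intro mult_left_mono) (auto simp: field_simps)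
  finally show ?w by (simp add: mult_ac)
qed

text \<open>Instead of Hoelder's inequality, \<open>le_powr_split\<close> is applied with \<open>\<kappa> = R powr (- \<sigma> / p)\<close>, which
  balances the two terms.\<close>

lemma ball_gradient:
  fixes w :: "real^'n \<Rightarrow> real"
  assumes en: "energy \<Omega> \<beta> lam p s F f w W" and \<beta>: "\<beta> > 0" and p: "p > 2" and lam: "lam > 0"
    and z: "cball z R \<subseteq> \<Omega>" and R: "0 < R" "R \<le> 1" and F: "F \<ge> 0"
    and \<sigma>: "\<sigma> \<ge> s" "\<sigma> \<ge> p / (p - 1)"
  defines "C1 \<equiv> F + unit_ball_vol (real CARD('n)) * (8 * \<beta> + (16 * \<beta>) powr (p / (p - 1)))"
  shows "(LBINT x. indicator (cball z (R / 2)) x * norm (W x))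
      \<le> (2 * exp (8 / 3) * C1 + unit_ball_vol (real CARD('n))) * R powr (real CARD('n) - \<sigma> / p)"
proof -
  let ?N = "real CARD('n)" and ?V = "unit_ball_vol (real CARD('n))" and ?B = "cball z (R / 2)"
  have V: "?V > 0" by (rule unit_ball_vol_pos) simp
  note be = ball_energy[OF en \<beta> p lam z R F \<sigma>, folded C1_def]
  define \<kappa> where "\<kappa> = R powr (- (\<sigma> / p))"
  have \<kappa>: "\<kappa> > 0" using R by (simp add: \<kappa>_def)
  have "(LBINT x. indicator ?B x * norm (W x))
     \<le> (LBINT x. \<kappa> powr (1 - p) * (indicator ?B x * norm (W x) powr p) + indicator ?B x * \<kappa>)"
  proof (rule integral_mono_AE')
    show "integrable lborel (\<lambda>x. \<kappa> powr (1 - p) * (indicator ?B x * norm (W x) powr p) + indicator ?B x * \<kappa>)"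
      using be(3) integrable_cball_const by (intro Bochner_Integration.integrable_add) auto
    show "AE x in lborel. indicator ?B x * norm (W x)
      \<le> \<kappa> powr (1 - p) * (indicator ?B x * norm (W x) powr p) + indicator ?B x * \<kappa>"
      using le_powr_split[OF norm_ge_zero \<kappa>, of p] p by (intro AE_I2) (auto simp: indicator_def)
  qed (use \<kappa> in auto)
  also have "\<dots> = \<kappa> powr (1 - p) * (LBINT x. indicator ?B x * norm (W x) powr p)
      + ?V * (R / 2) powr ?N * \<kappa>"
    using be(3) integrable_cball_const[of z "R / 2" \<kappa>] R by (simp add: measure_cball_eq)
  also have "\<dots> \<le> \<kappa> powr (1 - p) * (2 * exp (8 / 3) * C1 * R powr (?N - \<sigma>)) + ?V * R powr ?N * \<kappa>"
    using be(1) \<kappa> V R by (intro add_mono mult_left_mono mult_right_mono powr_mono2) auto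
  also have "\<kappa> powr (1 - p) * (2 * exp (8 / 3) * C1 * R powr (?N - \<sigma>))
      = 2 * exp (8 / 3) * C1 * (\<kappa> powr (1 - p) * R powr (?N - \<sigma>))" by (simp add: mult_ac)
  also have "\<kappa> powr (1 - p) * R powr (?N - \<sigma>) = R powr (?N - \<sigma> / p)"
    unfolding \<kappa>_def powr_powr using R p by (simp add: field_simps flip: powr_add)
  also have "?V * R powr ?N * \<kappa> = ?V * R powr (?N - \<sigma> / p)"
    unfolding \<kappa>_def using R by (simp add: powr_diff powr_minus_divide)
  finally show ?thesis by (simp add: algebra_simps)
qed

section \<open>Averages along cones\<close>

text \<open>The numerator is written as the divergence of \<open>\<psi>(z) z\<close> at the scaled
  point, the form in which \<open>scaling_weak\<close> can integrate by parts.\<close>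

lemma kernel_time_derivative:
  fixes \<psi> :: "real^'n \<Rightarrow> real"
  assumes \<psi>: "smooth_fun \<psi>" and t: "t > 0"
  shows "((\<lambda>t. \<psi> ((1 / t) *\<^sub>R (y - x)) / t ^ CARD('n)) has_field_derivative
     - ((real CARD('n) * \<psi> ((1 / t) *\<^sub>R (y - x)) + grad \<psi> ((1 / t) *\<^sub>R (y - x)) \<bullet> ((1 / t) *\<^sub>R (y - x)))
        / t ^ Suc CARD('n))) (at t)"
proof -
  let ?\<xi> = "(1 / t) *\<^sub>R (y - x)"
  obtain m where m: "CARD('n) = Suc m" using zero_less_card_finite not0_implies_Suc by (metis less_irrefl)
  have "((\<lambda>t. 1 / t) has_field_derivative - (1 / t\<^sup>2)) (at t)"
    using t by (auto intro!: derivative_eq_intros simp: power2_eq_square)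
  then have "((\<lambda>t. (1 / t) *\<^sub>R (y - x)) has_derivative (\<lambda>h. (- (1 / t\<^sup>2) * h) *\<^sub>R (y - x))) (at t)"
    unfolding has_field_derivative_def by (rule has_derivative_scaleR_left)
  from has_derivative_compose[OF this smooth_has_derivative[OF \<psi>]]
  have "((\<lambda>t. \<psi> ((1 / t) *\<^sub>R (y - x))) has_derivative (\<lambda>h. (- (grad \<psi> ?\<xi> \<bullet> ?\<xi>) / t) * h)) (at t)"
    by (rule has_derivative_eq_rhs) (simp add: fun_eq_iff power2_eq_square)
  then have 1: "((\<lambda>t. \<psi> ((1 / t) *\<^sub>R (y - x))) has_field_derivative - (grad \<psi> ?\<xi> \<bullet> ?\<xi>) / t) (at t)"
    unfolding has_field_derivative_def .
  have 2: "((\<lambda>t. t ^ CARD('n)) has_field_derivative real CARD('n) * t ^ m) (at t)"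
    using DERIV_pow[of "CARD('n)" t] by (simp add: m)
  have "((\<lambda>t. \<psi> ((1 / t) *\<^sub>R (y - x)) / t ^ CARD('n)) has_field_derivative
      ((- (grad \<psi> ?\<xi> \<bullet> ?\<xi>) / t) * t ^ CARD('n) - \<psi> ?\<xi> * (real CARD('n) * t ^ m))
       / (t ^ CARD('n) * t ^ CARD('n))) (at t)"
    by (rule DERIV_divide[OF 1 2]) (use t in simp)
  also have "((- (grad \<psi> ?\<xi> \<bullet> ?\<xi>) / t) * t ^ CARD('n) - \<psi> ?\<xi> * (real CARD('n) * t ^ m))
       / (t ^ CARD('n) * t ^ CARD('n))
     = - ((real CARD('n) * \<psi> ?\<xi> + grad \<psi> ?\<xi> \<bullet> ?\<xi>) / t ^ Suc CARD('n))"
  proof -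
    define a b n where "a = grad \<psi> ?\<xi> \<bullet> ?\<xi>" and "b = \<psi> ?\<xi>" and "n = real CARD('n)"
    define q where "q = t ^ m"
    have "q > 0" using t by (simp add: q_def)
    then show ?thesis using t
      unfolding m power_Suc a_def[symmetric] b_def[symmetric] n_def[symmetric, unfolded m] q_def[symmetric]
      by (simp add: field_simps)
  qed
  finally show ?thesis .
qed

lemma in_cball_scaled:
  fixes x y e :: "real^'n"
  assumes "t > 0"
  shows "(1 / t) *\<^sub>R (y - x) \<in> cball e c \<longleftrightarrow> y \<in> cball (x + t *\<^sub>R e) (c * t)"
proof -
  have "norm ((x + t *\<^sub>R e) - y) = t * norm (e - (1 / t) *\<^sub>R (y - x))"
  proof -
    have "(x + t *\<^sub>R e) - y = t *\<^sub>R (e - (1 / t) *\<^sub>R (y - x))" using assms by (simp add: algebra_simps)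
    then show ?thesis using assms by simp
  qed
  then show ?thesis using assms by (simp add: dist_norm field_simps)
qed

text \<open>The kernel \<open>\<psi>((y - x)/t)/t\<^sup>N\<close> is transported by the vector field \<open>(y - x)/t\<close>, so its
  derivative in \<open>t\<close> is minus the divergence of the kernel times this field; each component of
  the product is a test function.\<close>

lemma scaling_weak:
  fixes \<psi> :: "real^'n \<Rightarrow> real"
  assumes wp: "weak_pair \<Omega> w W" and \<psi>: "smooth_fun \<psi>" "\<And>z. z \<notin> cball e c \<Longrightarrow> \<psi> z = 0"
    and t: "t > 0" and sub: "cball (x + t *\<^sub>R e) (c * t) \<subseteq> \<Omega>"
  shows "(LBINT y. ((real CARD('n) * \<psi> ((1 / t) *\<^sub>R (y - x)) + grad \<psi> ((1 / t) *\<^sub>R (y - x)) \<bullet> ((1 / t) *\<^sub>R (y - x)))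
        / t ^ Suc CARD('n)) * w y)
     = - (LBINT y. (\<psi> ((1 / t) *\<^sub>R (y - x)) / t ^ CARD('n)) * (((1 / t) *\<^sub>R (y - x)) \<bullet> W y))"
proof -
  let ?\<xi> = "\<lambda>y. (1 / t) *\<^sub>R (y - x)" and ?K = "cball (x + t *\<^sub>R e) (c * t)"
  \<comment> \<open>After rescaling, \<open>h i\<close> becomes the \<open>i\<close>-th component of
    the kernel times the field; the \<open>i\<close>-th partial derivatives add up to the
    divergence.\<close>
  define h where "h i z = (1 / t ^ CARD('n)) * (\<psi> z * (z \<bullet> axis i 1))" for i :: 'n and z
  define \<phi> where "\<phi> i y = h i (?\<xi> y)" for i y
  have [measurable]: "w \<in> borel_measurable borel" "W \<in> borel_measurable borel"
    and wi: "integrable lborel (\<lambda>x. indicator ?K x *\<^sub>R w x)" and Wi: "integrable lborel (\<lambda>x. indicator ?K x *\<^sub>R W x)"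
    using wp sub by (auto simp: weak_pair_def)
  have h: "smooth_fun (h i)" for i
    unfolding h_def[abs_def] by (intro smooth_mult smooth_const \<psi> smooth_inner)
  have gi: "grad (\<lambda>z. z \<bullet> v) z = v" for v z :: "real^'n"
    by (rule grad_eqI) (auto intro!: derivative_eq_intros simp: inner_commute)
  have gh: "grad (h i) z = (1 / t ^ CARD('n)) *\<^sub>R (\<psi> z *\<^sub>R axis i 1 + (z \<bullet> axis i 1) *\<^sub>R grad \<psi> z)" for i z
  proof (rule grad_eqI)
    show "(h i has_derivative (\<lambda>v. ((1 / t ^ CARD('n)) *\<^sub>R (\<psi> z *\<^sub>R axis i 1 + (z \<bullet> axis i 1) *\<^sub>R grad \<psi> z)) \<bullet> v)) (at z)"
      unfolding h_def[abs_def]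
      by (rule has_derivative_eq_rhs, rule has_derivative_mult_right,
          rule has_derivative_mult[OF smooth_has_derivative[OF \<psi>(1)]
            smooth_has_derivative[OF smooth_inner]])
        (auto simp: gi inner_add_left algebra_simps)
  qed
  have \<phi>s: "smooth_fun (\<phi> i)" for i unfolding \<phi>_def[abs_def] by (rule smooth_dilate[OF h])
  have out: "?\<xi> y \<notin> cball e c" if "y \<notin> ?K" for y using that in_cball_scaled[OF t] by blast
  have \<phi>0: "\<phi> i y = 0" if "y \<notin> ?K" for i y
    using \<psi>(2)[OF out[OF that]] by (simp add: \<phi>_def h_def)
  have g\<phi>0: "grad (\<phi> i) y = 0" if "y \<notin> ?K" for i y
    by (rule grad_eq_0_outside[where K="?K"]) (use \<phi>0 that in auto)
  have \<phi>t: "\<phi> i \<in> test_functions \<Omega>" for i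
    unfolding test_functions_iff by (intro conjI \<phi>s exI[of _ ?K]) (use sub \<phi>0 in auto)
  have g\<phi>: "grad (\<phi> i) y = (1 / t) *\<^sub>R grad (h i) (?\<xi> y)" for i y
    unfolding \<phi>_def[abs_def] by (rule grad_affine[OF h])
  have m\<phi>[measurable]: "\<phi> i \<in> borel_measurable borel" "grad (\<phi> i) \<in> borel_measurable borel" for i
    using \<phi>s by (auto intro: borel_measurable_smooth borel_measurable_grad)
  have i1: "integrable lborel (\<lambda>y. w y *\<^sub>R grad (\<phi> i) y)" for i
  proof -
    obtain B where B: "\<And>y. norm (grad (\<phi> i) y) \<le> B"
      using continuous_compact_support_bounded[OF continuous_on_grad[OF \<phi>s] compact_cball g\<phi>0] by blast
    show ?thesis by (rule integrable_bounded_mult2[OF wi _ _ g\<phi>0 B]) auto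
  qed
  have i2: "integrable lborel (\<lambda>y. \<phi> i y *\<^sub>R W y)" for i
  proof -
    obtain B where B: "\<And>y. norm (\<phi> i y) \<le> B"
      using continuous_compact_support_bounded[OF smooth_continuous[OF \<phi>s] compact_cball \<phi>0] by blast
    show ?thesis by (rule integrable_bounded_mult[OF Wi _ _ \<phi>0 B[unfolded real_norm_def]]) auto
  qed
  have eq: "(LBINT y. (w y *\<^sub>R grad (\<phi> i) y) \<bullet> axis i 1) = - (LBINT y. (\<phi> i y *\<^sub>R W y) \<bullet> axis i 1)" for i
  proof -
    have "(LBINT y. w y *\<^sub>R grad (\<phi> i) y) = - (LBINT y. \<phi> i y *\<^sub>R W y)"
      using wp \<phi>t by (simp add: weak_pair_def)
    then show ?thesis
      by (simp only: integral_inner_left[OF i1] integral_inner_left[OF i2] inner_minus_left)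
  qed
  have sum_axis: "(\<Sum>i\<in>UNIV. (a \<bullet> axis i 1) * (b \<bullet> axis i 1)) = a \<bullet> b" for a b :: "real^'n"
    unfolding inner_axis by (simp add: inner_vec_def)
  have "(LBINT y. ((real CARD('n) * \<psi> (?\<xi> y) + grad \<psi> (?\<xi> y) \<bullet> ?\<xi> y) / t ^ Suc CARD('n)) * w y)
      = (LBINT y. (\<Sum>i\<in>UNIV. (w y *\<^sub>R grad (\<phi> i) y) \<bullet> axis i 1))"
  proof (rule Bochner_Integration.integral_cong[OF refl])
    fix y
    have "(\<Sum>i\<in>UNIV. (w y *\<^sub>R grad (\<phi> i) y) \<bullet> axis i 1)
       = (\<Sum>i\<in>UNIV. (w y / t ^ Suc CARD('n)) * (\<psi> (?\<xi> y) + (?\<xi> y \<bullet> axis i 1) * (grad \<psi> (?\<xi> y) \<bullet> axis i 1)))"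
      by (intro sum.cong refl) (simp add: g\<phi> gh inner_add_left inner_axis_axis)
    also have "\<dots> = (w y / t ^ Suc CARD('n)) * (real CARD('n) * \<psi> (?\<xi> y) + ?\<xi> y \<bullet> grad \<psi> (?\<xi> y))"
      by (simp only: sum_distrib_left[symmetric] sum.distrib sum_axis sum_constant)
    finally show "((real CARD('n) * \<psi> (?\<xi> y) + grad \<psi> (?\<xi> y) \<bullet> ?\<xi> y) / t ^ Suc CARD('n)) * w y
      = (\<Sum>i\<in>UNIV. (w y *\<^sub>R grad (\<phi> i) y) \<bullet> axis i 1)"
      by (simp only: inner_commute[of "?\<xi> y"] times_divide_eq_left times_divide_eq_right mult.commute)
  qed
  also have "\<dots> = (\<Sum>i\<in>UNIV. LBINT y. (w y *\<^sub>R grad (\<phi> i) y) \<bullet> axis i 1)"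
    by (rule Bochner_Integration.integral_sum) (intro integrable_inner_left i1)
  also have "\<dots> = - (\<Sum>i\<in>UNIV. LBINT y. (\<phi> i y *\<^sub>R W y) \<bullet> axis i 1)"
    by (simp only: eq sum_negf)
  also have "(\<Sum>i\<in>UNIV. LBINT y. (\<phi> i y *\<^sub>R W y) \<bullet> axis i 1)
      = (LBINT y. (\<Sum>i\<in>UNIV. (\<phi> i y *\<^sub>R W y) \<bullet> axis i 1))"
    by (rule Bochner_Integration.integral_sum[symmetric]) (intro integrable_inner_left i2)
  also have "\<dots> = (LBINT y. (\<psi> (?\<xi> y) / t ^ CARD('n)) * (?\<xi> y \<bullet> W y))"
  proof (rule Bochner_Integration.integral_cong[OF refl])
    fix y
    have "(\<Sum>i\<in>UNIV. (\<phi> i y *\<^sub>R W y) \<bullet> axis i 1)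
      = (\<Sum>i\<in>UNIV. (\<psi> (?\<xi> y) / t ^ CARD('n)) * ((?\<xi> y \<bullet> axis i 1) * (W y \<bullet> axis i 1)))"
      by (intro sum.cong refl) (simp add: \<phi>_def h_def)
    also have "\<dots> = (\<psi> (?\<xi> y) / t ^ CARD('n)) * (?\<xi> y \<bullet> W y)"
      by (simp only: sum_distrib_left[symmetric] sum_axis)
    finally show "(\<Sum>i\<in>UNIV. (\<phi> i y *\<^sub>R W y) \<bullet> axis i 1) = (\<psi> (?\<xi> y) / t ^ CARD('n)) * (?\<xi> y \<bullet> W y)" .
  qed
  finally show ?thesis .
qed

text \<open>For smooth \<open>w\<close> the average is the integral of
  \<open>\<psi> z * w (x + t *\<^sub>R z)\<close>, with derivative the integral of
  \<open>\<psi> z * (z \<bullet> W (x + t *\<^sub>R z))\<close>. Here \<open>w\<close> is only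
  weakly differentiable, so the kernel is differentiated in \<open>t\<close> and
  \<open>scaling_weak\<close> moves the derivative back. The doubled radius in the hypothesis leaves
  room to vary \<open>t\<close>.\<close>

lemma average_has_derivative:
  fixes \<psi> :: "real^'n \<Rightarrow> real"
  assumes wp: "weak_pair \<Omega> w W" and \<psi>: "smooth_fun \<psi>" "\<And>z. z \<notin> cball e c \<Longrightarrow> \<psi> z = 0"
    and e: "norm e = 1" and c: "0 < c" "c \<le> 1"
    and t: "t0 > 0" and sub: "cball (x + t0 *\<^sub>R e) (2 * c * t0) \<subseteq> \<Omega>"
  shows "((\<lambda>t. LBINT y. (\<psi> ((1 / t) *\<^sub>R (y - x)) / t ^ CARD('n)) * w y) has_field_derivative
     (LBINT y. (\<psi> ((1 / t0) *\<^sub>R (y - x)) / t0 ^ CARD('n)) * (((1 / t0) *\<^sub>R (y - x)) \<bullet> W y))) (at t0)"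
proof -
  let ?\<xi> = "\<lambda>t y. (1 / t) *\<^sub>R (y - x)" and ?K = "cball (x + t0 *\<^sub>R e) (2 * c * t0)" and ?n = "CARD('n)"
  define k where "k t y = \<psi> (?\<xi> t y) / t ^ ?n" for t y
  define k' where "k' t y = - ((real ?n * \<psi> (?\<xi> t y) + grad \<psi> (?\<xi> t y) \<bullet> ?\<xi> t y) / t ^ Suc ?n)" for t y
  \<comment> \<open>The kernel at a scale within \<open>d\<close> of \<open>t0\<close> lives within
    \<open>c * t0 + 2 * d = 2 * c * t0\<close> of the centre for \<open>t0\<close>, that is, in
    \<open>?K\<close>.\<close>
  define d where "d = c * t0 / 2"
  have d: "d > 0" "d \<le> t0 / 2" using c t by (auto simp: d_def)
  have [measurable]: "w \<in> borel_measurable borel" "W \<in> borel_measurable borel"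
    and wi: "integrable lborel (\<lambda>x. indicator ?K x *\<^sub>R w x)"
    using wp sub by (auto simp: weak_pair_def)
  have [measurable]: "\<psi> \<in> borel_measurable borel" "grad \<psi> \<in> borel_measurable borel"
    using \<psi>(1) by (auto intro: borel_measurable_smooth borel_measurable_grad)
  obtain B where B: "B > 0" "\<And>z. \<bar>\<psi> z\<bar> \<le> B"
    using continuous_compact_support_bounded[where f=\<psi> and K="cball e c"] smooth_continuous[OF \<psi>(1)] \<psi>(2)
    by (auto simp only: compact_cball real_norm_def)
  have g0: "grad \<psi> z = 0" if "z \<notin> cball e c" for z
    by (rule grad_eq_0_outside[where K="cball e c"]) (use \<psi>(2) that in auto)
  obtain B' where B': "B' > 0" "\<And>z. norm (grad \<psi> z) \<le> B'"
    using continuous_compact_support_bounded[OF continuous_on_grad[OF \<psi>(1)] compact_cball g0] by blast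
  have gz: "\<bar>grad \<psi> z \<bullet> z\<bar> \<le> B' * 2" for z
  proof (cases "z \<in> cball e c")
    case True
    then have "norm z \<le> 2" using e c norm_triangle_ineq2[of z e] by (auto simp: dist_norm norm_minus_commute)
    then have "norm (grad \<psi> z) * norm z \<le> B' * 2" using B' by (intro mult_mono) auto
    then show ?thesis using Cauchy_Schwarz_ineq2[of "grad \<psi> z" z] by linarith
  qed (use g0 B' in auto)
  have inK: "y \<in> ?K" if "\<bar>t - t0\<bar> < d" "y \<in> cball (x + t *\<^sub>R e) (c * t)" for t y
  proof -
    have "norm (x + t0 *\<^sub>R e - y) \<le> norm (x + t *\<^sub>R e - y) + norm ((t0 - t) *\<^sub>R e)"
      using norm_triangle_ineq[of "x + t *\<^sub>R e - y" "(t0 - t) *\<^sub>R e"] by (simp add: algebra_simps)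
    also have "\<dots> \<le> c * t + \<bar>t - t0\<bar>" using that e by (simp add: dist_norm abs_minus_commute)
    also have "\<dots> \<le> c * (t0 + d) + d" using that c by (intro add_mono mult_left_mono) auto
    also have "\<dots> \<le> c * t0 + 2 * d" using c d by (simp add: algebra_simps mult_left_le)
    finally show ?thesis using c by (simp add: d_def dist_norm)
  qed
  \<comment> \<open>Differentiation under the integral needs a weight integrable on the whole space,
    so \<open>w\<close> is cut off to \<open>?K\<close>; near \<open>t0\<close> the kernel vanishes
    outside \<open>?K\<close> and the cutoff is removed again.\<close>
  have main: "((\<lambda>t. LBINT y. k t y * (indicator ?K y *\<^sub>R w y)) has_derivative
      (\<lambda>v. LBINT y. (k' t0 y * v) * (indicator ?K y *\<^sub>R w y))) (at t0)"
  proof (rule has_derivative_lebesgue_integral[where d=d and B="(real ?n * B + B' * 2) / (t0 / 2) ^ Suc ?n"])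
    show "d > 0" by fact
    fix t y v assume "t \<in> ball t0 d"
    then have tt: "t > t0 / 2" using d by (auto simp: dist_real_def)
    then have t': "t > 0" using t by linarith
    show "((\<lambda>t. k t y) has_derivative (*) (k' t y)) (at t)"
      using kernel_time_derivative[OF \<psi>(1) t', of y x] by (simp add: has_field_derivative_def k_def k'_def)
    have "\<bar>k' t y\<bar> = \<bar>real ?n * \<psi> (?\<xi> t y) + grad \<psi> (?\<xi> t y) \<bullet> ?\<xi> t y\<bar> / t ^ Suc ?n"
      unfolding k'_def abs_minus_cancel abs_divide using t' by (simp add: abs_mult)
    also have "\<dots> \<le> (real ?n * B + B' * 2) / (t0 / 2) ^ Suc ?n"
    proof (intro frac_le power_mono)
      have "\<bar>real ?n * \<psi> (?\<xi> t y)\<bar> \<le> real ?n * B"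
        unfolding abs_mult using B(2) by (simp add: mult_left_mono)
      with gz[of "?\<xi> t y"] show "\<bar>real ?n * \<psi> (?\<xi> t y) + grad \<psi> (?\<xi> t y) \<bullet> ?\<xi> t y\<bar> \<le> real ?n * B + B' * 2"
        by linarith
    qed (use tt t B B' in auto)
    finally show "\<bar>k' t y * v\<bar> \<le> (real ?n * B + B' * 2) / (t0 / 2) ^ Suc ?n * norm v"
      unfolding abs_mult real_norm_def by (rule mult_right_mono) simp
  next
    fix t
    show "k t \<in> borel_measurable lborel" unfolding k_def[abs_def] by measurable
    show "(\<lambda>y. k' t0 y * v) \<in> borel_measurable lborel" for v unfolding k'_def[abs_def] by measurable
    show "integrable lborel (\<lambda>y. indicator ?K y *\<^sub>R w y)" by (rule wi)
    show "integrable lborel (\<lambda>y. k t y * (indicator ?K y *\<^sub>R w y))"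
    proof (rule Bochner_Integration.integrable_bound)
      show "integrable lborel (\<lambda>y. (B / \<bar>t ^ ?n\<bar>) * (indicator ?K y *\<^sub>R w y))"
        using wi by (rule integrable_mult_right)
      show "AE y in lborel. norm (k t y * (indicator ?K y *\<^sub>R w y)) \<le> norm ((B / \<bar>t ^ ?n\<bar>) * (indicator ?K y *\<^sub>R w y))"
      proof (intro AE_I2)
        fix y
        have "\<bar>k t y\<bar> \<le> \<bar>B / \<bar>t ^ ?n\<bar>\<bar>"
          unfolding k_def abs_divide abs_abs
          by (intro divide_right_mono order_trans[OF B(2) abs_ge_self]) simp
        then show "norm (k t y * (indicator ?K y *\<^sub>R w y)) \<le> norm ((B / \<bar>t ^ ?n\<bar>) * (indicator ?K y *\<^sub>R w y))"
          unfolding real_norm_def abs_mult[of "k t y"] abs_mult[of "B / \<bar>t ^ ?n\<bar>"]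
          by (rule mult_right_mono) simp
      qed
      have "k t \<in> borel_measurable lborel" unfolding k_def[abs_def] by measurable
      then show "(\<lambda>y. k t y * (indicator ?K y *\<^sub>R w y)) \<in> borel_measurable lborel"
        by (intro borel_measurable_times borel_measurable_integrable[OF wi])
    qed
  qed
  have kK: "k t y * w y = k t y * (indicator ?K y *\<^sub>R w y)" if "\<bar>t - t0\<bar> < d" for t y
  proof (cases "y \<in> ?K")
    case False
    have "t > 0" using that d t by linarith
    then have "?\<xi> t y \<notin> cball e c" using inK[OF that] False in_cball_scaled by blast
    then show ?thesis by (simp add: k_def \<psi>(2))
  qed simp
  have k'K: "k' t0 y * (indicator ?K y *\<^sub>R w y) = k' t0 y * w y" for y
  proof (cases "y \<in> ?K")
    case False
    have "?\<xi> t0 y \<notin> cball e c" using inK[of t0] d False in_cball_scaled[OF t] by fastforce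
    then show ?thesis by (simp add: k'_def \<psi>(2) g0)
  qed simp
  have "(LBINT y. (k' t0 y * v) * (indicator ?K y *\<^sub>R w y)) = (LBINT y. k' t0 y * w y) * v" for v
  proof -
    have "(k' t0 y * v) * (indicator ?K y *\<^sub>R w y) = (k' t0 y * w y) * v" for y
      using k'K[of y] by (metis mult.assoc mult.commute)
    then have "(LBINT y. (k' t0 y * v) * (indicator ?K y *\<^sub>R w y)) = (LBINT y. (k' t0 y * w y) * v)"
      by (simp only:)
    then show ?thesis by simp
  qed
  with main have "((\<lambda>t. LBINT y. k t y * (indicator ?K y *\<^sub>R w y)) has_derivative
      (*) (LBINT y. k' t0 y * w y)) (at t0)"
    by (simp only:)
  then have "((\<lambda>t. LBINT y. k t y * w y) has_derivative
      (*) (LBINT y. k' t0 y * w y)) (at t0)"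
  proof (rule has_derivative_transform_within_open[where s="ball t0 d"])
    show "(LBINT y. k t y * (indicator ?K y *\<^sub>R w y)) = (LBINT y. k t y * w y)" if "t \<in> ball t0 d" for t
      using kK[of t] that by (intro Bochner_Integration.integral_cong) (auto simp: dist_real_def abs_minus_commute)
  qed (use d in auto)
  moreover have "(LBINT y. k' t0 y * w y)
     = (LBINT y. (\<psi> (?\<xi> t0 y) / t0 ^ ?n) * (?\<xi> t0 y \<bullet> W y))"
  proof -
    have "cball (x + t0 *\<^sub>R e) (c * t0) \<subseteq> \<Omega>"
      using sub c t by (intro subset_trans[OF subset_cball sub]) auto
    from scaling_weak[OF wp \<psi> t this] show ?thesis
      unfolding k'_def mult_minus_left integral_minus by linarith
  qed
  ultimately show ?thesis unfolding k_def has_field_derivative_def by simp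
qed

text \<open>The right-hand side involves neither \<open>t\<close> nor \<open>x\<close>. Hence it
  persists as \<open>t\<close> tends to \<open>0\<close> and is common to all vertices that share
  the direction and the opening of the cone.\<close>

lemma average_bound:
  fixes \<psi> w :: "real^'n \<Rightarrow> real"
  assumes en: "energy \<Omega> \<beta> lam p s F f w W" and \<beta>: "\<beta> > 0" and p: "p > 2" and lam: "lam > 0" and F: "F \<ge> 0"
    and s: "s < p"
    and \<psi>: "smooth_fun \<psi>" "\<And>z. z \<notin> cball e c \<Longrightarrow> \<psi> z = 0" "\<And>z. \<bar>\<psi> z\<bar> \<le> B"
    and e: "norm e = 1" and c: "0 < c" "2 * c \<le> 1" and T: "0 < T" "T \<le> 1"
    and cone: "\<And>t. 0 < t \<Longrightarrow> t \<le> T \<Longrightarrow> cball (x + t *\<^sub>R e) (2 * c * t) \<subseteq> \<Omega>"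
    and t: "0 < t" "t \<le> T"
  defines "\<sigma> \<equiv> max s (p / (p - 1))"
    and "C1 \<equiv> F + unit_ball_vol (real CARD('n)) * (8 * \<beta> + (16 * \<beta>) powr (p / (p - 1)))"
  shows "(LBINT y. (\<psi> ((1 / t) *\<^sub>R (y - x)) / t ^ CARD('n)) * w y)
    \<le> B / T ^ CARD('n) * (exp (8 / 3) * C1 / lam * (2 * c * T) powr (real CARD('n) - \<sigma>))
      + (2 * B * (2 * exp (8 / 3) * C1 + unit_ball_vol (real CARD('n)))) / (1 - \<sigma> / p)"
proof -
  let ?n = "CARD('n)" and ?N = "real CARD('n)" and ?V = "unit_ball_vol (real CARD('n))"
  let ?\<xi> = "\<lambda>t y. (1 / t) *\<^sub>R (y - x)" and ?K = "\<lambda>t. cball (x + t *\<^sub>R e) (c * t)"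
  \<comment> \<open>\<open>B\<close> bounds the kernel, \<open>2\<close> bounds the scaled point on
    the support since \<open>norm e + c \<le> 2\<close>, and the bracket is the constant of
    \<open>ball_gradient\<close>.\<close>
  define C4 where "C4 = 2 * B * (2 * exp (8 / 3) * C1 + ?V)"
  define \<tau> where "\<tau> = \<sigma> / p"
  define A where "A t = (LBINT y. (\<psi> (?\<xi> t y) / t ^ ?n) * w y)" for t
  define A' where "A' t = (LBINT y. (\<psi> (?\<xi> t y) / t ^ ?n) * (?\<xi> t y \<bullet> W y))" for t
  have V: "?V > 0" by (rule unit_ball_vol_pos) simp
  have B: "B \<ge> 0" using \<psi>(3)[of 0] by linarith
  have C1: "C1 \<ge> 0" using F V \<beta> by (simp add: C1_def)
  have C4: "C4 \<ge> 0" using B C1 V by (simp add: C4_def)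
  have "p / (p - 1) < p" using p by (simp add: field_simps)
  moreover have "p / (p - 1) > 0" using p by simp
  ultimately have \<sigma>p: "0 < \<sigma>" "\<sigma> < p" using s by (auto simp: \<sigma>_def)
  have \<tau>: "0 < \<tau>" "\<tau> < 1" using \<sigma>p p by (auto simp: \<tau>_def)
  have N1: "?N \<ge> 1" using zero_less_card_finite[where 'a='n] by linarith
  have \<tau>N: "\<tau> \<le> ?N" using N1 \<tau> by linarith
  have \<sigma>s: "\<sigma> \<ge> s" "\<sigma> \<ge> p / (p - 1)" by (auto simp: \<sigma>_def)
  note wp = energyD(1)[OF en] and w0 = energyD(2)[OF en]
  have meas[measurable]: "w \<in> borel_measurable borel" "W \<in> borel_measurable borel"
    using wp by (auto simp: weak_pair_def)
  \<comment> \<open>The interior estimates lose half of the radius: applied with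
    \<open>R = 2 * c * t\<close> they cover exactly the ball of radius \<open>c * t\<close> that
    carries the kernel.\<close>
  have half: "cball z (2 * c * t / 2) = cball z (c * t)" for z :: "real^'n" and t by simp
  have R: "0 < 2 * c * t" "2 * c * t \<le> 1" if "0 < t" "t \<le> T" for t
  proof -
    show "0 < 2 * c * t" using that c by simp
    have "2 * c * t \<le> 1 * 1" using that c T by (intro mult_mono) auto
    then show "2 * c * t \<le> 1" by simp
  qed
  have sub: "?K t \<subseteq> \<Omega>" if "0 < t" "t \<le> T" for t
    using cone[OF that] subset_cball[of "c * t" "2 * c * t" "x + t *\<^sub>R e"] c that by auto
  have D: "(A has_field_derivative A' t) (at t)" if "0 < t" "t \<le> T" for t
    unfolding A_def A'_def
    by (rule average_has_derivative[OF wp \<psi>(1,2) e c(1) _ that(1) cone[OF that]]) (use c in auto)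
  have xi: "norm (?\<xi> t y) \<le> 2" if "0 < t" "y \<in> ?K t" for t y
  proof -
    have "?\<xi> t y \<in> cball e c" using that in_cball_scaled by blast
    then show ?thesis using e c norm_triangle_ineq2[of "?\<xi> t y" e] by (auto simp: dist_norm norm_minus_commute)
  qed
  have \<psi>K: "\<psi> (?\<xi> t y) = 0" if "0 < t" "y \<notin> ?K t" for t y
    using that \<psi>(2) in_cball_scaled by blast
  have A'_bound: "\<bar>A' t\<bar> \<le> C4 * t powr (- \<tau>)" if t: "0 < t" "t \<le> T" for t
  proof -
    have Wi: "integrable lborel (\<lambda>y. indicator (?K t) y *\<^sub>R W y)"
      using wp sub[OF t] by (simp add: weak_pair_def)
    have Wi': "integrable lborel (\<lambda>y. indicator (?K t) y * norm (W y))"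
      using integrable_norm[OF Wi] by simp
    have "\<bar>A' t\<bar> \<le> (LBINT y. norm ((\<psi> (?\<xi> t y) / t ^ ?n) * (?\<xi> t y \<bullet> W y)))"
      unfolding A'_def using integral_norm_bound[of lborel "\<lambda>y. (\<psi> (?\<xi> t y) / t ^ ?n) * (?\<xi> t y \<bullet> W y)"] by simp
    also have "\<dots> \<le> (LBINT y. (2 * B / t ^ ?n) * (indicator (?K t) y * norm (W y)))"
    proof (rule integral_mono_AE')
      show "integrable lborel (\<lambda>y. (2 * B / t ^ ?n) * (indicator (?K t) y * norm (W y)))"
        using Wi' by (rule integrable_mult_right)
      show "AE y in lborel. norm ((\<psi> (?\<xi> t y) / t ^ ?n) * (?\<xi> t y \<bullet> W y))
         \<le> (2 * B / t ^ ?n) * (indicator (?K t) y * norm (W y))"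
      proof (intro AE_I2)
        fix y
        show "norm ((\<psi> (?\<xi> t y) / t ^ ?n) * (?\<xi> t y \<bullet> W y))
         \<le> (2 * B / t ^ ?n) * (indicator (?K t) y * norm (W y))"
        proof (cases "y \<in> ?K t")
          case True
          have "\<bar>?\<xi> t y \<bullet> W y\<bar> \<le> norm (?\<xi> t y) * norm (W y)" by (rule Cauchy_Schwarz_ineq2)
          also have "\<dots> \<le> 2 * norm (W y)" using xi[OF t(1) True] by (intro mult_right_mono) auto
          finally have 1: "\<bar>?\<xi> t y \<bullet> W y\<bar> \<le> 2 * norm (W y)" .
          have 2: "\<bar>\<psi> (?\<xi> t y) / t ^ ?n\<bar> \<le> B / t ^ ?n"
            using \<psi>(3)[of "?\<xi> t y"] t by (simp add: abs_divide divide_right_mono)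
          have "\<bar>\<psi> (?\<xi> t y) / t ^ ?n\<bar> * \<bar>?\<xi> t y \<bullet> W y\<bar> \<le> (B / t ^ ?n) * (2 * norm (W y))"
            by (rule mult_mono[OF 2 1]) (use B t in auto)
          also have "(B / t ^ ?n) * (2 * norm (W y)) = (2 * B / t ^ ?n) * (indicator (?K t) y * norm (W y))"
            using True by simp
          finally show ?thesis by (simp only: real_norm_def abs_mult)
        qed (use \<psi>K[OF t(1)] in simp)
      qed
    qed (use B t in simp)
    also have "\<dots> = (2 * B / t ^ ?n) * (LBINT y. indicator (?K t) y * norm (W y))"
      by simp
    also have "\<dots> \<le> (2 * B / t ^ ?n) * ((2 * exp (8 / 3) * C1 + ?V) * (2 * c * t) powr (?N - \<tau>))"
      using ball_gradient[OF en \<beta> p lam cone[OF t] R[OF t] F \<sigma>s] B t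
      unfolding half C1_def \<tau>_def by (intro mult_left_mono) auto
    also have "\<dots> \<le> (2 * B / t ^ ?n) * ((2 * exp (8 / 3) * C1 + ?V) * t powr (?N - \<tau>))"
      using B t C1 V c \<tau>N by (intro mult_left_mono powr_mono2) (auto intro: mult_left_le_one_le)
    also have "\<dots> = C4 * t powr (- \<tau>)"
      using t by (simp add: C4_def powr_diff powr_realpow powr_minus_divide)
    finally show ?thesis .
  qed
  \<comment> \<open>Instead of integrating \<open>A'\<close>, the primitive of its bound is added,
    which makes a nondecreasing function; \<open>\<tau> < 1\<close> keeps this primitive bounded
    near \<open>0\<close>.\<close>
  have "A t + C4 / (1 - \<tau>) * t powr (1 - \<tau>) \<le> A T + C4 / (1 - \<tau>) * T powr (1 - \<tau>)"
  proof (rule DERIV_nonneg_imp_nondecreasing[OF t(2)])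
    fix u assume u: "t \<le> u" "u \<le> T"
    then have u0: "0 < u" using t by linarith
    have "((\<lambda>t. A t + C4 / (1 - \<tau>) * t powr (1 - \<tau>)) has_field_derivative
        A' u + C4 / (1 - \<tau>) * ((1 - \<tau>) * u powr (1 - \<tau> - 1))) (at u)"
      by (intro DERIV_add DERIV_cmult D has_real_derivative_powr u0 u)
    moreover have "A' u + C4 / (1 - \<tau>) * ((1 - \<tau>) * u powr (1 - \<tau> - 1)) = A' u + C4 * u powr (- \<tau>)"
      using \<tau> by simp
    ultimately show "\<exists>y. ((\<lambda>t. A t + C4 / (1 - \<tau>) * t powr (1 - \<tau>)) has_field_derivative y) (at u) \<and> 0 \<le> y"
      using A'_bound[OF u0 u(2)] by (intro exI[of _ "A' u + C4 * u powr (- \<tau>)"]) auto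
  qed
  moreover have "0 \<le> C4 / (1 - \<tau>) * t powr (1 - \<tau>)" using C4 \<tau> by simp
  moreover have "C4 / (1 - \<tau>) * T powr (1 - \<tau>) \<le> C4 / (1 - \<tau>) * 1"
    using C4 \<tau> T by (intro mult_left_mono powr_le1) auto
  moreover have "A T \<le> B / T ^ ?n * (exp (8 / 3) * C1 / lam * (2 * c * T) powr (?N - \<sigma>))"
  proof -
    have wi: "integrable lborel (\<lambda>y. indicator (?K T) y *\<^sub>R w y)"
      using wp sub[of T] T by (simp add: weak_pair_def)
    have "A T \<le> (LBINT y. (B / T ^ ?n) * (indicator (?K T) y * w y))"
      unfolding A_def
    proof (rule integral_mono_AE')
      show "integrable lborel (\<lambda>y. (B / T ^ ?n) * (indicator (?K T) y * w y))"
        using wi by (intro integrable_mult_right) simp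
      show "AE y in lborel. \<psi> (?\<xi> T y) / T ^ ?n * w y \<le> (B / T ^ ?n) * (indicator (?K T) y * w y)"
      proof (intro AE_I2)
        fix y
        have "\<psi> (?\<xi> T y) / T ^ ?n \<le> B / T ^ ?n"
          using \<psi>(3)[of "?\<xi> T y"] T by (intro divide_right_mono) auto
        then have "\<psi> (?\<xi> T y) / T ^ ?n * w y \<le> B / T ^ ?n * w y"
          using w0 by (rule mult_right_mono)
        then show "\<psi> (?\<xi> T y) / T ^ ?n * w y \<le> (B / T ^ ?n) * (indicator (?K T) y * w y)"
          using \<psi>K[OF T(1), of y] by (cases "y \<in> ?K T") auto
      qed
    qed (use B T w0 in simp)
    also have "\<dots> = (B / T ^ ?n) * (LBINT y. indicator (?K T) y * w y)" by simp
    also have "\<dots> \<le> B / T ^ ?n * (exp (8 / 3) * C1 / lam * (2 * c * T) powr (?N - \<sigma>))"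
      using ball_energy(2)[OF en \<beta> p lam cone[OF T(1) order_refl] R[OF T(1) order_refl] F \<sigma>s] B T
      unfolding half C1_def by (intro mult_left_mono) auto
    finally show ?thesis .
  qed
  ultimately have "A t \<le> B / T ^ ?n * (exp (8 / 3) * C1 / lam * (2 * c * T) powr (?N - \<sigma>)) + C4 / (1 - \<tau>)"
    by linarith
  then show ?thesis unfolding A_def C4_def \<tau>_def .
qed

section \<open>From bounds on averages to bounds almost everywhere\<close>

lemma AE_locally:
  fixes V :: "'a::euclidean_space set"
  assumes "\<And>x. x \<in> V \<Longrightarrow> \<exists>r>0. AE y in lborel. y \<in> ball x r \<longrightarrow> P y"
  shows "AE y in lborel. y \<in> V \<longrightarrow> P y"
proof -
  obtain r where r: "\<And>x. x \<in> V \<Longrightarrow> r x > 0" "\<And>x. x \<in> V \<Longrightarrow> AE y in lborel. y \<in> ball x (r x) \<longrightarrow> P y"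
    using assms by metis
  \<comment> \<open>Lindelof's theorem leaves countably many balls, hence a null union of
    exceptional sets.\<close>
  obtain \<F> where \<F>: "\<F> \<subseteq> (\<lambda>x. ball x (r x)) ` V" "countable \<F>" "\<Union>\<F> = \<Union>((\<lambda>x. ball x (r x)) ` V)"
    using Lindelof[of "(\<lambda>x. ball x (r x)) ` V"] by blast
  have ae: "AE y in lborel. \<forall>S\<in>\<F>. y \<in> S \<longrightarrow> P y"
    using \<F>(1,2) r(2) by (intro AE_ball_countable') auto
  have "V \<subseteq> \<Union>\<F>" unfolding \<F>(3) using r(1) by force
  from ae show ?thesis
  proof eventually_elim
    case (elim y)
    then show ?case using \<open>V \<subseteq> \<Union>\<F>\<close> by blast
  qed
qed

text \<open>On \<open>S\<close> the excess of \<open>g\<close> over \<open>M\<close> is at most the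
  distance between \<open>g\<close> and its average, whose integral tends to \<open>0\<close> with
  \<open>t\<close>. Convergence in \<open>L\<^sup>1\<close> thus takes the place of Lebesgue
  points.\<close>

lemma AE_le_of_smear_le:
  fixes g :: "'a::euclidean_space \<Rightarrow> real"
  assumes k: "mass_kernel k" and g: "integrable lborel g" and S[measurable]: "S \<in> sets borel" and d: "d > 0"
    and le: "\<And>t x. 0 < t \<Longrightarrow> t < d \<Longrightarrow> x \<in> S \<Longrightarrow> smear k t g x \<le> M"
  shows "AE x in lborel. x \<in> S \<longrightarrow> g x \<le> M"
proof -
  have [measurable]: "g \<in> borel_measurable borel" using g by auto
  \<comment> \<open>\<open>ennreal\<close> sends negative reals to \<open>0\<close>, so this is the
    integral of the positive part of \<open>g x - M\<close>.\<close>
  have "(\<integral>\<^sup>+x. indicator S x * ennreal (g x - M) \<partial>lborel) \<le> 0"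
  proof (rule ennreal_le_epsilon)
    fix e :: real assume e: "0 < e"
    obtain d' where d': "d' > 0"
      "\<And>t. t \<noteq> 0 \<Longrightarrow> \<bar>t\<bar> < d' \<Longrightarrow> (\<integral>\<^sup>+x. norm (smear k t g x - g x) \<partial>lborel) \<le> ennreal e"
      using mollify_L1[OF k g e] by blast
    define t where "t = min d d' / 2"
    have t: "0 < t" "t < d" "t < d'" using d d' by (auto simp: t_def)
    have "(\<integral>\<^sup>+x. indicator S x * ennreal (g x - M) \<partial>lborel) \<le> (\<integral>\<^sup>+x. norm (smear k t g x - g x) \<partial>lborel)"
    proof (intro nn_integral_mono)
      fix x
      show "indicator S x * ennreal (g x - M) \<le> ennreal (norm (smear k t g x - g x))"
      proof (cases "x \<in> S")
        case True
        then have "g x - M \<le> norm (smear k t g x - g x)" using le[OF t(1,2) True] by simp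
        then show ?thesis using True by (simp add: ennreal_leI)
      qed simp
    qed
    also have "\<dots> \<le> ennreal e" using d' t by simp
    finally show "(\<integral>\<^sup>+x. indicator S x * ennreal (g x - M) \<partial>lborel) \<le> 0 + ennreal e" by simp
  qed
  then have "AE x in lborel. indicator S x * ennreal (g x - M) = 0"
    by (subst (asm) le_zero_eq, subst (asm) nn_integral_0_iff_AE) auto
  then show ?thesis
  proof eventually_elim
    case (elim x)
    then show ?case by (cases "x \<in> S") (auto simp: ennreal_eq_0_iff)
  qed
qed

text \<open>With the kernel \<open>nbump e c\<close> centred on the axis, smearing at scale
  \<open>t\<close> is the average treated in \<open>average_bound\<close>. The constant is named
  before \<open>f\<close>, \<open>w\<close> and \<open>W\<close>, as the final uniformity
  requires.\<close>

lemma local_bound: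
  fixes e :: "real^'n" and V \<Omega> :: "(real^'n) set"
  assumes \<beta>: "\<beta> > 0" and p: "p > 2" and lam: "lam > 0" and F: "F \<ge> 0" and s: "s < p"
    and e: "norm e = 1" and c: "0 < c" "2 * c \<le> 1" and T: "0 < T" "T \<le> 1"
    and V: "open V" "V \<subseteq> \<Omega>"
    and cone: "\<And>x t. x \<in> V \<Longrightarrow> 0 < t \<Longrightarrow> t \<le> T \<Longrightarrow> cball (x + t *\<^sub>R e) (2 * c * t) \<subseteq> \<Omega>"
  shows "\<exists>M. \<forall>f w W. energy \<Omega> \<beta> lam p s F f w (W :: real^'n \<Rightarrow> real^'n) \<longrightarrow> (AE x in lborel. x \<in> V \<longrightarrow> w x \<le> M)"
proof -
  define \<psi> where "\<psi> = nbump e c"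
  note k = mass_kernel_nbump[OF c(1), of e, folded \<psi>_def]
  have \<psi>: "smooth_fun \<psi>" "\<And>z. z \<notin> cball e c \<Longrightarrow> \<psi> z = 0"
    using smooth_nbump nbump_eq_0[OF c(1)] by (auto simp only: \<psi>_def)
  have [measurable]: "\<psi> \<in> borel_measurable borel" using k by (simp add: mass_kernel_def)
  obtain B where B: "\<And>z. \<bar>\<psi> z\<bar> \<le> B" using k by (auto simp: mass_kernel_def)
  define M where "M = B / T ^ CARD('n) * (exp (8 / 3) * (F + unit_ball_vol (real CARD('n)) * (8 * \<beta> + (16 * \<beta>) powr (p / (p - 1))))
       / lam * (2 * c * T) powr (real CARD('n) - max s (p / (p - 1))))
      + (2 * B * (2 * exp (8 / 3) * (F + unit_ball_vol (real CARD('n)) * (8 * \<beta> + (16 * \<beta>) powr (p / (p - 1))))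
         + unit_ball_vol (real CARD('n)))) / (1 - max s (p / (p - 1)) / p)"
  have "AE x in lborel. x \<in> V \<longrightarrow> w x \<le> M" if en: "energy \<Omega> \<beta> lam p s F f w W"
    for f w and W :: "real^'n \<Rightarrow> real^'n"
  proof (rule AE_locally)
    fix x0 assume x0: "x0 \<in> V"
    note wp = energyD(1)[OF en]
    have [measurable]: "w \<in> borel_measurable borel" using wp by (simp add: weak_pair_def)
    obtain r where r: "r > 0" "cball x0 r \<subseteq> V" using V(1) x0 open_contains_cball by blast
    let ?K = "cball x0 r"
    have wi: "integrable lborel (\<lambda>x. indicator ?K x *\<^sub>R w x)" using wp r V by (simp add: weak_pair_def)
    have "AE x in lborel. x \<in> ball x0 (r / 2) \<longrightarrow> indicator ?K x *\<^sub>R w x \<le> M"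
    proof (rule AE_le_of_smear_le[OF k wi])
      \<comment> \<open>Averaging at scale \<open>t\<close> reaches at most
        \<open>t + c * t \<le> 2 * t < r / 2\<close> from \<open>x\<close>, so it never leaves
        \<open>?K\<close>.\<close>
      show "0 < min T (r / 4)" using T r by simp
      fix t x assume t: "0 < t" "t < min T (r / 4)" and x: "x \<in> ball x0 (r / 2)"
      have xV: "x \<in> V" using x r by (auto simp: subset_iff dist_norm)
      have "smear \<psi> t (\<lambda>y. indicator ?K y *\<^sub>R w y) x
        = (LBINT y. (\<psi> ((1 / t) *\<^sub>R (y - x)) / t ^ CARD('n)) * (indicator ?K y *\<^sub>R w y))"
        by (subst smear_eq_conv) (use t borel_measurable_integrable[OF wi] in auto)
      also have "\<dots> = (LBINT y. (\<psi> ((1 / t) *\<^sub>R (y - x)) / t ^ CARD('n)) * w y)"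
      proof (rule Bochner_Integration.integral_cong[OF refl])
        fix y
        show "(\<psi> ((1 / t) *\<^sub>R (y - x)) / t ^ CARD('n)) * (indicator ?K y *\<^sub>R w y)
          = (\<psi> ((1 / t) *\<^sub>R (y - x)) / t ^ CARD('n)) * w y"
        proof (cases "y \<in> cball (x + t *\<^sub>R e) (c * t)")
          case True
          have "norm (x0 - y) \<le> norm (x0 - x) + norm (x - y)" by norm
          also have "norm (x - y) \<le> norm (x + t *\<^sub>R e - y) + norm (t *\<^sub>R e)"
            using norm_triangle_ineq4[of "x + t *\<^sub>R e - y" "t *\<^sub>R e"] by (simp add: algebra_simps)
          also have "\<dots> \<le> c * t + t" using True t e by (simp add: dist_norm)
          also have "c * t \<le> 1 * t" using t c by (intro mult_right_mono) auto
          finally have "y \<in> ?K" using x t by (simp add: dist_norm)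
          then show ?thesis by simp
        next
          case False
          then have "\<psi> ((1 / t) *\<^sub>R (y - x)) = 0" using in_cball_scaled[OF t(1)] \<psi>(2) by blast
          then show ?thesis by simp
        qed
      qed
      also have "\<dots> \<le> M"
        unfolding M_def
        by (rule average_bound[OF en \<beta> p lam F s \<psi> B e c T cone[OF xV] t(1)]) (use t in auto)
      finally show "smear \<psi> t (\<lambda>y. indicator ?K y *\<^sub>R w y) x \<le> M" .
    qed auto
    then have "AE x in lborel. x \<in> ball x0 (r / 2) \<longrightarrow> w x \<le> M"
    proof eventually_elim
      case (elim x)
      show ?case
      proof
        assume "x \<in> ball x0 (r / 2)"
        moreover from this have "x \<in> ?K" using r by auto
        ultimately show "w x \<le> M" using elim by simp
      qed
    qed
    then show "\<exists>r>0. AE y in lborel. y \<in> ball x0 r \<longrightarrow> w y \<le> M" using r by (intro exI[of _ "r / 2"]) auto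
  qed
  then show ?thesis by blast
qed

section \<open>Interior cones and the global bound\<close>

lemma norm_project_le:
  fixes v e :: "'a::real_inner"
  assumes "norm e = 1" shows "norm (v - (v \<bullet> e) *\<^sub>R e) \<le> norm v"
proof (rule power2_le_imp_le)
  have "e \<bullet> e = 1" using assms by (simp add: norm_eq_1)
  then have "(norm (v - (v \<bullet> e) *\<^sub>R e))\<^sup>2 = (norm v)\<^sup>2 - (v \<bullet> e)\<^sup>2"
    unfolding power2_norm_eq_inner
    by (simp add: inner_diff_left inner_diff_right inner_commute power2_eq_square)
  then show "(norm (v - (v \<bullet> e) *\<^sub>R e))\<^sup>2 \<le> (norm v)\<^sup>2" by simp
qed simp

lemma norm_triangle_three:
  fixes x y z w :: "'a::real_normed_vector"
  shows "norm (z - y) \<le> norm (z - x) + norm (x + w - y) + norm w"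
  by norm

text \<open>All vertices in \<open>\<Omega> \<inter> U\<close> share one direction, height and
  opening. The radius \<open>2 * c * t\<close> is twice that of the averaging balls, to suit the
  interior estimates.\<close>

definition cone_nbhd :: "(real^'n) set \<Rightarrow> (real^'n) set \<Rightarrow> real^'n \<Rightarrow> real \<Rightarrow> real \<Rightarrow> bool" where
  "cone_nbhd \<Omega> U e T c \<longleftrightarrow> norm e = 1 \<and> 0 < c \<and> 2 * c \<le> 1 \<and> 0 < T \<and> T \<le> 1 \<and>
    (\<forall>x \<in> \<Omega> \<inter> U. \<forall>t. 0 < t \<and> t \<le> T \<longrightarrow> cball (x + t *\<^sub>R e) (2 * c * t) \<subseteq> \<Omega>)"

text \<open>Any direction works: with opening \<open>1 / 2\<close> a point at height
  \<open>t\<close> is within \<open>2 * t \<le> r / 2\<close> of its vertex, which itself is within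
  \<open>r / 4\<close> of \<open>z\<close>.\<close>

lemma cone_nbhd_interior:
  fixes \<Omega> :: "(real^'n) set"
  assumes "open \<Omega>" "z \<in> \<Omega>"
  shows "\<exists>U e T c. open U \<and> z \<in> U \<and> cone_nbhd \<Omega> U e T c"
proof -
  obtain r where r: "r > 0" "ball z r \<subseteq> \<Omega>" using assms open_contains_ball by blast
  have "cone_nbhd \<Omega> (ball z (r / 4)) (axis undefined 1) (min 1 (r / 4)) (1 / 2)"
    unfolding cone_nbhd_def
  proof (intro conjI ballI allI impI subsetI)
    fix x t y assume x: "x \<in> \<Omega> \<inter> ball z (r / 4)" and t: "0 < t \<and> t \<le> min 1 (r / 4)"
      and y: "y \<in> cball (x + t *\<^sub>R axis undefined 1) (2 * (1 / 2) * t)"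
    have "norm (z - y) \<le> norm (z - x) + norm (x + t *\<^sub>R axis undefined 1 - y) + norm (t *\<^sub>R axis undefined (1::real) :: real^'n)"
      by (rule norm_triangle_three)
    also have "\<dots> < r / 4 + t + t" using x y t by (simp add: dist_norm)
    finally show "y \<in> \<Omega>" using t r(2) by (auto simp: dist_norm subset_iff)
  qed (use r in auto)
  then show ?thesis using r(1) by (intro exI[of _ "ball z (r / 4)"] exI conjI) auto
qed

text \<open>Moving by \<open>t\<close> along \<open>e\<close> gains height \<open>t\<close> over the
  graph. A further displacement \<open>v\<close> costs at most \<open>norm v\<close> in height and
  \<open>L * norm v\<close> through the variation of \<open>g\<close>.\<close>

lemma cone_nbhd_boundary:
  assumes "lipschitz_boundary \<Omega>" "z \<in> frontier \<Omega>"
  shows "\<exists>U e T c. open U \<and> z \<in> U \<and> cone_nbhd \<Omega> U e T c"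
proof -
  obtain r e g L where r: "r > 0" and e: "norm e = 1" and g: "L-lipschitz_on {y. y \<bullet> e = 0} g"
    and \<Omega>: "\<And>x. x \<in> ball z r \<Longrightarrow> x \<in> \<Omega> \<longleftrightarrow> g (x - (x \<bullet> e) *\<^sub>R e) < x \<bullet> e"
    using assms unfolding lipschitz_boundary_def by blast
  have L: "L \<ge> 0" using g by (rule lipschitz_on_nonneg)
  \<comment> \<open>With this \<open>c\<close> a displacement of length \<open>2 * c * t\<close>
    costs \<open>(1 + L) * 2 * c * t = t / 2\<close>, less than the gain.\<close>
  define c where "c = 1 / (4 * (1 + L))"
  have c: "0 < c" "4 * c * (1 + L) = 1" "4 * c \<le> 1"
  proof -
    show "0 < c" "4 * c * (1 + L) = 1" using L by (simp_all add: c_def)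
    show "4 * c \<le> 1" using L by (simp add: c_def)
  qed
  have ee: "e \<bullet> e = 1" using e by (simp add: norm_eq_1)
  have "cone_nbhd \<Omega> (ball z (r / 2)) e (min 1 (r / 8)) c"
    unfolding cone_nbhd_def
  proof (intro conjI ballI allI impI subsetI)
    fix x t y assume x: "x \<in> \<Omega> \<inter> ball z (r / 2)" and t: "0 < t \<and> t \<le> min 1 (r / 8)"
      and y: "y \<in> cball (x + t *\<^sub>R e) (2 * c * t)"
    define v where "v = y - x - t *\<^sub>R e"
    have v: "norm v \<le> 2 * c * t"
    proof -
      have "norm v = norm (x + t *\<^sub>R e - y)" unfolding v_def by (subst norm_minus_commute) (simp add: algebra_simps)
      then show ?thesis using y by (simp add: dist_norm)
    qed
    have "2 * c * t \<le> 1 * t" using c t by (intro mult_right_mono) auto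
    then have v': "norm v \<le> t" using v by simp
    have y_eq: "y = x + t *\<^sub>R e + v" by (simp add: v_def)
    have "norm (z - y) \<le> norm (z - x) + norm (x + t *\<^sub>R e - y) + norm (t *\<^sub>R e)"
      by (rule norm_triangle_three)
    also have "norm (x + t *\<^sub>R e - y) = norm v" by (simp add: y_eq)
    also have "norm (z - x) + norm v + norm (t *\<^sub>R e) = norm (z - x) + norm (t *\<^sub>R e) + norm v" by simp
    also have "\<dots> < r / 2 + t + t" using x v' t e by (simp add: dist_norm)
    finally have yb: "y \<in> ball z r" using t by (simp add: dist_norm)
    have xb: "x \<in> ball z r" using x r by simp
    let ?P = "\<lambda>x. x - (x \<bullet> e) *\<^sub>R e"
    have P0: "?P x \<in> {y. y \<bullet> e = 0}" for x using ee by (simp add: inner_diff_left)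
    have Py: "?P y - ?P x = ?P v" unfolding y_eq using ee by (simp add: inner_add_left algebra_simps)
    have "dist (g (?P y)) (g (?P x)) \<le> L * dist (?P y) (?P x)"
      by (rule lipschitz_onD[OF g P0 P0])
    also have "dist (?P y) (?P x) = norm (?P v)" by (simp only: dist_norm Py)
    also have "L * norm (?P v) \<le> L * norm v" using L norm_project_le[OF e] by (intro mult_left_mono)
    finally have "g (?P y) \<le> g (?P x) + L * norm v" by (simp add: dist_real_def)
    also have "g (?P x) < x \<bullet> e" using x \<Omega>[OF xb] by simp
    finally have "g (?P y) < x \<bullet> e + L * norm v" by simp
    moreover have "y \<bullet> e \<ge> x \<bullet> e + t - norm v"
      unfolding y_eq using ee Cauchy_Schwarz_ineq2[of v e] e by (simp add: inner_add_left)
    moreover have "(1 + L) * norm v \<le> t"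
    proof -
      have "(1 + L) * norm v \<le> (1 + L) * (2 * c * t)" using L v by (intro mult_left_mono) auto
      also have "\<dots> = (4 * c * (1 + L)) * (t / 2)" by simp
      also have "\<dots> \<le> t" unfolding c(2) using t by simp
      finally show ?thesis .
    qed
    ultimately have "g (?P y) < y \<bullet> e" by (simp add: distrib_right)
    then show "y \<in> \<Omega>" using \<Omega>[OF yb] by simp
  qed (use c e r in auto)
  then show ?thesis using r(1) by (intro exI[of _ "ball z (r / 2)"] exI conjI) auto
qed

lemma cone_nbhd_exists:
  assumes "open \<Omega>" "lipschitz_boundary \<Omega>" "z \<in> closure \<Omega>"
  shows "\<exists>U e T c. open U \<and> z \<in> U \<and> cone_nbhd \<Omega> U e T c"
proof (cases "z \<in> \<Omega>")
  case False
  then have "z \<in> frontier \<Omega>" using assms by (simp add: frontier_def interior_open)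
  then show ?thesis using cone_nbhd_boundary assms by blast
qed (use cone_nbhd_interior assms in blast)

text \<open>The closure of \<open>\<Omega>\<close> is compact, so finitely many cone neighbourhoods
  suffice, boundary points included, and the largest of their constants is the bound. The cover is
  chosen from \<open>\<Omega>\<close> before any \<open>f\<close>, \<open>w\<close> and
  \<open>W\<close>.\<close>

lemma global_bound:
  fixes \<Omega> :: "(real^'n) set"
  assumes \<Omega>: "open \<Omega>" "bounded \<Omega>" "lipschitz_boundary \<Omega>"
    and \<beta>: "\<beta> > 0" and p: "p > 2" and lam: "lam > 0" and F: "F \<ge> 0" and s: "s < p"
  shows "\<exists>M. \<forall>f w W. energy \<Omega> \<beta> lam p s F f w (W :: real^'n \<Rightarrow> real^'n) \<longrightarrow> (AE x in lborel. x \<in> \<Omega> \<longrightarrow> w x \<le> M)"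
proof -
  define good where "good U \<longleftrightarrow> (\<exists>M. \<forall>f w W. energy \<Omega> \<beta> lam p s F f w (W :: real^'n \<Rightarrow> real^'n) \<longrightarrow>
    (AE x in lborel. x \<in> \<Omega> \<inter> U \<longrightarrow> w x \<le> M))" for U
  have ex: "\<exists>U. open U \<and> z \<in> U \<and> good U" if zc: "z \<in> closure \<Omega>" for z
  proof -
    obtain U e T c where U: "open U" "z \<in> U" "cone_nbhd \<Omega> U e T c"
      using cone_nbhd_exists[OF \<Omega>(1,3) zc] by blast
    have "good U" unfolding good_def
      by (rule local_bound[OF \<beta> p lam F s, of e c T]) (use U \<Omega> in \<open>auto simp: cone_nbhd_def\<close>)
    then show ?thesis using U by blast
  qed
  have "compact (closure \<Omega>)" using \<Omega> by (simp add: compact_closure)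
  moreover have "closure \<Omega> \<subseteq> \<Union>{U. open U \<and> good U}" using ex by blast
  ultimately obtain \<C> where \<C>: "\<C> \<subseteq> {U. open U \<and> good U}" "finite \<C>" "closure \<Omega> \<subseteq> \<Union>\<C>"
    by (rule compactE) auto
  have "\<forall>U\<in>\<C>. good U" using \<C>(1) by blast
  then obtain M where M: "\<And>U f w W. U \<in> \<C> \<Longrightarrow> energy \<Omega> \<beta> lam p s F f w (W :: real^'n \<Rightarrow> real^'n) \<Longrightarrow>
    AE x in lborel. x \<in> \<Omega> \<inter> U \<longrightarrow> w x \<le> M U"
    unfolding good_def by metis
  \<comment> \<open>An empty cover means an empty \<open>\<Omega>\<close>, so the unspecified value
    \<open>Max {}\<close> does no harm.\<close>
  have "AE x in lborel. x \<in> \<Omega> \<longrightarrow> w x \<le> Max (M ` \<C>)" if en: "energy \<Omega> \<beta> lam p s F f w W" for f w W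
  proof -
    have "AE x in lborel. \<forall>U\<in>\<C>. x \<in> \<Omega> \<inter> U \<longrightarrow> w x \<le> M U"
      using \<C>(2) M[OF _ en] by (intro AE_finite_allI) auto
    then show ?thesis
    proof eventually_elim
      case (elim x)
      show ?case
      proof
        assume x: "x \<in> \<Omega>"
        then obtain U where U: "U \<in> \<C>" "x \<in> U" using \<C>(3) closure_subset by blast
        then have "w x \<le> M U" using elim x by blast
        also have "\<dots> \<le> Max (M ` \<C>)" using U \<C>(2) by (intro Max_ge) auto
        finally show "w x \<le> Max (M ` \<C>)" .
      qed
    qed
  qed
  then show ?thesis by blast
qed

section \<open>Truncation of subsolutions\<close>

lemma integrable_continuous_compact_support:
  fixes f :: "'a::euclidean_space \<Rightarrow> 'b::euclidean_space"
  assumes "continuous_on UNIV f" "compact K" "\<And>x. x \<notin> K \<Longrightarrow> f x = 0"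
  shows "integrable lborel f"
proof -
  have "continuous_on K f" using assms(1) by (rule continuous_on_subset) simp
  then have "integrable lborel (\<lambda>x. indicator K x *\<^sub>R f x)" by (rule borel_integrable_compact[OF assms(2)])
  moreover have "(\<lambda>x. indicator K x *\<^sub>R f x) = f" using assms(3) by (auto simp: indicator_def)
  ultimately show ?thesis by simp
qed

text \<open>All translates of \<open>\<psi>\<close> have the same integral; differentiate in the
  shift, at \<open>0\<close>, under the integral sign. An integrable weight is required there, so
  the constant \<open>1\<close> is replaced by the indicator of a ball of radius
  \<open>R + 1\<close>, which contains the support shifted by less than \<open>1\<close>.\<close>

lemma integral_grad_eq_0:
  fixes \<psi> :: "real^'n \<Rightarrow> real"
  assumes \<psi>: "smooth_fun \<psi>" and K: "compact K" "\<And>x. x \<notin> K \<Longrightarrow> \<psi> x = 0"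
  shows "(LBINT y. grad \<psi> y \<bullet> v) = 0"
proof -
  obtain R where R: "\<And>x. x \<in> K \<Longrightarrow> norm x \<le> R" using compact_imp_bounded[OF K(1)] by (auto simp: bounded_iff)
  let ?g = "indicator (cball 0 (R + 1)) :: real^'n \<Rightarrow> real"
  have [measurable]: "\<psi> \<in> borel_measurable borel" by (rule borel_measurable_smooth[OF \<psi>])
  have g: "integrable lborel ?g" by (intro integrable_real_indicator emeasure_bounded_finite) auto
  define F where "F x = (LBINT y. \<psi> (1 *\<^sub>R (y - x)) * ?g y)" for x
  have D: "(F has_derivative (\<lambda>v. LBINT y. (- 1 * (grad \<psi> (1 *\<^sub>R (y - 0)) \<bullet> v)) * ?g y)) (at 0)"
    unfolding F_def by (rule conv_has_derivative[OF \<psi> K g])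
  have const: "F x = (LBINT z. \<psi> z)" if "x \<in> ball 0 1" for x
  proof -
    have "\<psi> (y - x) * ?g y = \<psi> (y - x)" for y
    proof (cases "y - x \<in> K")
      case True
      have "norm y \<le> norm (y - x) + norm x" using norm_triangle_sub by (metis add.commute)
      then have "norm y \<le> R + 1" using R[OF True] that by simp
      then show ?thesis by simp
    qed (simp add: K(2))
    then have eq: "(LBINT y. \<psi> (y - x) * ?g y) = (LBINT y. \<psi> (y - x))" by (simp only:)
    have "F x = (LBINT y. \<psi> (y - x))" by (simp only: F_def scaleR_one eq)
    also have "\<dots> = (LBINT z. \<psi> z)"
      using integral_affine[of "\<lambda>y. \<psi> (y - x)" 1 x] by simp
    finally show ?thesis .
  qed
  have "(F has_derivative (\<lambda>v. 0)) (at 0)"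
    by (rule has_derivative_transform_within_open[where f="\<lambda>_. LBINT z. \<psi> z" and s="ball 0 1"])
       (use const in auto)
  from has_derivative_unique[OF D this]
  have "(LBINT y. (- 1 * (grad \<psi> (1 *\<^sub>R (y - 0)) \<bullet> v)) * ?g y) = 0" by (rule fun_cong)
  moreover have "(- 1 * (grad \<psi> (1 *\<^sub>R (y - 0)) \<bullet> v)) * ?g y = - (grad \<psi> y \<bullet> v)" for y
  proof (cases "y \<in> K")
    case True then show ?thesis using R[of y] by simp
  next
    case False
    have "grad \<psi> y = 0" by (rule grad_eq_0_outside[OF compact_imp_closed[OF K(1)]]) (use K False in auto)
    then show ?thesis by simp
  qed
  ultimately have "(LBINT y. - (grad \<psi> y \<bullet> v)) = 0" by (simp only:)
  then show ?thesis by simp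
qed

text \<open>The gradient of the compactly supported product \<open>f * \<phi>\<close> has integral
  zero.\<close>

lemma integral_by_parts_smooth:
  fixes f \<phi> :: "real^'n \<Rightarrow> real"
  assumes f: "smooth_fun f" and \<phi>: "smooth_fun \<phi>" and K: "compact K" "\<And>x. x \<notin> K \<Longrightarrow> \<phi> x = 0"
  shows "(LBINT x. f x *\<^sub>R grad \<phi> x) = - (LBINT x. \<phi> x *\<^sub>R grad f x)"
proof -
  have g0: "grad \<phi> x = 0" if "x \<notin> K" for x
    by (rule grad_eq_0_outside[OF compact_imp_closed[OF K(1)]]) (use K that in auto)
  have i1: "integrable lborel (\<lambda>x. f x *\<^sub>R grad \<phi> x)"
    by (rule integrable_continuous_compact_support[OF _ K(1)])
       (use g0 in \<open>auto intro!: continuous_intros smooth_continuous continuous_on_grad f \<phi>\<close>)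
  have i2: "integrable lborel (\<lambda>x. \<phi> x *\<^sub>R grad f x)"
    by (rule integrable_continuous_compact_support[OF _ K(1)])
       (use K in \<open>auto intro!: continuous_intros smooth_continuous continuous_on_grad f \<phi>\<close>)
  have "((LBINT x. f x *\<^sub>R grad \<phi> x) + (LBINT x. \<phi> x *\<^sub>R grad f x)) \<bullet> v = 0 \<bullet> v" for v
  proof -
    have "0 = (LBINT x. grad (\<lambda>x. f x * \<phi> x) x \<bullet> v)"
      by (rule integral_grad_eq_0[symmetric, OF smooth_mult[OF f \<phi>] K(1)]) (simp add: K)
    also have "\<dots> = (LBINT x. (f x *\<^sub>R grad \<phi> x) \<bullet> v + (\<phi> x *\<^sub>R grad f x) \<bullet> v)"
      by (simp only: grad_mult[OF f \<phi>] inner_add_left)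
    also have "\<dots> = (LBINT x. (f x *\<^sub>R grad \<phi> x) \<bullet> v) + (LBINT x. (\<phi> x *\<^sub>R grad f x) \<bullet> v)"
      by (intro Bochner_Integration.integral_add integrable_inner_left i1 i2)
    also have "\<dots> = ((LBINT x. f x *\<^sub>R grad \<phi> x) + (LBINT x. \<phi> x *\<^sub>R grad f x)) \<bullet> v"
      by (simp only: integral_inner_left[OF i1] integral_inner_left[OF i2] inner_add_left)
    finally show ?thesis by simp
  qed
  then have "(LBINT x. f x *\<^sub>R grad \<phi> x) + (LBINT x. \<phi> x *\<^sub>R grad f x) = 0"
    by (subst vector_eq_rdot[symmetric]) blast
  then show ?thesis by (simp add: eq_neg_iff_add_eq_0)
qed

section \<open>Approximation of a weak pair by smooth functions\<close>

lemma ennreal_tendsto_0I: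
  assumes "\<And>e::real. e > 0 \<Longrightarrow> eventually (\<lambda>n. f n \<le> ennreal e) F"
  shows "(f \<longlongrightarrow> (0::ennreal)) F"
proof (rule order_tendstoI)
  fix a :: ennreal assume "0 < a"
  then obtain b where b: "0 < b" "b < a" using dense by blast
  then obtain r where r: "b = ennreal r" "r > 0" by (cases b) (auto simp: top.not_eq_extremum)
  from assms[OF r(2)] show "eventually (\<lambda>n. f n < a) F"
    by eventually_elim (use b r in auto)
qed simp

text \<open>Where \<open>h \<le> m\<close> the convergence in \<open>L\<^sup>1\<close> suffices.
  Where \<open>h > m\<close> Young's inequality with weight \<open>\<eta>\<close> plays the small
  tail of the square of \<open>h\<close> against the uniform \<open>L\<^sup>2\<close> bound on
  \<open>D n\<close>.\<close>

lemma weighted_tendsto_0: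
  fixes h :: "'a \<Rightarrow> real" and D :: "nat \<Rightarrow> 'a \<Rightarrow> real"
  assumes [measurable]: "h \<in> borel_measurable M" "\<And>n. D n \<in> borel_measurable M"
    and nn: "\<And>x. h x \<ge> 0" "\<And>n x. D n x \<ge> 0"
    and h2: "(\<integral>\<^sup>+x. ennreal ((h x)\<^sup>2) \<partial>M) < \<infinity>"
    and D1: "(\<lambda>n. \<integral>\<^sup>+x. ennreal (D n x) \<partial>M) \<longlonglongrightarrow> 0"
    and D2: "\<And>n. (\<integral>\<^sup>+x. ennreal ((D n x)\<^sup>2) \<partial>M) \<le> ennreal C" "C \<ge> 0"
  shows "(\<lambda>n. \<integral>\<^sup>+x. ennreal (h x * D n x) \<partial>M) \<longlonglongrightarrow> 0"
proof (rule ennreal_tendsto_0I)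
  fix e :: real assume e: "e > 0"
  \<comment> \<open>This gives \<open>\<eta> * C \<le> e / 3\<close>; the tail is later required to
    be below \<open>\<eta> * (e / 3)\<close>, so that its quotient by \<open>\<eta>\<close> is
    another third.\<close>
  define \<eta> where "\<eta> = e / (3 * (C + 1))"
  have \<eta>: "\<eta> > 0" "\<eta> * C \<le> e / 3" using e D2(2) by (auto simp: \<eta>_def field_simps)
  have "(\<lambda>m. \<integral>\<^sup>+x. indicator {x. h x > real m} x * ennreal ((h x)\<^sup>2) \<partial>M) \<longlonglongrightarrow> (\<integral>\<^sup>+x. 0 \<partial>M)"
  proof (rule nn_integral_dominated_convergence[where w="\<lambda>x. ennreal ((h x)\<^sup>2)"])
    show "AE x in M. (\<lambda>m. indicator {x. h x > real m} x * ennreal ((h x)\<^sup>2)) \<longlonglongrightarrow> 0"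
    proof (intro AE_I2 tendsto_eventually)
      fix x
      obtain m0 where "h x \<le> real m0" using real_arch_simple by blast
      then show "eventually (\<lambda>m. indicator {x. h x > real m} x * ennreal ((h x)\<^sup>2) = 0) sequentially"
        by (intro eventually_sequentiallyI[of m0]) (auto simp: indicator_def)
    qed
  qed (use h2 in \<open>auto simp: indicator_def\<close>)
  then have "eventually (\<lambda>m. (\<integral>\<^sup>+x. indicator {x. h x > real m} x * ennreal ((h x)\<^sup>2) \<partial>M) < ennreal (\<eta> * (e / 3))) sequentially"
    using \<eta>(1) e by (intro order_tendstoD) auto
  then obtain m where m: "(\<integral>\<^sup>+x. indicator {x. h x > real m} x * ennreal ((h x)\<^sup>2) \<partial>M) \<le> ennreal (\<eta> * (e / 3))"
    by (auto simp: eventually_sequentially intro: less_imp_le)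
  have pt: "h x * D n x \<le> real m * D n x + ((1 / \<eta>) * (indicator {x. h x > real m} x * (h x)\<^sup>2) + \<eta> * (D n x)\<^sup>2)" for n x
  proof (cases "h x > real m")
    case True
    have "0 \<le> (h x - \<eta> * D n x)\<^sup>2 / \<eta>" using \<eta>(1) by simp
    also have "\<dots> = (1 / \<eta>) * (h x)\<^sup>2 - 2 * (h x * D n x) + \<eta> * (D n x)\<^sup>2"
      using \<eta>(1) by (simp add: power2_eq_square field_simps)
    finally have "2 * (h x * D n x) \<le> (1 / \<eta>) * (h x)\<^sup>2 + \<eta> * (D n x)\<^sup>2" by simp
    moreover have "0 \<le> h x * D n x" "0 \<le> real m * D n x" using nn by simp_all
    ultimately show ?thesis using True by simp
  next
    case False
    have "h x * D n x \<le> real m * D n x" using False nn by (intro mult_right_mono) auto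
    then show ?thesis using \<eta>(1) False by (simp add: add_increasing2)
  qed
  have "eventually (\<lambda>n. (\<integral>\<^sup>+x. ennreal (D n x) \<partial>M) < ennreal (e / (3 * (real m + 1)))) sequentially"
    using e by (intro order_tendstoD[OF D1]) (auto simp: add_nonneg_pos)
  then show "eventually (\<lambda>n. (\<integral>\<^sup>+x. ennreal (h x * D n x) \<partial>M) \<le> ennreal e) sequentially"
  proof eventually_elim
    case (elim n)
    have "(\<integral>\<^sup>+x. ennreal (h x * D n x) \<partial>M)
      \<le> (\<integral>\<^sup>+x. ennreal (real m) * ennreal (D n x)
        + (ennreal (1 / \<eta>) * (indicator {x. h x > real m} x * ennreal ((h x)\<^sup>2)) + ennreal \<eta> * ennreal ((D n x)\<^sup>2)) \<partial>M)"
    proof (intro nn_integral_mono)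
      fix x
      have "ennreal (h x * D n x)
        \<le> ennreal (real m * D n x + ((1 / \<eta>) * (indicator {x. h x > real m} x * (h x)\<^sup>2) + \<eta> * (D n x)\<^sup>2))"
        by (intro ennreal_leI pt)
      also have "\<dots> = ennreal (real m) * ennreal (D n x)
        + (ennreal (1 / \<eta>) * (indicator {x. h x > real m} x * ennreal ((h x)\<^sup>2)) + ennreal \<eta> * ennreal ((D n x)\<^sup>2))"
        using nn \<eta>(1) by (simp add: ennreal_mult ennreal_indicator del: times_divide_eq_left)
      finally show "ennreal (h x * D n x) \<le> \<dots>" .
    qed
    also have "\<dots> = ennreal (real m) * (\<integral>\<^sup>+x. ennreal (D n x) \<partial>M)
      + (ennreal (1 / \<eta>) * (\<integral>\<^sup>+x. indicator {x. h x > real m} x * ennreal ((h x)\<^sup>2) \<partial>M)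
        + ennreal \<eta> * (\<integral>\<^sup>+x. ennreal ((D n x)\<^sup>2) \<partial>M))"
      by (subst nn_integral_add, measurable, subst nn_integral_add, measurable)
         (simp add: nn_integral_cmult)
    also have "\<dots> \<le> ennreal (real m) * ennreal (e / (3 * (real m + 1)))
      + (ennreal (1 / \<eta>) * ennreal (\<eta> * (e / 3)) + ennreal \<eta> * ennreal C)"
      using elim m D2(1) by (intro add_mono mult_left_mono) auto
    also have "\<dots> = ennreal (real m * (e / (3 * (real m + 1))) + ((1 / \<eta>) * (\<eta> * (e / 3)) + \<eta> * C))"
      using e \<eta>(1) D2(2) by (simp only: ennreal_mult[symmetric] ennreal_plus[symmetric] of_nat_0_le_iff
          divide_nonneg_nonneg mult_nonneg_nonneg add_nonneg_nonneg less_imp_le zero_le_one zero_le_numeral)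
    also have "\<dots> \<le> ennreal e"
    proof (intro ennreal_leI)
      have "real m * (e / (3 * (real m + 1))) \<le> e / 3" using e by (simp add: field_simps)
      moreover have "(1 / \<eta>) * (\<eta> * (e / 3)) = e / 3" using \<eta>(1) by simp
      ultimately have "real m * (e / (3 * (real m + 1))) + ((1 / \<eta>) * (\<eta> * (e / 3)) + \<eta> * C) \<le> e / 3 + (e / 3 + e / 3)"
        using \<eta>(2) by (intro add_mono) auto
      then show "real m * (e / (3 * (real m + 1))) + ((1 / \<eta>) * (\<eta> * (e / 3)) + \<eta> * C) \<le> e"
        by simp
    qed
    finally show ?case .
  qed
qed

lemma norm_diff_square_le:
  "(norm (a - b))\<^sup>2 \<le> 2 * (norm a)\<^sup>2 + 2 * (norm (b :: 'a :: real_inner))\<^sup>2"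
proof -
  have "0 \<le> (norm (a + b))\<^sup>2" by simp
  then show ?thesis unfolding power2_norm_eq_inner by (simp add: inner_simps inner_commute)
qed

text \<open>The weight \<open>1 + norm (G x)\<close> is the growth of the flux, which will multiply
  the error of the gradient. Mollified gradients converge in \<open>L\<^sup>1\<close> and are
  bounded in \<open>L\<^sup>2\<close>, and this is enough against a square integrable
  weight.\<close>

lemma mollified_sequence:
  fixes u :: "real^'n \<Rightarrow> real"
  assumes wp: "weak_pair \<Omega> u G" and \<Omega>: "open \<Omega>" and K: "compact K" "K \<subseteq> \<Omega>"
    and G2: "\<And>K. compact K \<Longrightarrow> K \<subseteq> \<Omega> \<Longrightarrow> integrable lborel (\<lambda>x. indicator K x * (norm (G x))\<^sup>2)"
  shows "\<exists>v. (\<forall>n. smooth_fun (v n)) \<and> (AE x in lborel. x \<in> K \<longrightarrow> (\<lambda>n. v n x) \<longlonglongrightarrow> u x) \<and>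
    ((\<lambda>n. \<integral>\<^sup>+x. ennreal (indicator K x * \<bar>v n x - u x\<bar>) \<partial>lborel) \<longlonglongrightarrow> 0) \<and>
    ((\<lambda>n. \<integral>\<^sup>+x. ennreal (indicator K x * ((1 + norm (G x)) * norm (grad (v n) x - G x))) \<partial>lborel) \<longlonglongrightarrow> 0)"
proof -
  obtain d0 where d0: "d0 > 0" "(\<Union>x\<in>K. cball x d0) \<subseteq> \<Omega>"
    using compact_subset_open_imp_cball_epsilon_subset[OF K(1) \<Omega> K(2)] by metis
  \<comment> \<open>The gradient of a mollification at a point of \<open>K\<close> is the mollified
    gradient only if the mollifier stays inside the set to which \<open>u\<close> is cut off; hence
    the thickening.\<close>
  define K' where "K' = (\<Union>x\<in>K. cball x d0)"
  have K': "compact K'" "K' \<subseteq> \<Omega>" "K \<subseteq> K'"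
    using d0 K(1) by (auto simp: K'_def intro!: compact_minkowski_sum_cball)
  have sets[measurable]: "K \<in> sets borel" "K' \<in> sets borel" using K K' by (auto intro: borel_closed compact_imp_closed)
  have [measurable]: "u \<in> borel_measurable borel" "G \<in> borel_measurable borel"
    using wp by (auto simp: weak_pair_def)
  define ut where "ut x = indicator K' x *\<^sub>R u x" for x
  define Gt where "Gt x = indicator K' x *\<^sub>R G x" for x
  have ut: "integrable lborel ut" and Gt: "integrable lborel Gt"
    using wp K' unfolding weak_pair_def ut_def[abs_def] Gt_def[abs_def] by blast+
  have [measurable]: "ut \<in> borel_measurable borel" "Gt \<in> borel_measurable borel" using ut Gt by auto
  let ?\<rho> = "nbump 0 1 :: real^'n \<Rightarrow> real"
  have \<rho>: "mass_kernel ?\<rho>" by (rule mass_kernel_nbump) simp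
  have [measurable]: "?\<rho> \<in> borel_measurable borel" using \<rho> by (simp add: mass_kernel_def)
  define P where "P n t \<longleftrightarrow> 0 < t \<and> t \<le> d0 \<and>
    (\<integral>\<^sup>+x. norm (smear ?\<rho> t ut x - ut x) \<partial>lborel) \<le> ennreal (1 / real (Suc n)) \<and>
    (\<integral>\<^sup>+x. norm (smear ?\<rho> t Gt x - Gt x) \<partial>lborel) \<le> ennreal (1 / real (Suc n))" for n t
  have "\<forall>n. \<exists>t. P n t"
  proof
    fix n
    have e: "1 / real (Suc n) > 0" by simp
    obtain d1 where d1: "d1 > 0" "\<And>t. t \<noteq> 0 \<Longrightarrow> \<bar>t\<bar> < d1 \<Longrightarrow>
        (\<integral>\<^sup>+x. norm (smear ?\<rho> t ut x - ut x) \<partial>lborel) \<le> ennreal (1 / real (Suc n))"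
      using mollify_L1[OF \<rho> ut e] by blast
    obtain d2 where d2: "d2 > 0" "\<And>t. t \<noteq> 0 \<Longrightarrow> \<bar>t\<bar> < d2 \<Longrightarrow>
        (\<integral>\<^sup>+x. norm (smear ?\<rho> t Gt x - Gt x) \<partial>lborel) \<le> ennreal (1 / real (Suc n))"
      using mollify_L1[OF \<rho> Gt e] by blast
    define t where "t = min d0 (min d1 d2) / 2"
    have "0 < t" "t \<le> d0" "t < d1" "t < d2" using d0 d1 d2 by (auto simp: t_def)
    then show "\<exists>t. P n t" unfolding P_def using d1(2)[of t] d2(2)[of t] by (intro exI[of _ t]) auto
  qed
  then obtain t where "\<forall>n. P n (t n)" by (rule choice[THEN exE])
  then have t: "0 < t n" "t n \<le> d0"
    "(\<integral>\<^sup>+x. norm (smear ?\<rho> (t n) ut x - ut x) \<partial>lborel) \<le> ennreal (1 / real (Suc n))"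
    "(\<integral>\<^sup>+x. norm (smear ?\<rho> (t n) Gt x - Gt x) \<partial>lborel) \<le> ennreal (1 / real (Suc n))" for n
    unfolding P_def by blast+
  define v0 where "v0 n = smear ?\<rho> (t n) ut" for n
  define g0 where "g0 n = smear ?\<rho> (t n) Gt" for n
  have [measurable]: "v0 n \<in> borel_measurable borel" "g0 n \<in> borel_measurable borel" for n
    unfolding v0_def g0_def by (auto intro: smear_measurable)
  have lim0: "(\<lambda>n. ennreal (1 / real (Suc n))) \<longlonglongrightarrow> 0"
    using tendsto_ennrealI[OF lim_1_over_n[THEN LIMSEQ_Suc]] by simp
  have i0: "integrable lborel (\<lambda>x. v0 n x - ut x)" for n
  proof (rule integrableI_bounded)
    show "(\<integral>\<^sup>+x. ennreal (norm (v0 n x - ut x)) \<partial>lborel) < \<infinity>"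
      using t(3)[of n] unfolding v0_def by (rule le_less_trans) simp
  qed measurable
  have "(\<lambda>n. LBINT x. norm (v0 n x - ut x)) \<longlonglongrightarrow> 0"
  proof (rule tendsto_sandwich[OF _ _ tendsto_const])
    show "eventually (\<lambda>n. (LBINT x. norm (v0 n x - ut x)) \<le> 1 / real (Suc n)) sequentially"
    proof (intro always_eventually allI)
      fix n
      have "ennreal (LBINT x. norm (v0 n x - ut x)) = (\<integral>\<^sup>+x. norm (v0 n x - ut x) \<partial>lborel)"
        by (rule nn_integral_eq_integral[symmetric]) (use integrable_norm[OF i0] in auto)
      also have "\<dots> \<le> ennreal (1 / real (Suc n))" using t(3)[of n] by (simp add: v0_def)
      finally show "(LBINT x. norm (v0 n x - ut x)) \<le> 1 / real (Suc n)" by (subst (asm) ennreal_le_iff) auto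
    qed
    show "(\<lambda>n. 1 / real (Suc n)) \<longlonglongrightarrow> 0" by (rule lim_1_over_n[THEN LIMSEQ_Suc])
  qed auto
  \<comment> \<open>Pointwise convergence is available only along a subsequence; the integral
    estimates are inherited by it.\<close>
  then obtain r :: "nat \<Rightarrow> nat" where r: "strict_mono r" "AE x in lborel. (\<lambda>n. v0 (r n) x - ut x) \<longlonglongrightarrow> 0"
    using tendsto_L1_AE_subseq[of lborel "\<lambda>n x. v0 n x - ut x", OF i0] by blast
  have lim1: "(\<lambda>n. ennreal (1 / real (Suc (r n)))) \<longlonglongrightarrow> 0"
    using LIMSEQ_subseq_LIMSEQ[OF lim0 r(1)] by (simp add: comp_def)
  have smooth: "smooth_fun (v0 n)" for n
    unfolding v0_def ut_def[abs_def] by (rule smooth_mollified[OF wp K'(1,2) t(1)])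
  have gr: "grad (v0 n) x = g0 n x" if "x \<in> K" for n x
    unfolding v0_def g0_def ut_def[abs_def] Gt_def[abs_def]
  proof (rule grad_mollified[OF wp K'(1,2) t(1)])
    show "cball x (t n) \<subseteq> K'" using that t(2)[of n] by (force simp: K'_def)
  qed
  have onK: "ut x = u x" "Gt x = G x" if "x \<in> K" for x using that K'(3) by (auto simp: ut_def Gt_def)
  \<comment> \<open>Both terms of \<open>norm_diff_square_le\<close> carry a factor
    \<open>2\<close>, and by \<open>smear_square_le\<close> each integral is at most that of the
    square of \<open>Gt\<close>.\<close>
  define C where "C = 4 * (LBINT x. indicator K' x * (norm (G x))\<^sup>2)"
  have C0: "C \<ge> 0" by (simp add: C_def)
  have Gt2: "(\<integral>\<^sup>+x. (ennreal (norm (Gt x)))\<^sup>2 \<partial>lborel) = ennreal (C / 4)"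
  proof -
    have "(\<integral>\<^sup>+x. (ennreal (norm (Gt x)))\<^sup>2 \<partial>lborel) = (\<integral>\<^sup>+x. ennreal (indicator K' x * (norm (G x))\<^sup>2) \<partial>lborel)"
      by (intro nn_integral_cong) (auto simp: Gt_def indicator_def ennreal_power)
    also have "\<dots> = ennreal (C / 4)"
      using G2[OF K'(1,2)] by (subst nn_integral_eq_integral) (auto simp: C_def)
    finally show ?thesis .
  qed
  define D where "D n x = norm (g0 n x - Gt x)" for n x
  have [measurable]: "D n \<in> borel_measurable borel" for n unfolding D_def[abs_def] by measurable
  have D2: "(\<integral>\<^sup>+x. ennreal ((D n x)\<^sup>2) \<partial>lborel) \<le> ennreal C" for n
  proof -
    have "(\<integral>\<^sup>+x. ennreal ((D n x)\<^sup>2) \<partial>lborel)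
      \<le> (\<integral>\<^sup>+x. ennreal 2 * (ennreal (norm (g0 n x)))\<^sup>2 + ennreal 2 * (ennreal (norm (Gt x)))\<^sup>2 \<partial>lborel)"
    proof (intro nn_integral_mono)
      fix x
      have "ennreal ((D n x)\<^sup>2) \<le> ennreal (2 * (norm (g0 n x))\<^sup>2 + 2 * (norm (Gt x))\<^sup>2)"
        unfolding D_def by (intro ennreal_leI norm_diff_square_le)
      then show "ennreal ((D n x)\<^sup>2) \<le> ennreal 2 * (ennreal (norm (g0 n x)))\<^sup>2 + ennreal 2 * (ennreal (norm (Gt x)))\<^sup>2"
        by (simp add: ennreal_mult' ennreal_power)
    qed
    also have "\<dots> = ennreal 2 * (\<integral>\<^sup>+x. (ennreal (norm (g0 n x)))\<^sup>2 \<partial>lborel) + ennreal 2 * (\<integral>\<^sup>+x. (ennreal (norm (Gt x)))\<^sup>2 \<partial>lborel)"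
      by (subst nn_integral_add, measurable) (subst nn_integral_cmult, measurable)+
    also have "\<dots> \<le> ennreal 2 * ennreal (C / 4) + ennreal 2 * ennreal (C / 4)"
      using smear_square_le[OF \<rho>, of Gt "t n"] unfolding g0_def Gt2 by (intro add_mono mult_left_mono) auto
    also have "\<dots> = ennreal C"
    proof -
      have "ennreal 2 * ennreal (C / 4) = ennreal (C / 2)" using C0 by (subst ennreal_mult[symmetric]) auto
      then show ?thesis using C0 by (simp only: ennreal_plus[symmetric] divide_nonneg_nonneg) simp
    qed
    finally show ?thesis .
  qed
  define h where "h x = indicator K x * (1 + norm (G x))" for x
  have [measurable]: "h \<in> borel_measurable borel" unfolding h_def[abs_def] by measurable
  have h2: "(\<integral>\<^sup>+x. ennreal ((h x)\<^sup>2) \<partial>lborel) < \<infinity>"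
  proof -
    have iK: "integrable lborel (\<lambda>x. indicator K x * (2::real))"
      using K(1) by (intro integrable_mult_left integrable_real_indicator emeasure_bounded_finite)
        (auto intro: compact_imp_bounded)
    have i: "integrable lborel (\<lambda>x. indicator K x * 2 + 2 * (indicator K x * (norm (G x))\<^sup>2))"
      using iK G2[OF K] by (intro Bochner_Integration.integrable_add integrable_mult_right)
    have "(\<integral>\<^sup>+x. ennreal ((h x)\<^sup>2) \<partial>lborel) \<le> (\<integral>\<^sup>+x. ennreal (norm (indicator K x * 2 + 2 * (indicator K x * (norm (G x))\<^sup>2))) \<partial>lborel)"
    proof (intro nn_integral_mono ennreal_leI)
      fix x
      have "(1 + norm (G x))\<^sup>2 \<le> 2 + 2 * (norm (G x))\<^sup>2"
        using zero_le_power2[of "1 - norm (G x)"] by (simp add: power2_eq_square algebra_simps)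
      then show "(h x)\<^sup>2 \<le> norm (indicator K x * 2 + 2 * (indicator K x * (norm (G x))\<^sup>2))"
        by (auto simp: h_def indicator_def)
    qed
    also have "\<dots> < \<infinity>" using i by (simp add: integrable_iff_bounded)
    finally show ?thesis .
  qed
  have wt: "(\<lambda>n. \<integral>\<^sup>+x. ennreal (h x * D (r n) x) \<partial>lborel) \<longlonglongrightarrow> 0"
  proof (rule weighted_tendsto_0[where C=C])
    show "(\<lambda>n. \<integral>\<^sup>+x. ennreal (D (r n) x) \<partial>lborel) \<longlonglongrightarrow> 0"
      by (rule tendsto_sandwich[OF _ _ tendsto_const lim1])
         (use t(4) in \<open>auto simp: D_def g0_def intro!: always_eventually\<close>)
  qed (use h2 D2 C0 in \<open>auto simp: h_def D_def\<close>)
  show ?thesis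
  proof (intro exI[of _ "\<lambda>n. v0 (r n)"] conjI allI)
    show "AE x in lborel. x \<in> K \<longrightarrow> (\<lambda>n. v0 (r n) x) \<longlonglongrightarrow> u x"
      using r(2)
    proof eventually_elim
      case (elim x)
      show ?case using onK(1) LIM_zero_cancel[OF elim] by auto
    qed
    show "(\<lambda>n. \<integral>\<^sup>+x. ennreal (indicator K x * \<bar>v0 (r n) x - u x\<bar>) \<partial>lborel) \<longlonglongrightarrow> 0"
    proof (rule tendsto_sandwich[OF _ _ tendsto_const lim1])
      show "eventually (\<lambda>n. (\<integral>\<^sup>+x. ennreal (indicator K x * \<bar>v0 (r n) x - u x\<bar>) \<partial>lborel)
          \<le> ennreal (1 / real (Suc (r n)))) sequentially"
      proof (intro always_eventually allI)
        fix n
        have "(\<integral>\<^sup>+x. ennreal (indicator K x * \<bar>v0 (r n) x - u x\<bar>) \<partial>lborel)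
          \<le> (\<integral>\<^sup>+x. norm (v0 (r n) x - ut x) \<partial>lborel)"
          using onK(1) by (intro nn_integral_mono ennreal_leI) (auto simp: indicator_def)
        also have "\<dots> \<le> ennreal (1 / real (Suc (r n)))" using t(3) by (simp add: v0_def)
        finally show "(\<integral>\<^sup>+x. ennreal (indicator K x * \<bar>v0 (r n) x - u x\<bar>) \<partial>lborel)
          \<le> ennreal (1 / real (Suc (r n)))" .
      qed
    qed auto
    have "indicator K x * ((1 + norm (G x)) * norm (grad (v0 (r n)) x - G x)) = h x * D (r n) x" for n x
      using onK(2) gr by (cases "x \<in> K") (auto simp: h_def D_def)
    then show "(\<lambda>n. \<integral>\<^sup>+x. ennreal (indicator K x * ((1 + norm (G x)) * norm (grad (v0 (r n)) x - G x))) \<partial>lborel) \<longlonglongrightarrow> 0"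
      using wt by (simp only:)
  qed (rule smooth)
qed

text \<open>A smooth nondecreasing substitute for the positive part: its derivative \<open>soft_step\<close> takes values
  in \<open>[0,1]\<close>, and \<open>s - 1 \<le> soft_pos s \<le> s * soft_step s\<close>, so no limit in a regularisation
  parameter is needed.\<close>

definition soft_pos :: "real \<Rightarrow> real" where "soft_pos s = s * flat_exp 0 s"
definition soft_step :: "real \<Rightarrow> real" where "soft_step s = flat_exp 0 s + flat_exp 1 s"

lemma soft_pos_has_derivative: "(soft_pos has_field_derivative soft_step s) (at s)"
proof -
  have "((\<lambda>s. s * flat_exp 0 s) has_field_derivative (1 * flat_exp 0 s + flat_exp 2 s * s)) (at s)"
    by (rule DERIV_mult[OF DERIV_ident flat_exp_0_has_derivative])
  moreover have "1 * flat_exp 0 s + flat_exp 2 s * s = soft_step s"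
    using flat_exp_Suc_mult[of s 1] by (simp add: soft_step_def numeral_2_eq_2 mult.commute)
  ultimately show ?thesis by (simp add: soft_pos_def[abs_def])
qed

text \<open>A nonnegative second derivative makes \<open>soft_pos\<close> convex; this is the sign
  that has to meet the sign condition on the flux. Its bound \<open>fact 3\<close> is the
  \<open>6\<close> in the energy estimate of the truncation.\<close>

lemma soft_step_has_derivative: "(soft_step has_field_derivative flat_exp 3 s) (at s)"
proof -
  have "((\<lambda>s. flat_exp 0 s + flat_exp 1 s) has_field_derivative
     (flat_exp 2 s + (flat_exp (1 + 2) s - of_nat 1 * flat_exp (Suc 1) s))) (at s)"
    by (intro DERIV_add flat_exp_0_has_derivative flat_exp_has_derivative)
  then show ?thesis by (simp add: soft_step_def[abs_def] numeral_2_eq_2 numeral_3_eq_3)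
qed

lemma soft_step_nonneg: "0 \<le> soft_step s"
  by (simp add: soft_step_def flat_exp_nonneg)

lemma soft_step_le_1: "soft_step s \<le> 1"
proof (cases "s > 0")
  case True
  have "(1 + 1 / s) * exp (- (1 / s)) \<le> exp (1 / s) * exp (- (1 / s))"
    by (intro mult_right_mono exp_ge_add_one_self) auto
  also have "\<dots> = 1" by (simp flip: exp_add)
  finally show ?thesis using True by (simp add: soft_step_def flat_exp_def algebra_simps)
qed (simp add: soft_step_def flat_exp_def)

lemma soft_pos_nonneg: "0 \<le> soft_pos s"
  by (simp add: soft_pos_def flat_exp_def)

lemma soft_pos_le: "soft_pos s \<le> s * soft_step s"
  by (auto simp: soft_pos_def soft_step_def flat_exp_def)

text \<open>The lost \<open>1\<close> reappears as the summand \<open>1\<close> in the final bound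
  \<open>1 + M\<close>.\<close>

lemma soft_pos_ge: "s - 1 \<le> soft_pos s"
proof (cases "s > 0")
  case True
  have "s - 1 = s * (1 + - (1 / s))" using True by (simp add: field_simps)
  also have "\<dots> \<le> s * exp (- (1 / s))" using True by (intro mult_left_mono exp_ge_add_one_self) auto
  finally show ?thesis using True by (simp add: soft_pos_def flat_exp_def)
qed (simp add: soft_pos_def flat_exp_def)

lemma soft_pos_lipschitz: "\<bar>soft_pos a - soft_pos b\<bar> \<le> \<bar>a - b\<bar>"
proof -
  have "norm (soft_pos a - soft_pos b) \<le> 1 * norm (a - b)"
    by (rule field_differentiable_bound[where S=UNIV and f'=soft_step])
      (use soft_pos_has_derivative soft_step_nonneg soft_step_le_1 in \<open>auto intro: has_field_derivative_at_within\<close>)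
  then show ?thesis by simp
qed

lemma abs_soft_pos_le: "\<bar>soft_pos a\<bar> \<le> \<bar>a\<bar>"
  using soft_pos_lipschitz[of a 0] by (simp add: soft_pos_def)

lemma continuous_soft_pos: "continuous_on UNIV soft_pos" and continuous_soft_step: "continuous_on UNIV soft_step"
  using soft_pos_has_derivative soft_step_has_derivative
  by (auto intro!: continuous_at_imp_continuous_on DERIV_isCont)

lemma soft_step_tendsto: "(X \<longlongrightarrow> l) F \<Longrightarrow> ((\<lambda>n. soft_step (X n)) \<longlongrightarrow> soft_step l) F"
  by (rule isCont_tendsto_compose[OF DERIV_isCont[OF soft_step_has_derivative]])

lemma borel_soft[measurable]: "soft_pos \<in> borel_measurable borel" "soft_step \<in> borel_measurable borel"
  by (intro borel_measurable_continuous_onI continuous_soft_pos continuous_soft_step)+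

lemma smooth_soft_pos: "smooth_fun v \<Longrightarrow> smooth_fun (\<lambda>x. soft_pos (v x))"
  unfolding soft_pos_def by (intro smooth_mult smooth_flat_exp)

lemma smooth_soft_step: "smooth_fun v \<Longrightarrow> smooth_fun (\<lambda>x. soft_step (v x))"
  unfolding soft_step_def by (intro smooth_add smooth_flat_exp)

lemma grad_compose:
  assumes v: "smooth_fun v" and h: "\<And>s. (h has_field_derivative h' s) (at s)"
  shows "grad (\<lambda>x. h (v x)) x = h' (v x) *\<^sub>R grad v x"
proof (rule grad_eqI)
  show "((\<lambda>x. h (v x)) has_derivative (\<lambda>w. (h' (v x) *\<^sub>R grad v x) \<bullet> w)) (at x)"
    using has_derivative_compose[OF smooth_has_derivative[OF v] h[unfolded has_field_derivative_def]]
    by simp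
qed

lemma integrable_le:
  fixes f :: "'a \<Rightarrow> 'b::{banach, second_countable_topology}" and g :: "'a \<Rightarrow> real"
  assumes "integrable M g" "f \<in> borel_measurable M" "\<And>x. norm (f x) \<le> g x"
  shows "integrable M f"
  by (rule Bochner_Integration.integrable_bound[OF assms(1,2)])
    (use assms(3) order_trans[OF _ abs_ge_self] in auto)

lemma nn_integral_tendsto_0_mono:
  assumes "(\<lambda>n. \<integral>\<^sup>+x. ennreal (g n x) \<partial>M) \<longlonglongrightarrow> 0" "\<And>n. g n \<in> borel_measurable M" "B \<ge> 0"
    "\<And>n x. f n x \<le> B * g n x" "\<And>n x. g n x \<ge> 0"
  shows "(\<lambda>n. \<integral>\<^sup>+x. ennreal (f n x) \<partial>M) \<longlonglongrightarrow> 0"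
proof (rule tendsto_sandwich[OF _ _ tendsto_const])
  have "(\<lambda>n. ennreal B * (\<integral>\<^sup>+x. ennreal (g n x) \<partial>M)) \<longlonglongrightarrow> ennreal B * 0"
    by (rule ennreal_tendsto_cmult[OF _ assms(1)]) simp
  then show "(\<lambda>n. ennreal B * (\<integral>\<^sup>+x. ennreal (g n x) \<partial>M)) \<longlonglongrightarrow> 0" by simp
  show "eventually (\<lambda>n. (\<integral>\<^sup>+x. ennreal (f n x) \<partial>M) \<le> ennreal B * (\<integral>\<^sup>+x. ennreal (g n x) \<partial>M)) sequentially"
  proof (intro always_eventually allI)
    fix n
    have "(\<integral>\<^sup>+x. ennreal (f n x) \<partial>M) \<le> (\<integral>\<^sup>+x. ennreal B * ennreal (g n x) \<partial>M)"
      using assms(3,4,5) by (intro nn_integral_mono) (simp add: ennreal_leI flip: ennreal_mult)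
    also have "\<dots> = ennreal B * (\<integral>\<^sup>+x. ennreal (g n x) \<partial>M)"
      using assms(2)[of n] by (intro nn_integral_cmult) measurable
    finally show "(\<integral>\<^sup>+x. ennreal (f n x) \<partial>M) \<le> ennreal B * (\<integral>\<^sup>+x. ennreal (g n x) \<partial>M)" .
  qed
qed auto

text \<open>For mollifications this is the classical chain rule and integration by parts. In the
  limit the left side uses that \<open>soft_pos\<close> is 1-Lipschitz. On the right the difference
  of the gradients splits into the error of the gradient, small by construction, and the error of
  the step times \<open>G\<close>, handled by dominated convergence.\<close>

lemma soft_pos_weak_pair:
  fixes u :: "real^'n \<Rightarrow> real"
  assumes wp: "weak_pair \<Omega> u G" and \<Omega>: "open \<Omega>"
    and G2: "\<And>K. compact K \<Longrightarrow> K \<subseteq> \<Omega> \<Longrightarrow> integrable lborel (\<lambda>x. indicator K x * (norm (G x))\<^sup>2)"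
  shows "weak_pair \<Omega> (\<lambda>x. soft_pos (u x)) (\<lambda>x. soft_step (u x) *\<^sub>R G x)"
proof -
  have [measurable]: "u \<in> borel_measurable borel" "G \<in> borel_measurable borel"
    using wp by (auto simp: weak_pair_def)
  have loc: "integrable lborel (\<lambda>x. indicator K x *\<^sub>R u x)" "integrable lborel (\<lambda>x. indicator K x *\<^sub>R G x)"
    "K \<in> sets borel" if "compact K" "K \<subseteq> \<Omega>" for K
    using wp that by (auto simp: weak_pair_def compact_imp_closed)
  have loc': "integrable lborel (\<lambda>x. indicator K x *\<^sub>R soft_pos (u x))"
    "integrable lborel (\<lambda>x. indicator K x *\<^sub>R (soft_step (u x) *\<^sub>R G x))" if K: "compact K" "K \<subseteq> \<Omega>" for K
  proof -
    note [measurable] = loc(3)[OF K]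
    show "integrable lborel (\<lambda>x. indicator K x *\<^sub>R soft_pos (u x))"
      by (rule integrable_le[OF integrable_norm[OF loc(1)[OF K]]])
        (auto simp: indicator_def abs_soft_pos_le)
    show "integrable lborel (\<lambda>x. indicator K x *\<^sub>R (soft_step (u x) *\<^sub>R G x))"
      by (rule integrable_le[OF integrable_norm[OF loc(2)[OF K]]])
        (auto simp: indicator_def soft_step_nonneg soft_step_le_1 intro: mult_left_le_one_le)
  qed
  have "(LBINT x. soft_pos (u x) *\<^sub>R grad \<phi> x) = - (LBINT x. \<phi> x *\<^sub>R (soft_step (u x) *\<^sub>R G x))"
    if \<phi>: "\<phi> \<in> test_functions \<Omega>" for \<phi>
  proof -
    from test_function_bounds[OF \<phi>] obtain K B where KB: "compact K" "K \<subseteq> \<Omega>"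
        "\<forall>x. x \<notin> K \<longrightarrow> \<phi> x = 0" "\<forall>x. x \<notin> K \<longrightarrow> grad \<phi> x = 0"
        "\<forall>x. \<bar>\<phi> x\<bar> \<le> B" "\<forall>x. norm (grad \<phi> x) \<le> B"
      and sm: "smooth_fun \<phi>" and [measurable]: "\<phi> \<in> borel_measurable borel" "grad \<phi> \<in> borel_measurable borel"
      by (elim exE conjE) (rule that)
    have K: "compact K" "K \<subseteq> \<Omega>" "\<And>x. x \<notin> K \<Longrightarrow> \<phi> x = 0" "\<And>x. x \<notin> K \<Longrightarrow> grad \<phi> x = 0"
      and B: "\<And>x. \<bar>\<phi> x\<bar> \<le> B" "\<And>x. norm (grad \<phi> x) \<le> B"
      using KB by blast+
    note Km[measurable] = loc(3)[OF K(1,2)]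
    have B0: "B \<ge> 0" using B(1)[of 0] by linarith
    obtain v where v: "\<And>n. smooth_fun (v n)" "AE x in lborel. x \<in> K \<longrightarrow> (\<lambda>n. v n x) \<longlonglongrightarrow> u x"
      "(\<lambda>n. \<integral>\<^sup>+x. ennreal (indicator K x * \<bar>v n x - u x\<bar>) \<partial>lborel) \<longlonglongrightarrow> 0"
      "(\<lambda>n. \<integral>\<^sup>+x. ennreal (indicator K x * ((1 + norm (G x)) * norm (grad (v n) x - G x))) \<partial>lborel) \<longlonglongrightarrow> 0"
      using mollified_sequence[OF wp \<Omega> K(1,2) G2] by blast
    have [measurable]: "v n \<in> borel_measurable borel" "grad (v n) \<in> borel_measurable borel" for n
      using v(1) by (auto intro: borel_measurable_smooth borel_measurable_grad)
    have gv: "grad (\<lambda>x. soft_pos (v n x)) x = soft_step (v n x) *\<^sub>R grad (v n) x" for n x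
      by (rule grad_compose[OF v(1) soft_pos_has_derivative])
    have parts: "(LBINT x. soft_pos (v n x) *\<^sub>R grad \<phi> x)
        = - (LBINT x. \<phi> x *\<^sub>R (soft_step (v n x) *\<^sub>R grad (v n) x))" for n
    proof -
      have "(LBINT x. soft_pos (v n x) *\<^sub>R grad \<phi> x) = - (LBINT x. \<phi> x *\<^sub>R grad (\<lambda>x. soft_pos (v n x)) x)"
        by (rule integral_by_parts_smooth[OF smooth_soft_pos[OF v(1)] sm K(1)]) (rule K(3))
      then show ?thesis by (simp only: gv)
    qed
    have lim1: "(\<lambda>n. LBINT x. soft_pos (v n x) *\<^sub>R grad \<phi> x) \<longlonglongrightarrow> (LBINT x. soft_pos (u x) *\<^sub>R grad \<phi> x)"
    proof (rule tendsto_L1_int)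
      show "integrable lborel (\<lambda>x. soft_pos (v n x) *\<^sub>R grad \<phi> x)" for n
        by (rule integrable_continuous_compact_support[OF _ K(1)])
          (use K in \<open>auto intro!: continuous_intros smooth_continuous smooth_soft_pos continuous_on_grad v sm\<close>)
      show "integrable lborel (\<lambda>x. soft_pos (u x) *\<^sub>R grad \<phi> x)"
        by (rule integrable_bounded_mult2[OF loc'(1)[OF K(1,2)] _ _ K(4) B(2)]) measurable
      show "(\<lambda>n. \<integral>\<^sup>+x. ennreal (norm (soft_pos (v n x) *\<^sub>R grad \<phi> x - soft_pos (u x) *\<^sub>R grad \<phi> x)) \<partial>lborel) \<longlonglongrightarrow> 0"
      proof (rule nn_integral_tendsto_0_mono[OF v(3) _ B0])
        fix n x
        show "norm (soft_pos (v n x) *\<^sub>R grad \<phi> x - soft_pos (u x) *\<^sub>R grad \<phi> x) \<le> B * (indicator K x * \<bar>v n x - u x\<bar>)"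
        proof (cases "x \<in> K")
          case True
          have "\<bar>soft_pos (v n x) - soft_pos (u x)\<bar> * norm (grad \<phi> x) \<le> \<bar>v n x - u x\<bar> * B"
            by (intro mult_mono soft_pos_lipschitz B) auto
          then show ?thesis using True by (simp add: mult.commute flip: scaleR_diff_left)
        qed (simp add: K(4))
      qed auto
    qed
    have small: "(\<lambda>n. \<integral>\<^sup>+x. ennreal (indicator K x * (norm (grad (v n) x - G x) + \<bar>soft_step (v n x) - soft_step (u x)\<bar> * norm (G x))) \<partial>lborel) \<longlonglongrightarrow> 0"
    proof -
      have a: "(\<lambda>n. \<integral>\<^sup>+x. ennreal (indicator K x * norm (grad (v n) x - G x)) \<partial>lborel) \<longlonglongrightarrow> 0"
        by (rule nn_integral_tendsto_0_mono[OF v(4) _ zero_le_one])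
          (auto simp: indicator_def mult_right_mono[of 1 "1 + norm (G _)", simplified])
      have b: "(\<lambda>n. \<integral>\<^sup>+x. ennreal (indicator K x * (\<bar>soft_step (v n x) - soft_step (u x)\<bar> * norm (G x))) \<partial>lborel) \<longlonglongrightarrow> (\<integral>\<^sup>+x. 0 \<partial>(lborel :: (real^'n) measure))"
      proof (rule nn_integral_dominated_convergence[where w="\<lambda>x. ennreal (norm (indicator K x *\<^sub>R G x))"])
        show "(\<integral>\<^sup>+x. ennreal (norm (indicator K x *\<^sub>R G x)) \<partial>lborel) < \<infinity>"
          using loc(2)[OF K(1,2)] by (simp add: integrable_iff_bounded)
        show "AE x in lborel. ennreal (indicator K x * (\<bar>soft_step (v n x) - soft_step (u x)\<bar> * norm (G x)))
            \<le> ennreal (norm (indicator K x *\<^sub>R G x))" for n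
        proof (intro AE_I2 ennreal_leI)
          fix x
          have "\<bar>soft_step (v n x) - soft_step (u x)\<bar> \<le> 1"
            using soft_step_nonneg[of "v n x"] soft_step_le_1[of "v n x"] soft_step_nonneg[of "u x"] soft_step_le_1[of "u x"]
            by (simp add: abs_le_iff)
          then show "indicator K x * (\<bar>soft_step (v n x) - soft_step (u x)\<bar> * norm (G x)) \<le> norm (indicator K x *\<^sub>R G x)"
            by (auto simp: indicator_def intro: mult_left_le_one_le)
        qed
        show "AE x in lborel. (\<lambda>n. ennreal (indicator K x * (\<bar>soft_step (v n x) - soft_step (u x)\<bar> * norm (G x)))) \<longlonglongrightarrow> 0"
          using v(2)
        proof eventually_elim
          case (elim x)
          show ?case
          proof (cases "x \<in> K")
            case True
            then have "(\<lambda>n. soft_step (v n x)) \<longlonglongrightarrow> soft_step (u x)"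
              using elim by (intro soft_step_tendsto) simp
            then have "(\<lambda>n. indicator K x * (\<bar>soft_step (v n x) - soft_step (u x)\<bar> * norm (G x))) \<longlonglongrightarrow> 0"
              by (intro tendsto_mult_right_zero tendsto_mult_left_zero tendsto_rabs_zero LIM_zero)
            from tendsto_ennrealI[OF this] show ?thesis by simp
          qed simp
        qed
      qed measurable
      have "(\<integral>\<^sup>+x. ennreal (indicator K x * (norm (grad (v n) x - G x) + \<bar>soft_step (v n x) - soft_step (u x)\<bar> * norm (G x))) \<partial>lborel)
        = (\<integral>\<^sup>+x. ennreal (indicator K x * norm (grad (v n) x - G x)) \<partial>lborel)
         + (\<integral>\<^sup>+x. ennreal (indicator K x * (\<bar>soft_step (v n x) - soft_step (u x)\<bar> * norm (G x))) \<partial>lborel)" for n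
        by (subst nn_integral_add[symmetric]) (auto simp: distrib_left)
      then show ?thesis using tendsto_add[OF a b] by simp
    qed
    have lim2: "(\<lambda>n. LBINT x. \<phi> x *\<^sub>R (soft_step (v n x) *\<^sub>R grad (v n) x)) \<longlonglongrightarrow> (LBINT x. \<phi> x *\<^sub>R (soft_step (u x) *\<^sub>R G x))"
    proof (rule tendsto_L1_int)
      show "integrable lborel (\<lambda>x. \<phi> x *\<^sub>R (soft_step (v n x) *\<^sub>R grad (v n) x))" for n
        by (rule integrable_continuous_compact_support[OF _ K(1)])
          (use K in \<open>auto intro!: continuous_intros smooth_continuous smooth_mult smooth_soft_step continuous_on_grad v sm\<close>)
      show "integrable lborel (\<lambda>x. \<phi> x *\<^sub>R (soft_step (u x) *\<^sub>R G x))"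
        by (rule integrable_bounded_mult[OF loc'(2)[OF K(1,2)] _ _ K(3) B(1)]) measurable
      show "(\<lambda>n. \<integral>\<^sup>+x. ennreal (norm (\<phi> x *\<^sub>R (soft_step (v n x) *\<^sub>R grad (v n) x) - \<phi> x *\<^sub>R (soft_step (u x) *\<^sub>R G x))) \<partial>lborel) \<longlonglongrightarrow> 0"
      proof (rule nn_integral_tendsto_0_mono[OF small _ B0])
        fix n x
        show "norm (\<phi> x *\<^sub>R (soft_step (v n x) *\<^sub>R grad (v n) x) - \<phi> x *\<^sub>R (soft_step (u x) *\<^sub>R G x))
           \<le> B * (indicator K x * (norm (grad (v n) x - G x) + \<bar>soft_step (v n x) - soft_step (u x)\<bar> * norm (G x)))"
        proof (cases "x \<in> K")
          case True
          have "norm (soft_step (v n x) *\<^sub>R grad (v n) x - soft_step (u x) *\<^sub>R G x)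
             = norm (soft_step (v n x) *\<^sub>R (grad (v n) x - G x) + (soft_step (v n x) - soft_step (u x)) *\<^sub>R G x)"
            by (simp add: algebra_simps)
          also have "\<dots> \<le> soft_step (v n x) * norm (grad (v n) x - G x) + \<bar>soft_step (v n x) - soft_step (u x)\<bar> * norm (G x)"
            using norm_triangle_ineq soft_step_nonneg[of "v n x"] by (metis norm_scaleR abs_of_nonneg)
          also have "\<dots> \<le> norm (grad (v n) x - G x) + \<bar>soft_step (v n x) - soft_step (u x)\<bar> * norm (G x)"
            using soft_step_nonneg[of "v n x"] soft_step_le_1[of "v n x"] by (simp add: mult_left_le_one_le)
          finally have le: "\<bar>\<phi> x\<bar> * norm (soft_step (v n x) *\<^sub>R grad (v n) x - soft_step (u x) *\<^sub>R G x)
             \<le> B * (norm (grad (v n) x - G x) + \<bar>soft_step (v n x) - soft_step (u x)\<bar> * norm (G x))"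
            by (intro mult_mono B) (auto intro: B0)
          have ind: "indicator K x = (1 :: real)" using True by simp
          show ?thesis using le by (simp only: ind mult_1 scaleR_diff_right[symmetric] norm_scaleR)
        qed (simp add: K(3))
      qed auto
    qed
    show ?thesis
      by (rule LIMSEQ_unique[OF lim1]) (simp only: parts tendsto_minus[OF lim2])
  qed
  then show ?thesis using loc' by (simp add: weak_pair_def)
qed

section \<open>The energy inequality for the truncation\<close>

lemma powr_sq_le: "(x::real)\<^sup>2 \<le> 1 + x powr p" if "x \<ge> 0" "p \<ge> 2"
proof (cases "x \<le> 1")
  case True
  then have "x\<^sup>2 \<le> 1" using that by (simp add: power_le_one)
  then show ?thesis using powr_ge_zero[of x p] by linarith
next
  case False
  then have "x powr 2 \<le> x powr p" using that by (intro powr_mono) auto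
  then show ?thesis using False by simp
qed

lemma integrable_indicator_compact: "compact K \<Longrightarrow> integrable lborel (\<lambda>x::'a::euclidean_space. indicator K x * (c::real))"
  by (intro integrable_mult_left integrable_real_indicator emeasure_bounded_finite)
    (auto intro: compact_imp_bounded compact_imp_closed borel_closed)

text \<open>The steps lie in \<open>[0,1]\<close>, so \<open>B\<close> times the norm of
  \<open>q\<close> on \<open>K\<close> dominates. The weight \<open>q\<close> will be the gradient
  power, \<open>u\<close> itself and the growth factor \<open>1 + norm (G x)\<close>.\<close>

lemma tendsto_integral_soft_step:
  fixes u :: "real^'n \<Rightarrow> real"
  assumes q: "integrable lborel (\<lambda>x. indicator K x * q x)" and [measurable]: "K \<in> sets borel"
    and [measurable]: "q \<in> borel_measurable borel" "\<theta> \<in> borel_measurable borel" "u \<in> borel_measurable borel"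
      "\<And>n. v n \<in> borel_measurable borel"
    and \<theta>: "\<And>x. x \<notin> K \<Longrightarrow> \<theta> x = 0" "\<And>x. \<bar>\<theta> x\<bar> \<le> B"
    and v: "AE x in lborel. x \<in> K \<longrightarrow> (\<lambda>n. v n x) \<longlonglongrightarrow> u x"
  shows "(\<lambda>n. LBINT x. \<theta> x * soft_step (v n x) * q x) \<longlonglongrightarrow> (LBINT x. \<theta> x * soft_step (u x) * q x)"
    and "integrable lborel (\<lambda>x. \<theta> x * soft_step (v n x) * q x)"
    and "integrable lborel (\<lambda>x. \<theta> x * soft_step (u x) * q x)"
proof -
  have bd: "norm (\<theta> x * soft_step s * q x) \<le> B * norm (indicator K x * q x)" for x s
  proof (cases "x \<in> K")
    case True
    have "\<bar>\<theta> x\<bar> * soft_step s \<le> B * 1"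
      using \<theta>(2)[of x] soft_step_nonneg[of s] soft_step_le_1[of s] by (intro mult_mono) auto
    then have "\<bar>\<theta> x\<bar> * soft_step s * \<bar>q x\<bar> \<le> B * 1 * \<bar>q x\<bar>" by (rule mult_right_mono) simp
    then show ?thesis using True soft_step_nonneg[of s] by (simp add: abs_mult)
  qed (simp add: \<theta>)
  have iq: "integrable lborel (\<lambda>x. B * norm (indicator K x * q x))"
    using q by (intro integrable_mult_right integrable_norm)
  have lim: "AE x in lborel. (\<lambda>n. \<theta> x * soft_step (v n x) * q x) \<longlonglongrightarrow> \<theta> x * soft_step (u x) * q x"
    using v
  proof eventually_elim
    case (elim x)
    show ?case
    proof (cases "x \<in> K")
      case True
      then have "(\<lambda>n. soft_step (v n x)) \<longlonglongrightarrow> soft_step (u x)"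
        using elim by (intro soft_step_tendsto) simp
      then show ?thesis by (intro tendsto_intros)
    qed (simp add: \<theta>)
  qed
  show "(\<lambda>n. LBINT x. \<theta> x * soft_step (v n x) * q x) \<longlonglongrightarrow> (LBINT x. \<theta> x * soft_step (u x) * q x)"
  proof (rule integral_dominated_convergence[OF _ _ iq lim])
    show "AE x in lborel. norm (\<theta> x * soft_step (v n x) * q x) \<le> B * norm (indicator K x * q x)" for n
      using bd by (intro AE_I2)
  qed measurable
  show "integrable lborel (\<lambda>x. \<theta> x * soft_step (v n x) * q x)"
    by (rule integrable_le[OF iq _ bd]) measurable
  show "integrable lborel (\<lambda>x. \<theta> x * soft_step (u x) * q x)"
    by (rule integrable_le[OF iq _ bd]) measurable
qed

lemma integrable_indicator_square:
  assumes K: "compact K" and [measurable]: "G \<in> borel_measurable borel" and p: "p \<ge> 2"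
    and Gp: "integrable lborel (\<lambda>x::'a::euclidean_space. indicator K x *\<^sub>R (norm (G x) powr p))"
  shows "integrable lborel (\<lambda>x. indicator K x * (norm (G x))\<^sup>2)"
proof -
  have [measurable]: "K \<in> sets borel" using K by (simp add: compact_imp_closed)
  have "integrable lborel (\<lambda>x. indicator K x * 1 + indicator K x *\<^sub>R (norm (G x) powr p))"
    by (intro Bochner_Integration.integrable_add integrable_indicator_compact Gp K)
  then show ?thesis
    by (rule integrable_le) (use powr_sq_le[OF norm_ge_zero, of p] p in \<open>auto simp: indicator_def\<close>)
qed

text \<open>The test function is \<open>\<phi> * soft_step v\<close> with \<open>v\<close> a mollification of \<open>u\<close>, rather than of
  \<open>soft_step u\<close>, so that it is smooth. The bounds by \<open>h\<close> in the hypothesis \<open>sub\<close> stand in for the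
  flux integral.\<close>

lemma soft_pos_energy:
  fixes u :: "real^'n \<Rightarrow> real"
  assumes wp: "weak_pair \<Omega> u G" and \<Omega>: "open \<Omega>" and p: "p > 2" and \<beta>: "\<beta> > 0" and lam: "lam > 0"
    and Gp: "\<And>K. compact K \<Longrightarrow> K \<subseteq> \<Omega> \<Longrightarrow> integrable lborel (\<lambda>x. indicator K x *\<^sub>R (norm (G x) powr p))"
    and [measurable]: "f \<in> borel_measurable borel"
    and fi: "\<And>K. compact K \<Longrightarrow> K \<subseteq> \<Omega> \<Longrightarrow> integrable lborel (\<lambda>x. indicator K x *\<^sub>R \<bar>f x\<bar>)"
    and \<alpha>: "AE x in lborel. x \<in> \<Omega> \<longrightarrow> norm (\<alpha> x) \<le> \<beta> * (1 + norm (G x)) \<and> 0 \<le> \<alpha> x \<bullet> G x"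
    and sub: "\<And>\<phi> h. \<phi> \<in> test_functions \<Omega> \<Longrightarrow> (\<And>x. 0 \<le> \<phi> x) \<Longrightarrow> integrable lborel h \<Longrightarrow> (\<And>x. 0 \<le> h x) \<Longrightarrow>
       (AE x in lborel. x \<in> \<Omega> \<longrightarrow> - (\<alpha> x \<bullet> grad \<phi> x) \<le> h x) \<Longrightarrow>
       (LBINT x. \<phi> x * norm (G x) powr p) + lam * (LBINT x. \<phi> x * u x)
       \<le> (LBINT x. \<phi> x * \<bar>f x\<bar>) + (LBINT x. h x)"
    and \<phi>: "\<phi> \<in> test_functions \<Omega>" and \<phi>0: "\<And>x. 0 \<le> \<phi> x"
  shows "(LBINT x. \<phi> x * norm (soft_step (u x) *\<^sub>R G x) powr p) + lam * (LBINT x. \<phi> x * soft_pos (u x))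
    \<le> (LBINT x. \<phi> x * \<bar>f x\<bar>) + \<beta> * (LBINT x. norm (grad \<phi> x) * (1 + norm (soft_step (u x) *\<^sub>R G x)))"
proof -
  have [measurable]: "u \<in> borel_measurable borel" "G \<in> borel_measurable borel"
    using wp by (auto simp: weak_pair_def)
  have G2: "integrable lborel (\<lambda>x. indicator K x * (norm (G x))\<^sup>2)" if K: "compact K" "K \<subseteq> \<Omega>" for K
    by (rule integrable_indicator_square[OF K(1) _ _ Gp[OF K]]) (use p in auto)
  from test_function_bounds[OF \<phi>] obtain K B where KB: "compact K" "K \<subseteq> \<Omega>"
      "\<forall>x. x \<notin> K \<longrightarrow> \<phi> x = 0" "\<forall>x. x \<notin> K \<longrightarrow> grad \<phi> x = 0"
      "\<forall>x. \<bar>\<phi> x\<bar> \<le> B" "\<forall>x. norm (grad \<phi> x) \<le> B"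
    and sm: "smooth_fun \<phi>" and [measurable]: "\<phi> \<in> borel_measurable borel" "grad \<phi> \<in> borel_measurable borel"
    by (elim exE conjE) (rule that)
  have K: "compact K" "K \<subseteq> \<Omega>" "\<And>x. x \<notin> K \<Longrightarrow> \<phi> x = 0" "\<And>x. x \<notin> K \<Longrightarrow> grad \<phi> x = 0"
    and B: "\<And>x. \<bar>\<phi> x\<bar> \<le> B" "\<And>x. norm (grad \<phi> x) \<le> B"
    using KB by blast+
  have B': "\<bar>norm (grad \<phi> x)\<bar> \<le> B" for x using B(2)[of x] by simp
  have K4: "norm (grad \<phi> x) = 0" if "x \<notin> K" for x using K(4)[OF that] by simp
  have Km[measurable]: "K \<in> sets borel" using K(1) by (simp add: compact_imp_closed)
  have B0: "B \<ge> 0" using B(1)[of 0] by linarith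
  obtain v where v: "\<And>n. smooth_fun (v n)" "AE x in lborel. x \<in> K \<longrightarrow> (\<lambda>n. v n x) \<longlonglongrightarrow> u x"
    "(\<lambda>n. \<integral>\<^sup>+x. ennreal (indicator K x * ((1 + norm (G x)) * norm (grad (v n) x - G x))) \<partial>lborel) \<longlonglongrightarrow> 0"
    using mollified_sequence[OF wp \<Omega> K(1,2) G2] by blast
  have vm[measurable]: "v n \<in> borel_measurable borel" "grad (v n) \<in> borel_measurable borel" for n
    using v(1) by (auto intro: borel_measurable_smooth borel_measurable_grad)
  \<comment> \<open>The growth of the flux times the error of the mollified gradient: all that
    remains of the term with the derivative of \<open>soft_step\<close>.\<close>
  define e where "e n x = indicator K x * ((1 + norm (G x)) * norm (grad (v n) x - G x))" for n x
  have e0: "0 \<le> e n x" for n x by (simp add: e_def)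
  have iK: "integrable lborel (\<lambda>x. indicator K x * 1 :: real)" by (rule integrable_indicator_compact[OF K(1)])
  have iG: "integrable lborel (\<lambda>x. indicator K x * norm (G x))"
  proof -
    have "integrable lborel (\<lambda>x. indicator K x *\<^sub>R G x)" using wp K by (simp add: weak_pair_def)
    from integrable_norm[OF this] show ?thesis by simp
  qed
  have i1G: "integrable lborel (\<lambda>x. indicator K x * (1 + norm (G x)))"
    using Bochner_Integration.integrable_add[OF iK iG] by (simp add: distrib_left)
  have iu: "integrable lborel (\<lambda>x. indicator K x * u x)" using wp K by (simp add: weak_pair_def)
  have iGp: "integrable lborel (\<lambda>x. indicator K x * norm (G x) powr p)" using Gp[OF K(1,2)] by simp
  have ie: "integrable lborel (e n)" for n
  proof -
    have "compact (grad (v n) ` K)" using K(1) v(1) by (intro compact_continuous_image continuous_on_grad)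
    then obtain C where C: "\<And>x. x \<in> K \<Longrightarrow> norm (grad (v n) x) \<le> C"
      using compact_imp_bounded bounded_iff[of "grad (v n) ` K"] by blast
    have "integrable lborel (\<lambda>x. \<bar>C\<bar> * (indicator K x * (1 + norm (G x))) + (indicator K x * norm (G x) + indicator K x * (norm (G x))\<^sup>2))"
      by (intro Bochner_Integration.integrable_add integrable_mult_right i1G iG G2 K)
    then show ?thesis
    proof (rule integrable_le)
      fix x
      show "norm (e n x) \<le> \<bar>C\<bar> * (indicator K x * (1 + norm (G x))) + (indicator K x * norm (G x) + indicator K x * (norm (G x))\<^sup>2)"
      proof (cases "x \<in> K")
        case True
        have "norm (grad (v n) x - G x) \<le> \<bar>C\<bar> + norm (G x)"
          using norm_triangle_ineq4[of "grad (v n) x" "G x"] C[OF True] by linarith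
        then have "(1 + norm (G x)) * norm (grad (v n) x - G x) \<le> (1 + norm (G x)) * (\<bar>C\<bar> + norm (G x))"
          by (intro mult_left_mono) auto
        then show ?thesis using True by (simp add: e_def abs_mult algebra_simps power2_eq_square)
      qed (simp add: e_def)
    next
      show "e n \<in> borel_measurable lborel" unfolding e_def[abs_def] by measurable
    qed
  qed
  have e_lim: "(\<lambda>n. LBINT x. e n x) \<longlonglongrightarrow> 0"
  proof -
    have "(\<integral>\<^sup>+x. ennreal (e n x) \<partial>lborel) = ennreal (LBINT x. e n x)" for n
      using e0 by (intro nn_integral_eq_integral ie) auto
    with v(3) have "(\<lambda>n. ennreal (LBINT x. e n x)) \<longlonglongrightarrow> 0" by (simp add: e_def)
    then show ?thesis
      by (subst (asm) ennreal_tendsto_0_iff) (auto intro!: integral_nonneg_AE e0)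
  qed
  have um: "u \<in> borel_measurable borel" and \<phi>m: "\<phi> \<in> borel_measurable borel" by measurable
  have ms: "(\<lambda>x. norm (G x) powr p) \<in> borel_measurable borel" "(\<lambda>x. 1 + norm (G x)) \<in> borel_measurable borel"
    "(\<lambda>x. norm (grad \<phi> x)) \<in> borel_measurable borel" by measurable
  note L1 = tendsto_integral_soft_step[where v=v, OF iGp Km ms(1) \<phi>m um vm(1) K(3) B(1) v(2)]
  note L2 = tendsto_integral_soft_step[where v=v, OF iu Km um \<phi>m um vm(1) K(3) B(1) v(2)]
  note L3 = tendsto_integral_soft_step[where v=v, OF i1G Km ms(2,3) um vm(1) K4 B' v(2)]
  have step: "(LBINT x. \<phi> x * soft_step (v n x) * norm (G x) powr p) + lam * (LBINT x. \<phi> x * soft_step (v n x) * u x)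
     \<le> (LBINT x. \<phi> x * \<bar>f x\<bar>) + (\<beta> * (LBINT x. norm (grad \<phi> x) * soft_step (v n x) * (1 + norm (G x)))
          + (6 * B * \<beta>) * (LBINT x. e n x))" for n
  proof -
    let ?S = "\<lambda>x. soft_step (v n x)"
    define \<phi>n where "\<phi>n x = \<phi> x * ?S x" for x
    define h where "h x = \<beta> * (norm (grad \<phi> x) * ?S x * (1 + norm (G x))) + (6 * B * \<beta>) * e n x" for x
    have \<phi>n: "\<phi>n \<in> test_functions \<Omega>"
      unfolding test_functions_iff
      by (intro conjI exI[of _ K]) (use K in \<open>auto simp: \<phi>n_def[abs_def] intro!: smooth_mult sm smooth_soft_step v(1)\<close>)
    have g: "grad \<phi>n x = (\<phi> x * flat_exp 3 (v n x)) *\<^sub>R grad (v n) x + ?S x *\<^sub>R grad \<phi> x" for x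
      unfolding \<phi>n_def[abs_def] grad_mult[OF sm smooth_soft_step[OF v(1)]]
        grad_compose[OF v(1) soft_step_has_derivative] by simp
    have ih: "integrable lborel h"
      unfolding h_def[abs_def] by (intro Bochner_Integration.integrable_add integrable_mult_right ie L3(2))
    have h0: "0 \<le> h x" for x
      unfolding h_def using \<beta> B0 e0 soft_step_nonneg by (intro add_nonneg_nonneg mult_nonneg_nonneg) auto
    have "AE x in lborel. x \<in> \<Omega> \<longrightarrow> - (\<alpha> x \<bullet> grad \<phi>n x) \<le> h x"
      using \<alpha>
    proof eventually_elim
      case (elim x)
      show ?case
      proof
        assume "x \<in> \<Omega>"
        with elim have a: "norm (\<alpha> x) \<le> \<beta> * (1 + norm (G x))" "0 \<le> \<alpha> x \<bullet> G x" by auto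
        show "- (\<alpha> x \<bullet> grad \<phi>n x) \<le> h x"
        proof (cases "x \<in> K")
          case False
          then have "grad \<phi>n x = 0" by (simp add: g K)
          then show ?thesis using h0[of x] by simp
        next
          case True
          let ?c = "\<phi> x * flat_exp 3 (v n x)"
          have c: "0 \<le> ?c" "?c \<le> 6 * B"
          proof -
            show "0 \<le> ?c" using \<phi>0 flat_exp_nonneg by simp
            have "?c \<le> B * 6" using \<phi>0[of x] B(1)[of x] flat_exp_le[of 3 "v n x"] flat_exp_nonneg[of 3 "v n x"] B0
              by (intro mult_mono) (auto simp: fact_numeral)
            then show "?c \<le> 6 * B" by simp
          qed
          \<comment> \<open>Split the mollified gradient into \<open>G x\<close> and an error. The
            sign condition drops the first part, and the growth bound controls the second.\<close>
          have 1: "- (\<alpha> x \<bullet> grad (v n) x) \<le> \<beta> * (1 + norm (G x)) * norm (grad (v n) x - G x)"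
          proof -
            have "- (\<alpha> x \<bullet> grad (v n) x) = - (\<alpha> x \<bullet> G x) - \<alpha> x \<bullet> (grad (v n) x - G x)"
              by (simp add: inner_diff_right)
            also have "\<dots> \<le> norm (\<alpha> x) * norm (grad (v n) x - G x)"
              using a(2) Cauchy_Schwarz_ineq2[of "\<alpha> x" "grad (v n) x - G x"] by linarith
            also have "\<dots> \<le> \<beta> * (1 + norm (G x)) * norm (grad (v n) x - G x)"
              using a(1) by (intro mult_right_mono) auto
            finally show ?thesis .
          qed
          have "?c * (- (\<alpha> x \<bullet> grad (v n) x)) \<le> ?c * (\<beta> * (1 + norm (G x)) * norm (grad (v n) x - G x))"
            using 1 c by (intro mult_left_mono) auto
          also have "\<dots> \<le> (6 * B) * (\<beta> * (1 + norm (G x)) * norm (grad (v n) x - G x))"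
            using c \<beta> by (intro mult_right_mono) auto
          also have "\<dots> = (6 * B * \<beta>) * e n x" using True by (simp add: e_def)
          finally have A: "?c * (- (\<alpha> x \<bullet> grad (v n) x)) \<le> (6 * B * \<beta>) * e n x" .
          have "- (\<alpha> x \<bullet> grad \<phi> x) \<le> norm (\<alpha> x) * norm (grad \<phi> x)"
            using Cauchy_Schwarz_ineq2[of "\<alpha> x" "grad \<phi> x"] by linarith
          also have "\<dots> \<le> \<beta> * (1 + norm (G x)) * norm (grad \<phi> x)" using a(1) by (intro mult_right_mono) auto
          finally have "?S x * (- (\<alpha> x \<bullet> grad \<phi> x)) \<le> ?S x * (\<beta> * (1 + norm (G x)) * norm (grad \<phi> x))"
            using soft_step_nonneg by (intro mult_left_mono)
          then have "?S x * (- (\<alpha> x \<bullet> grad \<phi> x)) \<le> \<beta> * (norm (grad \<phi> x) * ?S x * (1 + norm (G x)))"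
            by (simp add: mult_ac)
          moreover have "- (\<alpha> x \<bullet> grad \<phi>n x) = ?c * (- (\<alpha> x \<bullet> grad (v n) x)) + ?S x * (- (\<alpha> x \<bullet> grad \<phi> x))"
            by (simp add: g inner_add_right)
          ultimately show ?thesis using A unfolding h_def by linarith
        qed
      qed
    qed
    from sub[OF \<phi>n _ ih h0 this]
    have "(LBINT x. \<phi>n x * norm (G x) powr p) + lam * (LBINT x. \<phi>n x * u x)
       \<le> (LBINT x. \<phi>n x * \<bar>f x\<bar>) + (LBINT x. h x)"
      using \<phi>0 soft_step_nonneg by (simp add: \<phi>n_def)
    also have "(LBINT x. h x) = \<beta> * (LBINT x. norm (grad \<phi> x) * ?S x * (1 + norm (G x)))
          + (6 * B * \<beta>) * (LBINT x. e n x)"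
      unfolding h_def using L3(2) ie by simp
    also have "(LBINT x. \<phi>n x * \<bar>f x\<bar>) \<le> (LBINT x. \<phi> x * \<bar>f x\<bar>)"
    proof (rule integral_mono_AE')
      show "integrable lborel (\<lambda>x. \<phi> x * \<bar>f x\<bar>)"
        using integrable_bounded_mult[OF fi[OF K(1,2)] _ _ K(3) B(1)] by simp
      show "AE x in lborel. \<phi>n x * \<bar>f x\<bar> \<le> \<phi> x * \<bar>f x\<bar>"
        using \<phi>0 soft_step_nonneg soft_step_le_1
        by (intro AE_I2 mult_right_mono) (auto simp: \<phi>n_def mult_left_le)
    qed (use \<phi>0 in auto)
    finally show ?thesis by (simp add: \<phi>n_def)
  qed
  have main: "(LBINT x. \<phi> x * soft_step (u x) * norm (G x) powr p) + lam * (LBINT x. \<phi> x * soft_step (u x) * u x)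
     \<le> (LBINT x. \<phi> x * \<bar>f x\<bar>) + (\<beta> * (LBINT x. norm (grad \<phi> x) * soft_step (u x) * (1 + norm (G x))) + (6 * B * \<beta>) * 0)"
  proof (rule LIMSEQ_le)
    show "(\<lambda>n. (LBINT x. \<phi> x * soft_step (v n x) * norm (G x) powr p) + lam * (LBINT x. \<phi> x * soft_step (v n x) * u x))
      \<longlonglongrightarrow> (LBINT x. \<phi> x * soft_step (u x) * norm (G x) powr p) + lam * (LBINT x. \<phi> x * soft_step (u x) * u x)"
      by (intro tendsto_add tendsto_mult tendsto_const L1(1) L2(1))
    show "(\<lambda>n. (LBINT x. \<phi> x * \<bar>f x\<bar>) + (\<beta> * (LBINT x. norm (grad \<phi> x) * soft_step (v n x) * (1 + norm (G x)))
          + (6 * B * \<beta>) * (LBINT x. e n x)))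
      \<longlonglongrightarrow> (LBINT x. \<phi> x * \<bar>f x\<bar>) + (\<beta> * (LBINT x. norm (grad \<phi> x) * soft_step (u x) * (1 + norm (G x))) + (6 * B * \<beta>) * 0)"
      by (intro tendsto_add tendsto_mult tendsto_const L3(1) e_lim)
  qed (use step in blast)
  \<comment> \<open>In the limit inequality every term except the source carries a single factor
    \<open>soft_step (u x)\<close>. Three comparisons, valid because this factor lies in
    \<open>[0,1]\<close>, turn it into the inequality for the truncated pair.\<close>
  have "(LBINT x. \<phi> x * norm (soft_step (u x) *\<^sub>R G x) powr p) \<le> (LBINT x. \<phi> x * soft_step (u x) * norm (G x) powr p)"
  proof (rule integral_mono_AE'[OF L1(3)])
    show "AE x in lborel. \<phi> x * norm (soft_step (u x) *\<^sub>R G x) powr p \<le> \<phi> x * soft_step (u x) * norm (G x) powr p"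
    proof (intro AE_I2)
      fix x
      let ?s = "soft_step (u x)"
      have "norm (?s *\<^sub>R G x) powr p = ?s powr p * norm (G x) powr p"
        using soft_step_nonneg[of "u x"] by (simp add: powr_mult)
      also have "\<dots> \<le> ?s powr 1 * norm (G x) powr p"
        using soft_step_nonneg[of "u x"] soft_step_le_1[of "u x"] p
        by (intro mult_right_mono powr_mono') auto
      also have "?s powr 1 = ?s" using soft_step_nonneg[of "u x"] by simp
      finally have "\<phi> x * norm (?s *\<^sub>R G x) powr p \<le> \<phi> x * (?s * norm (G x) powr p)"
        using \<phi>0 by (intro mult_left_mono)
      then show "\<phi> x * norm (?s *\<^sub>R G x) powr p \<le> \<phi> x * ?s * norm (G x) powr p" by (simp only: mult.assoc)
    qed
  qed (use \<phi>0 soft_step_nonneg in auto)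
  moreover have "(LBINT x. \<phi> x * soft_pos (u x)) \<le> (LBINT x. \<phi> x * soft_step (u x) * u x)"
  proof (rule integral_mono_AE'[OF L2(3)])
    have "\<phi> x * soft_pos (u x) \<le> \<phi> x * soft_step (u x) * u x" for x
      using mult_left_mono[OF soft_pos_le[of "u x"] \<phi>0[of x]] by (simp add: mult_ac)
    moreover have "0 \<le> \<phi> x * soft_pos (u x)" for x using \<phi>0 soft_pos_nonneg by simp
    ultimately show "AE x in lborel. \<phi> x * soft_pos (u x) \<le> \<phi> x * soft_step (u x) * u x"
      "AE x in lborel. 0 \<le> \<phi> x * soft_step (u x) * u x"
      by (auto intro: order_trans)
  qed
  moreover have "(LBINT x. norm (grad \<phi> x) * soft_step (u x) * (1 + norm (G x)))
      \<le> (LBINT x. norm (grad \<phi> x) * (1 + norm (soft_step (u x) *\<^sub>R G x)))"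
  proof (rule integral_mono_AE')
    have "integrable lborel (\<lambda>x. norm (grad \<phi> x) *\<^sub>R (1 + norm (G x)))"
      using i1G by (intro integrable_bounded_mult[OF _ _ _ K4 B']) auto
    then show "integrable lborel (\<lambda>x. norm (grad \<phi> x) * (1 + norm (soft_step (u x) *\<^sub>R G x)))"
    proof (rule integrable_le)
      show "norm (norm (grad \<phi> x) * (1 + norm (soft_step (u x) *\<^sub>R G x))) \<le> norm (grad \<phi> x) *\<^sub>R (1 + norm (G x))" for x
        using soft_step_nonneg[of "u x"] soft_step_le_1[of "u x"]
        by (simp add: abs_mult mult_left_mono mult_left_le_one_le)
    qed measurable
    show "AE x in lborel. norm (grad \<phi> x) * soft_step (u x) * (1 + norm (G x)) \<le> norm (grad \<phi> x) * (1 + norm (soft_step (u x) *\<^sub>R G x))"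
    proof (intro AE_I2)
      fix x
      have "soft_step (u x) * (1 + norm (G x)) \<le> 1 + norm (soft_step (u x) *\<^sub>R G x)"
        using soft_step_nonneg[of "u x"] soft_step_le_1[of "u x"] by (simp add: distrib_left)
      then show "norm (grad \<phi> x) * soft_step (u x) * (1 + norm (G x)) \<le> norm (grad \<phi> x) * (1 + norm (soft_step (u x) *\<^sub>R G x))"
        unfolding mult.assoc by (intro mult_left_mono) auto
    qed
  qed auto
  ultimately show ?thesis using main lam \<beta>
    by (smt (verit, best) mult_left_mono mult_zero_right)
qed

section \<open>Passing to Borel representatives\<close>

lemma AE_lebesgue_on_iff:
  "S \<in> sets borel \<Longrightarrow> (AE x in lebesgue_on S. P x) \<longleftrightarrow> (AE x in lborel. x \<in> S \<longrightarrow> P x)"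
  by (subst AE_restrict_space_iff) (auto simp: AE_completion_iff)

lemma
  fixes F F0 :: "'a::euclidean_space \<Rightarrow> 'b::euclidean_space"
  assumes S: "S \<in> sets borel" and F: "F \<in> borel_measurable (lebesgue_on S)"
    and F0[measurable]: "F0 \<in> borel_measurable borel"
    and eq: "AE x in lborel. x \<in> S \<longrightarrow> F x = F0 x"
  shows integral_lebesgue_on_transfer:
      "(\<integral>x. F x \<partial>lebesgue_on S) = (LBINT x. indicator S x *\<^sub>R F0 x)"
    and integrable_lebesgue_on_transfer:
      "integrable (lebesgue_on S) F \<longleftrightarrow> integrable lborel (\<lambda>x. indicator S x *\<^sub>R F0 x)"
proof -
  note [measurable] = S
  have S': "S \<inter> space lebesgue \<in> sets lebesgue" using S by auto
  have m: "(\<lambda>x. indicator S x *\<^sub>R F x) \<in> borel_measurable lebesgue"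
    using F borel_measurable_restrict_space_iff[OF S', of F] by simp
  have m0: "(\<lambda>x. indicator S x *\<^sub>R F0 x) \<in> borel_measurable lborel" by measurable
  have m0': "(\<lambda>x. indicator S x *\<^sub>R F0 x) \<in> borel_measurable lebesgue" using m0 by (rule measurable_completion)
  have ae: "AE x in lebesgue. indicator S x *\<^sub>R F x = indicator S x *\<^sub>R F0 x"
    using eq by (intro AE_completion) (auto elim!: eventually_mono simp: indicator_def)
  have "(\<integral>x. F x \<partial>lebesgue_on S) = (\<integral>x. indicator S x *\<^sub>R F x \<partial>lebesgue)"
    by (rule integral_restrict_space[OF S'])
  also have "\<dots> = (\<integral>x. indicator S x *\<^sub>R F0 x \<partial>lebesgue)" by (rule integral_cong_AE[OF m m0' ae])
  also have "\<dots> = (LBINT x. indicator S x *\<^sub>R F0 x)" by (rule integral_completion[OF m0])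
  finally show "(\<integral>x. F x \<partial>lebesgue_on S) = (LBINT x. indicator S x *\<^sub>R F0 x)" .
  have "integrable (lebesgue_on S) F \<longleftrightarrow> integrable lebesgue (\<lambda>x. indicator S x *\<^sub>R F x)"
    by (rule integrable_restrict_space[OF S'])
  also have "\<dots> \<longleftrightarrow> integrable lebesgue (\<lambda>x. indicator S x *\<^sub>R F0 x)" by (rule integrable_cong_AE[OF m m0' ae])
  also have "\<dots> \<longleftrightarrow> integrable lborel (\<lambda>x. indicator S x *\<^sub>R F0 x)" by (rule integrable_completion[OF m0])
  finally show "integrable (lebesgue_on S) F \<longleftrightarrow> integrable lborel (\<lambda>x. indicator S x *\<^sub>R F0 x)" .
qed

lemma borel_measurable_lebesgue_on: "f \<in> borel_measurable borel \<Longrightarrow> f \<in> borel_measurable (lebesgue_on S)"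
  by (intro measurable_restrict_space1 measurable_completion) simp

lemma borel_representative_real:
  fixes h :: "'a::euclidean_space \<Rightarrow> real"
  assumes "S \<in> sets borel" "h \<in> borel_measurable (lebesgue_on S)"
  shows "\<exists>h0\<in>borel_measurable borel. AE x in lborel. x \<in> S \<longrightarrow> h x = h0 x"
proof -
  have "(\<lambda>x. if x \<in> S then h x else 0) \<in> borel_measurable lebesgue"
    using assms by (intro borel_measurable_if_I) auto
  from completion_ex_borel_measurable_real[OF this] obtain h0 where
    h0: "h0 \<in> borel_measurable lborel" "AE x in lborel. (if x \<in> S then h x else 0) = h0 x" by blast
  from h0(2) have "AE x in lborel. x \<in> S \<longrightarrow> h x = h0 x" by eventually_elim auto
  with h0(1) show ?thesis by auto
qed

lemma vec_sum_axis: "(\<Sum>i\<in>UNIV. (x $ i) *\<^sub>R axis i 1) = (x :: real^'n)"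
  using basis_expansion[of x] by (simp add: scalar_mult_eq_scaleR)

lemma borel_representative_vec:
  fixes h :: "'a::euclidean_space \<Rightarrow> real^'n"
  assumes S: "S \<in> sets borel" and h: "h \<in> borel_measurable (lebesgue_on S)"
  shows "\<exists>h0\<in>borel_measurable borel. AE x in lborel. x \<in> S \<longrightarrow> h x = h0 x"
proof -
  have "\<forall>i. \<exists>g. g \<in> borel_measurable borel \<and> (AE x in lborel. x \<in> S \<longrightarrow> h x $ i = g x)"
  proof
    fix i
    have "(\<lambda>x. h x \<bullet> axis i 1) \<in> borel_measurable (lebesgue_on S)" using h by measurable
    then have "(\<lambda>x. h x $ i) \<in> borel_measurable (lebesgue_on S)" by (simp add: inner_axis)
    from borel_representative_real[OF S this]
    show "\<exists>g. g \<in> borel_measurable borel \<and> (AE x in lborel. x \<in> S \<longrightarrow> h x $ i = g x)" by blast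
  qed
  then obtain g where g: "\<forall>i. g i \<in> borel_measurable borel \<and> (AE x in lborel. x \<in> S \<longrightarrow> h x $ i = g i x)"
    by (rule choice[THEN exE])
  then have [measurable]: "g i \<in> borel_measurable borel" for i by blast
  define h0 where "h0 x = (\<Sum>i\<in>UNIV. g i x *\<^sub>R (axis i 1 :: real^'n))" for x
  have "AE x in lborel. \<forall>i\<in>UNIV. x \<in> S \<longrightarrow> h x $ i = g i x"
    by (rule AE_finite_allI) (use g in auto)
  then have "AE x in lborel. x \<in> S \<longrightarrow> h x = h0 x"
  proof eventually_elim
    case (elim x)
    show ?case
    proof
      assume "x \<in> S"
      then have "h0 x = (\<Sum>i\<in>UNIV. (h x $ i) *\<^sub>R axis i 1)" using elim by (simp add: h0_def)
      then show "h x = h0 x" by (simp only: vec_sum_axis)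
    qed
  qed
  moreover have "h0 \<in> borel_measurable borel" unfolding h0_def[abs_def] by measurable
  ultimately show ?thesis by blast
qed

text \<open>Local spaces give measurability on compact subsets only. Cut off to a compact exhaustion
  and pass to the pointwise limit.\<close>

lemma measurable_lebesgue_on_open:
  fixes h :: "'a::euclidean_space \<Rightarrow> 'b::euclidean_space"
  assumes \<Omega>: "open \<Omega>" and h: "\<And>K. compact K \<Longrightarrow> K \<subseteq> \<Omega> \<Longrightarrow> h \<in> borel_measurable (lebesgue_on K)"
  shows "h \<in> borel_measurable (lebesgue_on \<Omega>)"
proof -
  obtain C :: "nat \<Rightarrow> 'a set" where C: "\<And>n. compact (C n)" "\<And>n. C n \<subseteq> \<Omega>" "\<Union>(range C) = \<Omega>"
    "\<And>K. compact K \<Longrightarrow> K \<subseteq> \<Omega> \<Longrightarrow> \<exists>N. \<forall>n\<ge>N. K \<subseteq> C n"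
    using open_Union_compact_subsets[OF \<Omega>] by metis
  have "(\<lambda>x. if x \<in> \<Omega> then h x else 0) \<in> borel_measurable lebesgue"
  proof (rule borel_measurable_LIMSEQ_metric)
    show "(\<lambda>x. if x \<in> C n then h x else 0) \<in> borel_measurable lebesgue" for n
      using C(1)[of n] h[OF C(1,2)] by (intro borel_measurable_if_I) (auto simp: compact_imp_closed)
    show "(\<lambda>n. if x \<in> C n then h x else 0) \<longlonglongrightarrow> (if x \<in> \<Omega> then h x else 0)" for x
    proof (cases "x \<in> \<Omega>")
      case True
      then obtain N where "\<forall>n\<ge>N. x \<in> C n" using C(4)[of "{x}"] by auto
      then have "eventually (\<lambda>n. (if x \<in> C n then h x else 0) = (if x \<in> \<Omega> then h x else 0)) sequentially"
        using True by (intro eventually_sequentiallyI[of N]) auto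
      then show ?thesis by (rule tendsto_eventually)
    next
      case False
      then have "x \<notin> C n" for n using C(2) by blast
      then show ?thesis using False by simp
    qed
  qed
  then show ?thesis by (rule borel_measurable_if_D)
qed

lemma Lspace_1_integrable: "f \<in> Lspace K 1 \<Longrightarrow> integrable (lebesgue_on K) f"
  by (auto simp: Lspace_def integrable_norm_iff)

text \<open>A test function and its gradient vanish off \<open>\<Omega>\<close>, so integrals over
  \<open>\<Omega>\<close> become integrals over the whole space whatever values the representatives
  take outside.\<close>

lemma weak_pair_representative:
  fixes u u0 :: "real^'n \<Rightarrow> real"
  assumes \<Omega>: "open \<Omega>" and wg: "has_weak_gradient \<Omega> u G"
    and u0: "u0 \<in> borel_measurable borel" "AE x in lborel. x \<in> \<Omega> \<longrightarrow> u x = u0 x"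
    and G0: "G0 \<in> borel_measurable borel" "AE x in lborel. x \<in> \<Omega> \<longrightarrow> G x = G0 x"
    and um: "u \<in> borel_measurable (lebesgue_on \<Omega>)" and Gm: "G \<in> borel_measurable (lebesgue_on \<Omega>)"
  shows "weak_pair \<Omega> u0 G0"
proof -
  note [measurable] = u0(1) G0(1) um Gm
  have \<Omega>b: "\<Omega> \<in> sets borel" using \<Omega> by simp
  have onK: "integrable lborel (\<lambda>x. indicator K x *\<^sub>R u0 x)" "integrable lborel (\<lambda>x. indicator K x *\<^sub>R G0 x)"
    if K: "compact K" "K \<subseteq> \<Omega>" for K
  proof -
    have Kb: "K \<in> sets borel" using K(1) by (simp add: compact_imp_closed)
    have i: "integrable (lebesgue_on K) u" "integrable (lebesgue_on K) G"
      using wg K unfolding has_weak_gradient_def Lspace_loc_def by (auto intro: Lspace_1_integrable)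
    have ae: "AE x in lborel. x \<in> K \<longrightarrow> u x = u0 x" "AE x in lborel. x \<in> K \<longrightarrow> G x = G0 x"
    proof -
      show "AE x in lborel. x \<in> K \<longrightarrow> u x = u0 x" using u0(2) by eventually_elim (use K(2) in auto)
      show "AE x in lborel. x \<in> K \<longrightarrow> G x = G0 x" using G0(2) by eventually_elim (use K(2) in auto)
    qed
    show "integrable lborel (\<lambda>x. indicator K x *\<^sub>R u0 x)"
      using i(1) integrable_lebesgue_on_transfer[OF Kb borel_measurable_integrable[OF i(1)] u0(1) ae(1)] by blast
    show "integrable lborel (\<lambda>x. indicator K x *\<^sub>R G0 x)"
      using i(2) integrable_lebesgue_on_transfer[OF Kb borel_measurable_integrable[OF i(2)] G0(1) ae(2)] by blast
  qed
  have "(LBINT x. u0 x *\<^sub>R grad \<phi> x) = - (LBINT x. \<phi> x *\<^sub>R G0 x)" if \<phi>: "\<phi> \<in> test_functions \<Omega>" for \<phi>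
  proof -
    from test_function_bounds[OF \<phi>] obtain K where K: "K \<subseteq> \<Omega>"
        "\<forall>x. x \<notin> K \<longrightarrow> \<phi> x = 0" "\<forall>x. x \<notin> K \<longrightarrow> grad \<phi> x = 0"
      and [measurable]: "\<phi> \<in> borel_measurable borel" "grad \<phi> \<in> borel_measurable borel"
      by (elim exE conjE) (rule that)
    have [measurable]: "\<phi> \<in> borel_measurable (lebesgue_on \<Omega>)" "grad \<phi> \<in> borel_measurable (lebesgue_on \<Omega>)"
      by (simp_all add: borel_measurable_lebesgue_on)
    have ind: "indicator \<Omega> x *\<^sub>R (u0 x *\<^sub>R grad \<phi> x) = u0 x *\<^sub>R grad \<phi> x"
      "indicator \<Omega> x *\<^sub>R (\<phi> x *\<^sub>R G0 x) = \<phi> x *\<^sub>R G0 x" for x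
    proof -
      have "x \<in> \<Omega> \<or> \<phi> x = 0 \<and> grad \<phi> x = 0" using K by blast
      then show "indicator \<Omega> x *\<^sub>R (u0 x *\<^sub>R grad \<phi> x) = u0 x *\<^sub>R grad \<phi> x"
        "indicator \<Omega> x *\<^sub>R (\<phi> x *\<^sub>R G0 x) = \<phi> x *\<^sub>R G0 x" by auto
    qed
    have "(\<integral>x. u x *\<^sub>R grad \<phi> x \<partial>lebesgue_on \<Omega>) = (LBINT x. indicator \<Omega> x *\<^sub>R (u0 x *\<^sub>R grad \<phi> x))"
      by (rule integral_lebesgue_on_transfer[OF \<Omega>b]) (use u0(2) in \<open>auto elim!: eventually_mono\<close>)
    also have "\<dots> = (LBINT x. u0 x *\<^sub>R grad \<phi> x)" by (simp only: ind)
    finally have 1: "(\<integral>x. u x *\<^sub>R grad \<phi> x \<partial>lebesgue_on \<Omega>) = (LBINT x. u0 x *\<^sub>R grad \<phi> x)" .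
    have "(\<integral>x. \<phi> x *\<^sub>R G x \<partial>lebesgue_on \<Omega>) = (LBINT x. indicator \<Omega> x *\<^sub>R (\<phi> x *\<^sub>R G0 x))"
      by (rule integral_lebesgue_on_transfer[OF \<Omega>b]) (use G0(2) in \<open>auto elim!: eventually_mono\<close>)
    also have "\<dots> = (LBINT x. \<phi> x *\<^sub>R G0 x)" by (simp only: ind)
    finally have 2: "(\<integral>x. \<phi> x *\<^sub>R G x \<partial>lebesgue_on \<Omega>) = (LBINT x. \<phi> x *\<^sub>R G0 x)" .
    have "(\<integral>x. u x *\<^sub>R grad \<phi> x \<partial>lebesgue_on \<Omega>) = - (\<integral>x. \<phi> x *\<^sub>R G x \<partial>lebesgue_on \<Omega>)"
      using wg \<phi> unfolding has_weak_gradient_def by blast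
    then show ?thesis by (simp only: 1 2)
  qed
  then show ?thesis unfolding weak_pair_def using onK u0(1) G0(1) by blast
qed

section \<open>Growth of the source on small balls\<close>

lemma source_estimate_infinity:
  fixes f :: "real^'n \<Rightarrow> real"
  assumes \<Omega>: "open \<Omega>" and f: "f \<in> Lspace \<Omega> \<infinity>"
    and f0[measurable]: "f0 \<in> borel_measurable borel" and ae: "AE x in lborel. x \<in> \<Omega> \<longrightarrow> f x = f0 x"
  shows "R > 0 \<Longrightarrow> cball z R \<subseteq> \<Omega> \<Longrightarrow> (LBINT x. indicator (cball z R) x *\<^sub>R \<bar>f0 x\<bar>)
    \<le> (Lnorm \<Omega> \<infinity> f * unit_ball_vol (real CARD('n))) * R powr (real CARD('n))"
    and "compact K \<Longrightarrow> K \<subseteq> \<Omega> \<Longrightarrow> integrable lborel (\<lambda>x. indicator K x *\<^sub>R \<bar>f0 x\<bar>)"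
proof -
  let ?L = "Lnorm \<Omega> \<infinity> f"
  let ?e = "esssup (lebesgue_on \<Omega>) (\<lambda>x. ennreal (norm (f x)))"
  have fin: "?e < \<infinity>" using f by (simp add: Lspace_def)
  have "AE x in lebesgue_on \<Omega>. ennreal (norm (f x)) \<le> ?e" by (rule esssup_AE)
  then have "AE x in lebesgue_on \<Omega>. \<bar>f x\<bar> \<le> ?L"
  proof eventually_elim
    case (elim x)
    have "enn2real (ennreal (norm (f x))) \<le> enn2real ?e" by (rule enn2real_mono[OF elim]) (use fin in simp)
    then show ?case by (simp add: Lnorm_def)
  qed
  then have "AE x in lborel. x \<in> \<Omega> \<longrightarrow> \<bar>f x\<bar> \<le> ?L" using \<Omega> by (simp add: AE_lebesgue_on_iff)
  with ae have b: "AE x in lborel. x \<in> \<Omega> \<longrightarrow> \<bar>f0 x\<bar> \<le> ?L" by eventually_elim auto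
  have L0: "?L \<ge> 0" by (simp add: Lnorm_def)
  show "integrable lborel (\<lambda>x. indicator K x *\<^sub>R \<bar>f0 x\<bar>)" if K: "compact K" "K \<subseteq> \<Omega>" for K
  proof (rule Bochner_Integration.integrable_bound[OF integrable_indicator_compact[OF K(1), of ?L]])
    have [measurable]: "K \<in> sets borel" using K(1) by (simp add: compact_imp_closed)
    show "(\<lambda>x. indicator K x *\<^sub>R \<bar>f0 x\<bar>) \<in> borel_measurable lborel" by measurable
    show "AE x in lborel. norm (indicator K x *\<^sub>R \<bar>f0 x\<bar>) \<le> norm (indicator K x * ?L)"
      using b by eventually_elim (use K L0 in \<open>auto simp: indicator_def\<close>)
  qed
  assume R: "R > 0" "cball z R \<subseteq> \<Omega>"
  have "(LBINT x. indicator (cball z R) x *\<^sub>R \<bar>f0 x\<bar>) \<le> (LBINT x. indicator (cball z R) x * ?L)"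
  proof (rule integral_mono_AE'[OF integrable_cball_const])
    show "AE x in lborel. indicator (cball z R) x *\<^sub>R \<bar>f0 x\<bar> \<le> indicator (cball z R) x * ?L"
      using b by eventually_elim (use R in \<open>auto simp: indicator_def\<close>)
  qed (use L0 in auto)
  also have "\<dots> = (?L * unit_ball_vol (real CARD('n))) * R powr (real CARD('n))"
    using R by (simp add: measure_cball_eq)
  finally show "(LBINT x. indicator (cball z R) x *\<^sub>R \<bar>f0 x\<bar>)
    \<le> (?L * unit_ball_vol (real CARD('n))) * R powr (real CARD('n))" .
qed

text \<open>\<open>le_powr_split\<close> at the level \<open>R powr (- N / q)\<close> gives both
  terms the same power of \<open>R\<close>, with loss \<open>N / q\<close> as in Hoelder's
  inequality; the constant becomes a sum instead of a product.\<close>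

lemma source_estimate_finite:
  fixes f :: "real^'n \<Rightarrow> real"
  assumes \<Omega>: "open \<Omega>" and q: "q \<ge> 1" and f: "f \<in> Lspace \<Omega> (ennreal q)"
    and f0[measurable]: "f0 \<in> borel_measurable borel" and ae: "AE x in lborel. x \<in> \<Omega> \<longrightarrow> f x = f0 x"
  shows "R > 0 \<Longrightarrow> cball z R \<subseteq> \<Omega> \<Longrightarrow> (LBINT x. indicator (cball z R) x *\<^sub>R \<bar>f0 x\<bar>)
    \<le> (Lnorm \<Omega> (ennreal q) f powr q + unit_ball_vol (real CARD('n))) * R powr (real CARD('n) - real CARD('n) / q)"
    and "compact K \<Longrightarrow> K \<subseteq> \<Omega> \<Longrightarrow> integrable lborel (\<lambda>x. indicator K x *\<^sub>R \<bar>f0 x\<bar>)"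
proof -
  let ?N = "real CARD('n)" and ?V = "unit_ball_vol (real CARD('n))"
  have \<Omega>b[measurable]: "\<Omega> \<in> sets borel" using \<Omega> by simp
  have fm[measurable]: "f \<in> borel_measurable (lebesgue_on \<Omega>)"
    and fi: "integrable (lebesgue_on \<Omega>) (\<lambda>x. norm (f x) powr q)"
    using f q by (auto simp: Lspace_def)
  have aeq: "AE x in lborel. x \<in> \<Omega> \<longrightarrow> norm (f x) powr q = \<bar>f0 x\<bar> powr q"
    using ae by eventually_elim auto
  have m1: "(\<lambda>x. norm (f x) powr q) \<in> borel_measurable (lebesgue_on \<Omega>)" by measurable
  have m2: "(\<lambda>x. \<bar>f0 x\<bar> powr q) \<in> borel_measurable borel" by measurable
  have iq: "integrable lborel (\<lambda>x. indicator \<Omega> x * \<bar>f0 x\<bar> powr q)"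
    using fi integrable_lebesgue_on_transfer[OF \<Omega>b m1 m2 aeq] by simp
  have I: "(LBINT x. indicator \<Omega> x * \<bar>f0 x\<bar> powr q) = Lnorm \<Omega> (ennreal q) f powr q"
  proof -
    have "(\<integral>x. norm (f x) powr q \<partial>lebesgue_on \<Omega>) = (LBINT x. indicator \<Omega> x * \<bar>f0 x\<bar> powr q)"
      using integral_lebesgue_on_transfer[OF \<Omega>b m1 m2 aeq] by simp
    moreover have "(\<integral>x. norm (f x) powr q \<partial>lebesgue_on \<Omega>) \<ge> 0" by simp
    ultimately show ?thesis using q by (simp add: Lnorm_def powr_powr)
  qed
  have split: "indicator K x * \<bar>f0 x\<bar> \<le> k powr (1 - q) * (indicator \<Omega> x * \<bar>f0 x\<bar> powr q) + indicator K x * k"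
    if "K \<subseteq> \<Omega>" "k > 0" for K k x
    using le_powr_split[of "\<bar>f0 x\<bar>" k q] that q by (auto simp: indicator_def)
  show "integrable lborel (\<lambda>x. indicator K x *\<^sub>R \<bar>f0 x\<bar>)" if K: "compact K" "K \<subseteq> \<Omega>" for K
  proof -
    have [measurable]: "K \<in> sets borel" using K(1) by (simp add: compact_imp_closed)
    have "integrable lborel (\<lambda>x. 1 powr (1 - q) * (indicator \<Omega> x * \<bar>f0 x\<bar> powr q) + indicator K x * 1)"
      by (intro Bochner_Integration.integrable_add integrable_mult_right iq integrable_indicator_compact K)
    then show ?thesis
      by (rule integrable_le) (use split[OF K(2), of 1] in auto)
  qed
  assume R: "R > 0" "cball z R \<subseteq> \<Omega>"
  define k where "k = R powr (- ?N / q)"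
  have k: "k > 0" using R by (simp add: k_def)
  have "(LBINT x. indicator (cball z R) x *\<^sub>R \<bar>f0 x\<bar>)
     \<le> (LBINT x. k powr (1 - q) * (indicator \<Omega> x * \<bar>f0 x\<bar> powr q) + indicator (cball z R) x * k)"
  proof (rule integral_mono_AE')
    show "integrable lborel (\<lambda>x. k powr (1 - q) * (indicator \<Omega> x * \<bar>f0 x\<bar> powr q) + indicator (cball z R) x * k)"
      by (intro Bochner_Integration.integrable_add integrable_mult_right iq integrable_cball_const)
  qed (use split[OF R(2) k] k in auto)
  also have "\<dots> = k powr (1 - q) * (Lnorm \<Omega> (ennreal q) f powr q) + ?V * R powr ?N * k"
    using iq integrable_cball_const[of z R k] R by (simp add: I measure_cball_eq)
  also have "k powr (1 - q) = R powr (?N - ?N / q)"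
  proof -
    have "- ?N / q * (1 - q) = ?N - ?N / q" using q by (simp add: field_simps)
    then show ?thesis unfolding k_def powr_powr by simp
  qed
  also have "?V * R powr ?N * k = ?V * R powr (?N - ?N / q)"
    unfolding k_def using R by (simp add: powr_diff powr_minus_divide)
  finally show "(LBINT x. indicator (cball z R) x *\<^sub>R \<bar>f0 x\<bar>)
    \<le> (Lnorm \<Omega> (ennreal q) f powr q + ?V) * R powr (?N - ?N / q)"
    by (simp add: algebra_simps)
qed

text \<open>Take \<open>s = N / q\<close>, or \<open>0\<close> for infinite \<open>q\<close>; then
  \<open>s < p\<close> is the assumption on \<open>q\<close>. The source enters \<open>F\<close>
  only through its norm \<open>L\<close>, so \<open>s\<close> and \<open>F\<close> can be fixed
  before \<open>f\<close>.\<close>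

lemma source_estimate:
  fixes \<Omega> :: "(real^'n) set"
  assumes \<Omega>: "open \<Omega>" and p: "p > 0" and q: "q \<ge> 1" "q > ennreal (real CARD('n) / p)" and L: "L \<ge> 0"
  shows "\<exists>s F. s < p \<and> 0 \<le> F \<and> (\<forall>f f0. f \<in> Lspace \<Omega> q \<and> Lnorm \<Omega> q f = L \<and> f0 \<in> borel_measurable borel \<and>
      (AE x in lborel. x \<in> \<Omega> \<longrightarrow> f x = f0 x) \<longrightarrow>
      (\<forall>z R. 0 < R \<and> R \<le> 1 \<and> cball z R \<subseteq> \<Omega> \<longrightarrow>
         (LBINT x. indicator (cball z R) x *\<^sub>R \<bar>f0 x\<bar>) \<le> F * R powr (real CARD('n) - s)) \<and>
      (\<forall>K. compact K \<and> K \<subseteq> \<Omega> \<longrightarrow> integrable lborel (\<lambda>x. indicator K x *\<^sub>R \<bar>f0 x\<bar>)))"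
proof (cases "q = \<infinity>")
  case True
  have "0 \<le> L * unit_ball_vol (real CARD('n))" using L by simp
  then show ?thesis
    using p source_estimate_infinity[OF \<Omega>]
    by (rule_tac exI[of _ 0], rule_tac exI[of _ "L * unit_ball_vol (real CARD('n))"]) (auto simp: True)
next
  case False
  then obtain r where r: "q = ennreal r" "r \<ge> 0" by (cases q) auto
  have r1: "r \<ge> 1" using q(1) r by (metis ennreal_1 ennreal_le_iff)
  have "real CARD('n) / p < r" using q(2) r p by (simp add: ennreal_less_iff)
  then have s: "real CARD('n) / r < p" using p r1 by (simp add: field_simps)
  show ?thesis
  proof (rule exI[of _ "real CARD('n) / r"], rule exI[of _ "L powr r + unit_ball_vol (real CARD('n))"],
      intro conjI s allI impI)
    show "0 \<le> L powr r + unit_ball_vol (real CARD('n))" by simp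
    fix f f0 :: "real^'n \<Rightarrow> real" and z R
    assume "f \<in> Lspace \<Omega> q \<and> Lnorm \<Omega> q f = L \<and> f0 \<in> borel_measurable borel \<and> (AE x in lborel. x \<in> \<Omega> \<longrightarrow> f x = f0 x)"
      and "0 < R \<and> R \<le> 1 \<and> cball z R \<subseteq> \<Omega>"
    then show "(LBINT x. indicator (cball z R) x *\<^sub>R \<bar>f0 x\<bar>)
        \<le> (L powr r + unit_ball_vol (real CARD('n))) * R powr (real CARD('n) - real CARD('n) / r)"
      using source_estimate_finite(1)[OF \<Omega> r1, of f f0 R z] by (auto simp: r)
  next
    fix f f0 :: "real^'n \<Rightarrow> real" and K
    assume a: "f \<in> Lspace \<Omega> q \<and> Lnorm \<Omega> q f = L \<and> f0 \<in> borel_measurable borel \<and> (AE x in lborel. x \<in> \<Omega> \<longrightarrow> f x = f0 x)"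
      and K: "compact K \<and> K \<subseteq> \<Omega>"
    show "integrable lborel (\<lambda>x. indicator K x *\<^sub>R \<bar>f0 x\<bar>)"
      using source_estimate_finite(2)[OF \<Omega> r1, of f f0 K] a K by (auto simp: r)
  qed
qed

text \<open>The structure conditions hold off a null set that may depend on
  \<open>(s, \<xi>)\<close>, but the flux is evaluated at arguments varying with \<open>x\<close>. A
  countable dense set of arguments yields one null set, and continuity extends the inequality to all
  arguments.\<close>

lemma AE_all_nonneg_of_continuous:
  fixes g :: "'x \<Rightarrow> 'c::second_countable_topology \<Rightarrow> real"
  assumes c: "AE x in M. continuous_on UNIV (g x)" and P: "\<And>d. AE x in M. 0 \<le> g x d"
  shows "AE x in M. \<forall>d. 0 \<le> g x d"
proof -
  obtain D :: "'c set" where D: "countable D" "\<And>X. open X \<Longrightarrow> X \<noteq> {} \<Longrightarrow> \<exists>d\<in>D. d \<in> X"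
    using countable_dense_exists[where 'a='c] by blast
  have "AE x in M. \<forall>d\<in>D. 0 \<le> g x d" using D(1) P by (intro AE_ball_countable') auto
  with c show ?thesis
  proof eventually_elim
    case (elim x)
    have "open {d. g x d < 0}" by (rule open_Collect_less[OF elim(1) continuous_on_const])
    then have "{d. g x d < 0} = {}" using D(2) elim(2) by (metis (mono_tags, lifting) mem_Collect_eq not_less)
    then show ?case by (auto simp: not_less)
  qed
qed

lemma caratheodory_AE_growth:
  fixes a :: "real^'n \<Rightarrow> real \<Rightarrow> real^'n \<Rightarrow> real^'n"
  assumes "caratheodory \<Omega> a" "\<And>s \<xi>. AE x in lebesgue_on \<Omega>. norm (a x s \<xi>) \<le> \<beta> * (1 + norm \<xi>)"
  shows "AE x in lebesgue_on \<Omega>. \<forall>s \<xi>. norm (a x s \<xi>) \<le> \<beta> * (1 + norm \<xi>)"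
proof -
  have "AE x in lebesgue_on \<Omega>. \<forall>d. 0 \<le> \<beta> * (1 + norm (snd d)) - norm (a x (fst d) (snd d))"
  proof (rule AE_all_nonneg_of_continuous)
    have "AE x in lebesgue_on \<Omega>. continuous_on UNIV (\<lambda>(s, \<xi>). a x s \<xi>)"
      using assms(1) by (simp add: caratheodory_def)
    then show "AE x in lebesgue_on \<Omega>. continuous_on UNIV (\<lambda>d. \<beta> * (1 + norm (snd d)) - norm (a x (fst d) (snd d)))"
      by eventually_elim (auto intro!: continuous_intros simp: case_prod_beta')
    show "AE x in lebesgue_on \<Omega>. 0 \<le> \<beta> * (1 + norm (snd d)) - norm (a x (fst d) (snd d))" for d
      using assms(2)[of "fst d" "snd d"] by eventually_elim simp
  qed
  then show ?thesis by eventually_elim force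
qed

lemma caratheodory_AE_monotone:
  fixes a :: "real^'n \<Rightarrow> real \<Rightarrow> real^'n \<Rightarrow> real^'n"
  assumes "caratheodory \<Omega> a" "\<And>s \<xi>. AE x in lebesgue_on \<Omega>. 0 \<le> a x s \<xi> \<bullet> \<xi>"
  shows "AE x in lebesgue_on \<Omega>. \<forall>s \<xi>. 0 \<le> a x s \<xi> \<bullet> \<xi>"
proof -
  have "AE x in lebesgue_on \<Omega>. \<forall>d. 0 \<le> a x (fst d) (snd d) \<bullet> snd d"
  proof (rule AE_all_nonneg_of_continuous)
    have "AE x in lebesgue_on \<Omega>. continuous_on UNIV (\<lambda>(s, \<xi>). a x s \<xi>)"
      using assms(1) by (simp add: caratheodory_def)
    then show "AE x in lebesgue_on \<Omega>. continuous_on UNIV (\<lambda>d. a x (fst d) (snd d) \<bullet> snd d)"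
      by eventually_elim (auto intro!: continuous_intros simp: case_prod_beta')
    show "AE x in lebesgue_on \<Omega>. 0 \<le> a x (fst d) (snd d) \<bullet> snd d" for d by (rule assms(2))
  qed
  then show ?thesis by eventually_elim force
qed

text \<open>The flux \<open>a x (u x) (weak_grad \<Omega> u x)\<close> need not be shown to be measurable: if its product with
  \<open>grad \<phi>\<close> is not integrable then the integral is \<open>0\<close>, and the bound by \<open>h\<close> still holds.\<close>

lemma subsolution_representative:
  fixes \<Omega> :: "(real^'n) set" and u u0 f f0 :: "real^'n \<Rightarrow> real" and G0 :: "real^'n \<Rightarrow> real^'n"
  assumes \<Omega>: "open \<Omega>" and sub: "subsolution \<Omega> a lam p f u"
    and um: "u \<in> borel_measurable (lebesgue_on \<Omega>)" and Gm: "weak_grad \<Omega> u \<in> borel_measurable (lebesgue_on \<Omega>)"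
    and fm: "f \<in> borel_measurable (lebesgue_on \<Omega>)"
    and u0: "u0 \<in> borel_measurable borel" "AE x in lborel. x \<in> \<Omega> \<longrightarrow> u x = u0 x"
    and G0: "G0 \<in> borel_measurable borel" "AE x in lborel. x \<in> \<Omega> \<longrightarrow> weak_grad \<Omega> u x = G0 x"
    and f0: "f0 \<in> borel_measurable borel" "AE x in lborel. x \<in> \<Omega> \<longrightarrow> f x = f0 x"
    and f0i: "\<And>K. compact K \<Longrightarrow> K \<subseteq> \<Omega> \<Longrightarrow> integrable lborel (\<lambda>x. indicator K x *\<^sub>R \<bar>f0 x\<bar>)"
    and \<phi>: "\<phi> \<in> test_functions \<Omega>" "\<And>x. 0 \<le> \<phi> x" and h: "integrable lborel h" "\<And>x. 0 \<le> h x"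
    and le: "AE x in lborel. x \<in> \<Omega> \<longrightarrow> - (a x (u x) (weak_grad \<Omega> u x) \<bullet> grad \<phi> x) \<le> h x"
  shows "(LBINT x. \<phi> x * norm (G0 x) powr p) + lam * (LBINT x. \<phi> x * u0 x)
       \<le> (LBINT x. \<phi> x * \<bar>f0 x\<bar>) + (LBINT x. h x)"
proof -
  have \<Omega>b[measurable]: "\<Omega> \<in> sets borel" using \<Omega> by simp
  note [measurable] = um Gm fm u0(1) G0(1) f0(1)
  from test_function_bounds[OF \<phi>(1)] obtain K B where K: "compact K" "K \<subseteq> \<Omega>" "\<forall>x. x \<notin> K \<longrightarrow> \<phi> x = 0"
      and B: "\<forall>x. \<bar>\<phi> x\<bar> \<le> B" and [measurable]: "\<phi> \<in> borel_measurable borel"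
    by (elim exE conjE) (rule that)
  have [measurable]: "\<phi> \<in> borel_measurable (lebesgue_on \<Omega>)" by (rule borel_measurable_lebesgue_on) measurable
  have ind: "indicator \<Omega> x *\<^sub>R (\<phi> x * r) = \<phi> x * r" for x r
    using K by (auto simp: indicator_def)
  have Iu: "(\<integral>x. u x * \<phi> x \<partial>lebesgue_on \<Omega>) = (LBINT x. \<phi> x * u0 x)"
  proof -
    have "(\<integral>x. u x * \<phi> x \<partial>lebesgue_on \<Omega>) = (LBINT x. indicator \<Omega> x *\<^sub>R (\<phi> x * u0 x))"
      by (rule integral_lebesgue_on_transfer[OF \<Omega>b]) (use u0(2) in \<open>auto elim!: eventually_mono\<close>)
    then show ?thesis by (simp only: ind)
  qed
  have IG: "(\<integral>x. norm (weak_grad \<Omega> u x) powr p * \<phi> x \<partial>lebesgue_on \<Omega>) = (LBINT x. \<phi> x * norm (G0 x) powr p)"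
  proof -
    have "(\<integral>x. norm (weak_grad \<Omega> u x) powr p * \<phi> x \<partial>lebesgue_on \<Omega>) = (LBINT x. indicator \<Omega> x *\<^sub>R (\<phi> x * norm (G0 x) powr p))"
      by (rule integral_lebesgue_on_transfer[OF \<Omega>b]) (use G0(2) in \<open>auto elim!: eventually_mono\<close>)
    then show ?thesis by (simp only: ind)
  qed
  have If: "(\<integral>x. f x * \<phi> x \<partial>lebesgue_on \<Omega>) \<le> (LBINT x. \<phi> x * \<bar>f0 x\<bar>)"
  proof -
    have "(\<integral>x. f x * \<phi> x \<partial>lebesgue_on \<Omega>) = (LBINT x. indicator \<Omega> x *\<^sub>R (\<phi> x * f0 x))"
      by (rule integral_lebesgue_on_transfer[OF \<Omega>b]) (use f0(2) in \<open>auto elim!: eventually_mono\<close>)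
    also have "\<dots> = (LBINT x. \<phi> x * f0 x)" by (simp only: ind)
    also have "\<dots> \<le> (LBINT x. \<phi> x * \<bar>f0 x\<bar>)"
    proof (rule integral_mono_AE')
      have "integrable lborel (\<lambda>x. \<phi> x *\<^sub>R \<bar>f0 x\<bar>)"
        by (rule integrable_bounded_mult[OF f0i[OF K(1,2)]]) (use K B in auto)
      then show "integrable lborel (\<lambda>x. \<phi> x * \<bar>f0 x\<bar>)" by simp
    qed (use \<phi>(2) in \<open>auto intro!: AE_I2 mult_left_mono\<close>)
    finally show ?thesis .
  qed
  have hm[measurable]: "h \<in> borel_measurable borel" using h(1) by auto
  have hint: "integrable lborel (\<lambda>x. indicator \<Omega> x *\<^sub>R h x)"
    by (rule integrable_le[OF h(1)]) (use h(2) in \<open>auto simp: indicator_def\<close>)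
  have hm': "h \<in> borel_measurable (lebesgue_on \<Omega>)" by (rule borel_measurable_lebesgue_on[OF hm])
  have "- (\<integral>x. a x (u x) (weak_grad \<Omega> u x) \<bullet> grad \<phi> x \<partial>lebesgue_on \<Omega>)
     = (\<integral>x. - (a x (u x) (weak_grad \<Omega> u x) \<bullet> grad \<phi> x) \<partial>lebesgue_on \<Omega>)" by simp
  also have "\<dots> \<le> (\<integral>x. h x \<partial>lebesgue_on \<Omega>)"
  proof (rule integral_mono_AE')
    show "integrable (lebesgue_on \<Omega>) h"
      using hint integrable_lebesgue_on_transfer[OF \<Omega>b hm' hm] by simp
    show "AE x in lebesgue_on \<Omega>. - (a x (u x) (weak_grad \<Omega> u x) \<bullet> grad \<phi> x) \<le> h x"
      using le by (simp add: AE_lebesgue_on_iff[OF \<Omega>b])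
  qed (use h(2) in auto)
  also have "\<dots> = (LBINT x. indicator \<Omega> x *\<^sub>R h x)"
    by (rule integral_lebesgue_on_transfer[OF \<Omega>b hm' hm]) simp
  also have "\<dots> \<le> (LBINT x. h x)"
    by (rule integral_mono[OF hint h(1)]) (use h(2) in \<open>auto simp: indicator_def\<close>)
  finally have Ia: "- (\<integral>x. a x (u x) (weak_grad \<Omega> u x) \<bullet> grad \<phi> x \<partial>lebesgue_on \<Omega>) \<le> (LBINT x. h x)" .
  have "(\<integral>x. a x (u x) (weak_grad \<Omega> u x) \<bullet> grad \<phi> x \<partial>lebesgue_on \<Omega>)
        + lam * (\<integral>x. u x * \<phi> x \<partial>lebesgue_on \<Omega>)
        + (\<integral>x. norm (weak_grad \<Omega> u x) powr p * \<phi> x \<partial>lebesgue_on \<Omega>)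
        \<le> (\<integral>x. f x * \<phi> x \<partial>lebesgue_on \<Omega>)"
    using sub \<phi> by (simp add: subsolution_def)
  then show ?thesis using Ia If unfolding Iu IG by linarith
qed

text \<open>The hypotheses on the triple \<open>(a, f, u)\<close>, over which the bound has to be
  uniform once the other data are fixed.\<close>

definition admissible ::
  "(real^'n) set \<Rightarrow> real \<Rightarrow> real \<Rightarrow> real \<Rightarrow> ennreal \<Rightarrow> (real^'n \<Rightarrow> real \<Rightarrow> real^'n \<Rightarrow> real^'n) \<Rightarrow>
    (real^'n \<Rightarrow> real) \<Rightarrow> (real^'n \<Rightarrow> real) \<Rightarrow> bool" where
  "admissible \<Omega> \<beta> p lam q a f u \<longleftrightarrow> caratheodory \<Omega> a \<and>
    (\<forall>s \<xi>. AE x in lebesgue_on \<Omega>. norm (a x s \<xi>) \<le> \<beta> * (1 + norm \<xi>)) \<and>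
    f \<in> Lspace \<Omega> q \<and> u \<in> W1_loc \<Omega> p \<and> subsolution \<Omega> a lam p f u \<and>
    ((\<forall>s \<xi>. AE x in lebesgue_on \<Omega>. a x s \<xi> \<bullet> \<xi> \<ge> 0) \<or> (AE x in lebesgue_on \<Omega>. u x \<ge> 0))"

text \<open>Under the sign condition \<open>w\<close> is \<open>soft_pos\<close> of
  \<open>u\<close>, and \<open>u \<le> 1 + w\<close> is \<open>soft_pos_ge\<close>. If
  \<open>u\<close> is nonnegative then \<open>w\<close> is \<open>u\<close> itself, and the flux is
  estimated by its growth alone. The source estimate is assumed for every Borel representative
  because one is chosen only inside the proof.\<close>

lemma admissible_energy:
  fixes u f :: "real^'n \<Rightarrow> real"
  assumes \<Omega>: "open \<Omega>" and \<beta>: "\<beta> > 0" and p: "p > 2" and lam: "lam > 0"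
    and adm: "admissible \<Omega> \<beta> p lam q a f u"
    and src: "\<And>f0. f0 \<in> borel_measurable borel \<Longrightarrow> (AE x in lborel. x \<in> \<Omega> \<longrightarrow> f x = f0 x) \<Longrightarrow>
      (\<forall>z R. 0 < R \<and> R \<le> 1 \<and> cball z R \<subseteq> \<Omega> \<longrightarrow>
         (LBINT x. indicator (cball z R) x *\<^sub>R \<bar>f0 x\<bar>) \<le> F * R powr (real CARD('n) - s)) \<and>
      (\<forall>K. compact K \<and> K \<subseteq> \<Omega> \<longrightarrow> integrable lborel (\<lambda>x. indicator K x *\<^sub>R \<bar>f0 x\<bar>))"
  shows "u \<in> borel_measurable (lebesgue_on \<Omega>) \<and>
    (\<exists>f0 w W. energy \<Omega> \<beta> lam p s F f0 w W \<and> (AE x in lborel. x \<in> \<Omega> \<longrightarrow> u x \<le> 1 + w x))"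
proof -
  have \<Omega>b: "\<Omega> \<in> sets borel" using \<Omega> by simp
  define G where "G = weak_grad \<Omega> u"
  have car: "caratheodory \<Omega> a" and gr: "\<And>s \<xi>. AE x in lebesgue_on \<Omega>. norm (a x s \<xi>) \<le> \<beta> * (1 + norm \<xi>)"
    and f: "f \<in> Lspace \<Omega> q" and u: "u \<in> W1_loc \<Omega> p" and sub: "subsolution \<Omega> a lam p f u"
    and alt: "(\<forall>s \<xi>. AE x in lebesgue_on \<Omega>. a x s \<xi> \<bullet> \<xi> \<ge> 0) \<or> (AE x in lebesgue_on \<Omega>. u x \<ge> 0)"
    using adm unfolding admissible_def by blast+
  have wg: "has_weak_gradient \<Omega> u G"
    using u someI_ex[of "has_weak_gradient \<Omega> u"] unfolding W1_loc_def G_def weak_grad_def by blast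
  have um: "u \<in> borel_measurable (lebesgue_on \<Omega>)" and Gm: "G \<in> borel_measurable (lebesgue_on \<Omega>)"
    using wg unfolding has_weak_gradient_def Lspace_loc_def Lspace_def
    by (auto intro!: measurable_lebesgue_on_open[OF \<Omega>])
  have fm: "f \<in> borel_measurable (lebesgue_on \<Omega>)" using f by (simp add: Lspace_def)
  obtain u0 where u0: "u0 \<in> borel_measurable borel" "AE x in lborel. x \<in> \<Omega> \<longrightarrow> u x = u0 x"
    using borel_representative_real[OF \<Omega>b um] by blast
  obtain f0 where f0: "f0 \<in> borel_measurable borel" "AE x in lborel. x \<in> \<Omega> \<longrightarrow> f x = f0 x"
    using borel_representative_real[OF \<Omega>b fm] by blast
  obtain G0 where G0: "G0 \<in> borel_measurable borel" "AE x in lborel. x \<in> \<Omega> \<longrightarrow> G x = G0 x"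
    using borel_representative_vec[OF \<Omega>b Gm] by blast
  note [measurable] = u0(1) f0(1) G0(1)
  have fF: "0 < R \<Longrightarrow> R \<le> 1 \<Longrightarrow> cball z R \<subseteq> \<Omega> \<Longrightarrow>
         (LBINT x. indicator (cball z R) x *\<^sub>R \<bar>f0 x\<bar>) \<le> F * R powr (real CARD('n) - s)"
    and fi: "compact K \<Longrightarrow> K \<subseteq> \<Omega> \<Longrightarrow> integrable lborel (\<lambda>x. indicator K x *\<^sub>R \<bar>f0 x\<bar>)" for z R K
    using src[OF f0] by blast+
  have Gp: "integrable lborel (\<lambda>x. indicator K x *\<^sub>R (norm (G0 x) powr p))" if K: "compact K" "K \<subseteq> \<Omega>" for K
  proof -
    have Kb: "K \<in> sets borel" using K(1) by (simp add: compact_imp_closed)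
    have "G \<in> Lspace K (ennreal p)" using u K unfolding W1_loc_def Lspace_loc_def G_def by blast
    then have m[measurable]: "G \<in> borel_measurable (lebesgue_on K)" and i: "integrable (lebesgue_on K) (\<lambda>x. norm (G x) powr p)"
      using p by (auto simp: Lspace_def)
    have ae: "AE x in lborel. x \<in> K \<longrightarrow> norm (G x) powr p = norm (G0 x) powr p"
      using G0(2) by eventually_elim (use K(2) in auto)
    have m': "(\<lambda>x. norm (G x) powr p) \<in> borel_measurable (lebesgue_on K)"
      "(\<lambda>x. norm (G0 x) powr p) \<in> borel_measurable borel" by measurable
    show ?thesis
      using i integrable_lebesgue_on_transfer[OF Kb m' ae] by blast
  qed
  have growth: "AE x in lborel. x \<in> \<Omega> \<longrightarrow> norm (a x (u x) (G x)) \<le> \<beta> * (1 + norm (G0 x))"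
  proof -
    have "AE x in lborel. x \<in> \<Omega> \<longrightarrow> (\<forall>s \<xi>. norm (a x s \<xi>) \<le> \<beta> * (1 + norm \<xi>))"
      using caratheodory_AE_growth[OF car gr] by (simp add: AE_lebesgue_on_iff[OF \<Omega>b])
    with G0(2) show ?thesis by eventually_elim auto
  qed
  \<comment> \<open>The representative \<open>u1\<close> is left open because the two alternatives
    work with different ones.\<close>
  have sub': "(LBINT x. \<phi> x * norm (G0 x) powr p) + lam * (LBINT x. \<phi> x * u1 x)
       \<le> (LBINT x. \<phi> x * \<bar>f0 x\<bar>) + (LBINT x. h x)"
    if u1: "u1 \<in> borel_measurable borel" "AE x in lborel. x \<in> \<Omega> \<longrightarrow> u x = u1 x"
      and \<phi>: "\<phi> \<in> test_functions \<Omega>" "\<And>x. 0 \<le> \<phi> x" and h: "integrable lborel h" "\<And>x. 0 \<le> h x"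
      and le: "AE x in lborel. x \<in> \<Omega> \<longrightarrow> - (a x (u x) (G x) \<bullet> grad \<phi> x) \<le> h x"
    for u1 \<phi> h
  proof (rule subsolution_representative[OF \<Omega> sub um _ fm u1 G0(1) _ f0])
    show "integrable lborel (\<lambda>x. indicator K x *\<^sub>R \<bar>f0 x\<bar>)" if "compact K" "K \<subseteq> \<Omega>" for K
      using that by (rule fi)
  qed (use \<phi> h le Gm G0(2) in \<open>simp_all add: G_def\<close>)
  show ?thesis
  proof (intro conjI um)
    show "\<exists>f0 w W. energy \<Omega> \<beta> lam p s F f0 w W \<and> (AE x in lborel. x \<in> \<Omega> \<longrightarrow> u x \<le> 1 + w x)"
      using alt
    proof
      assume "\<forall>s \<xi>. AE x in lebesgue_on \<Omega>. a x s \<xi> \<bullet> \<xi> \<ge> 0"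
      then have mono: "AE x in lborel. x \<in> \<Omega> \<longrightarrow> (\<forall>s \<xi>. 0 \<le> a x s \<xi> \<bullet> \<xi>)"
        using caratheodory_AE_monotone[OF car] by (simp add: AE_lebesgue_on_iff[OF \<Omega>b])
      have \<alpha>: "AE x in lborel. x \<in> \<Omega> \<longrightarrow> norm (a x (u x) (G x)) \<le> \<beta> * (1 + norm (G0 x)) \<and> 0 \<le> a x (u x) (G x) \<bullet> G0 x"
        using mono growth G0(2) by eventually_elim auto
      have wp: "weak_pair \<Omega> u0 G0" by (rule weak_pair_representative[OF \<Omega> wg u0 G0 um Gm])
      have G2: "integrable lborel (\<lambda>x. indicator K x * (norm (G0 x))\<^sup>2)" if K: "compact K" "K \<subseteq> \<Omega>" for K
        by (rule integrable_indicator_square[OF K(1) G0(1) _ Gp[OF K]]) (use p in simp)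
      have Wp: "integrable lborel (\<lambda>x. indicator K x *\<^sub>R (norm (soft_step (u0 x) *\<^sub>R G0 x) powr p))" if K: "compact K" "K \<subseteq> \<Omega>" for K
      proof (rule integrable_le[OF Gp[OF K]])
        have [measurable]: "K \<in> sets borel" using K(1) by (simp add: compact_imp_closed)
        show "(\<lambda>x. indicator K x *\<^sub>R (norm (soft_step (u0 x) *\<^sub>R G0 x) powr p)) \<in> borel_measurable lborel" by measurable
        have "norm (soft_step (u0 x) *\<^sub>R G0 x) powr p \<le> norm (G0 x) powr p" for x
          using soft_step_nonneg[of "u0 x"] soft_step_le_1[of "u0 x"] p
          by (intro powr_mono2) (auto intro: mult_left_le_one_le)
        then show "norm (indicator K x *\<^sub>R (norm (soft_step (u0 x) *\<^sub>R G0 x) powr p)) \<le> indicator K x *\<^sub>R (norm (G0 x) powr p)" for x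
          by (auto simp: indicator_def simp del: norm_scaleR)
      qed
      have "energy \<Omega> \<beta> lam p s F f0 (\<lambda>x. soft_pos (u0 x)) (\<lambda>x. soft_step (u0 x) *\<^sub>R G0 x)"
        unfolding energy_def
      proof (intro conjI allI ballI impI)
        show "weak_pair \<Omega> (\<lambda>x. soft_pos (u0 x)) (\<lambda>x. soft_step (u0 x) *\<^sub>R G0 x)"
          by (rule soft_pos_weak_pair[OF wp \<Omega> G2])
        show "0 \<le> soft_pos (u0 x)" for x by (rule soft_pos_nonneg)
        fix \<phi> assume \<phi>: "\<phi> \<in> test_functions \<Omega>" "\<forall>x. 0 \<le> \<phi> x"
        show "(LBINT x. \<phi> x * norm (soft_step (u0 x) *\<^sub>R G0 x) powr p) + lam * (LBINT x. \<phi> x * soft_pos (u0 x))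
          \<le> (LBINT x. \<phi> x * \<bar>f0 x\<bar>) + \<beta> * (LBINT x. norm (grad \<phi> x) * (1 + norm (soft_step (u0 x) *\<^sub>R G0 x)))"
          by (rule soft_pos_energy[OF wp \<Omega> p \<beta> lam Gp f0(1) fi \<alpha> sub'[OF u0] \<phi>(1)]) (use \<phi>(2) in auto)
      qed (use fi fF Wp f0(1) in auto)
      moreover have "AE x in lborel. x \<in> \<Omega> \<longrightarrow> u x \<le> 1 + soft_pos (u0 x)"
        using u0(2)
      proof eventually_elim
        case (elim x)
        then show ?case using soft_pos_ge[of "u0 x"] by auto
      qed
      ultimately show ?thesis by blast
    next
      assume "AE x in lebesgue_on \<Omega>. u x \<ge> 0"
      then have nn: "AE x in lborel. x \<in> \<Omega> \<longrightarrow> 0 \<le> u x" by (simp add: AE_lebesgue_on_iff[OF \<Omega>b])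
      \<comment> \<open>\<open>energy\<close> demands nonnegativity at every point, while
        \<open>u\<close> is nonnegative only almost everywhere.\<close>
      define u1 where "u1 x = max (u0 x) 0" for x
      have u1: "u1 \<in> borel_measurable borel" "AE x in lborel. x \<in> \<Omega> \<longrightarrow> u x = u1 x"
      proof -
        show "u1 \<in> borel_measurable borel" unfolding u1_def[abs_def] by measurable
        show "AE x in lborel. x \<in> \<Omega> \<longrightarrow> u x = u1 x"
          using nn u0(2) by eventually_elim (auto simp: u1_def)
      qed
      have wp: "weak_pair \<Omega> u1 G0" by (rule weak_pair_representative[OF \<Omega> wg u1 G0 um Gm])
      have "energy \<Omega> \<beta> lam p s F f0 u1 G0"
        unfolding energy_def
      proof (intro conjI allI ballI impI)
        show "weak_pair \<Omega> u1 G0" by (rule wp)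
        show "0 \<le> u1 x" for x by (simp add: u1_def)
        fix \<phi> assume \<phi>: "\<phi> \<in> test_functions \<Omega>" "\<forall>x. 0 \<le> \<phi> x"
        from test_function_bounds[OF \<phi>(1)] obtain K B where K: "compact K" "K \<subseteq> \<Omega>" "\<forall>x. x \<notin> K \<longrightarrow> grad \<phi> x = 0"
            and B: "\<forall>x. norm (grad \<phi> x) \<le> B" and [measurable]: "grad \<phi> \<in> borel_measurable borel"
          by (elim exE conjE) (rule that)
        have i: "integrable lborel (\<lambda>x. norm (grad \<phi> x) *\<^sub>R (1 + norm (G0 x)))"
        proof (rule integrable_bounded_mult)
          have "integrable lborel (\<lambda>x. indicator K x *\<^sub>R G0 x)" using wp K by (simp add: weak_pair_def)
          from Bochner_Integration.integrable_add[OF integrable_indicator_compact[OF K(1), of 1] integrable_norm[OF this]]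
          show "integrable lborel (\<lambda>x. indicator K x *\<^sub>R (1 + norm (G0 x)))" by (simp add: distrib_left)
          show "norm (grad \<phi> x) = 0" if "x \<notin> K" for x using K(3) that by simp
          show "\<bar>norm (grad \<phi> x)\<bar> \<le> B" for x using B by simp
        qed measurable
        have "(LBINT x. \<phi> x * norm (G0 x) powr p) + lam * (LBINT x. \<phi> x * u1 x)
          \<le> (LBINT x. \<phi> x * \<bar>f0 x\<bar>) + (LBINT x. \<beta> * (norm (grad \<phi> x) *\<^sub>R (1 + norm (G0 x))))"
        proof (rule sub'[OF u1 \<phi>(1)])
          show "integrable lborel (\<lambda>x. \<beta> * (norm (grad \<phi> x) *\<^sub>R (1 + norm (G0 x))))"
            using i by (rule integrable_mult_right)
          show "AE x in lborel. x \<in> \<Omega> \<longrightarrow> - (a x (u x) (G x) \<bullet> grad \<phi> x) \<le> \<beta> * (norm (grad \<phi> x) *\<^sub>R (1 + norm (G0 x)))"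
            using growth
          proof eventually_elim
            case (elim x)
            show ?case
            proof
              assume "x \<in> \<Omega>"
              then have "norm (a x (u x) (G x)) * norm (grad \<phi> x) \<le> \<beta> * (1 + norm (G0 x)) * norm (grad \<phi> x)"
                using elim by (intro mult_right_mono) auto
              then show "- (a x (u x) (G x) \<bullet> grad \<phi> x) \<le> \<beta> * (norm (grad \<phi> x) *\<^sub>R (1 + norm (G0 x)))"
                using Cauchy_Schwarz_ineq2[of "a x (u x) (G x)" "grad \<phi> x"] by (simp add: mult_ac)
            qed
          qed
        qed (use \<phi>(2) \<beta> in auto)
        then show "(LBINT x. \<phi> x * norm (G0 x) powr p) + lam * (LBINT x. \<phi> x * u1 x)
          \<le> (LBINT x. \<phi> x * \<bar>f0 x\<bar>) + \<beta> * (LBINT x. norm (grad \<phi> x) * (1 + norm (G0 x)))"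
          by simp
      qed (use fi fF Gp f0(1) in auto)
      moreover have "AE x in lborel. x \<in> \<Omega> \<longrightarrow> u x \<le> 1 + u1 x" using u1(2) by eventually_elim auto
      ultimately show ?thesis by blast
    qed
  qed
qed

text \<open>The order of choice carries the claim: \<open>s\<close> and \<open>F\<close> come from
  the exponents, \<open>L\<close> and the dimension, then \<open>M\<close> from these and
  \<open>\<Omega>\<close>, and only afterwards \<open>a\<close>, \<open>f\<close> and
  \<open>u\<close>.\<close>

lemma admissible_bound:
  fixes \<Omega> :: "(real^'n) set"
  assumes \<Omega>: "open \<Omega>" "bounded \<Omega>" "lipschitz_boundary \<Omega>" and \<beta>: "\<beta> > 0" and p: "p > 2" and lam: "lam > 0"
    and q: "q \<ge> 1" "q > ennreal (real CARD('n) / p)" and L: "L \<ge> 0"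
  shows "\<exists>M\<ge>0. \<forall>a f u. admissible \<Omega> \<beta> p lam q a f u \<and> Lnorm \<Omega> q f = L \<longrightarrow>
    u \<in> borel_measurable (lebesgue_on \<Omega>) \<and> (AE x in lebesgue_on \<Omega>. u x \<le> M)"
proof -
  have "p > 0" using p by simp
  from source_estimate[OF \<Omega>(1) this q L] obtain s F where s: "s < p" and F: "0 \<le> F"
    and src: "\<And>f f0. f \<in> Lspace \<Omega> q \<and> Lnorm \<Omega> q f = L \<and> f0 \<in> borel_measurable borel \<and>
      (AE x in lborel. x \<in> \<Omega> \<longrightarrow> f x = f0 x) \<Longrightarrow>
      (\<forall>z R. 0 < R \<and> R \<le> 1 \<and> cball z R \<subseteq> \<Omega> \<longrightarrow>
         (LBINT x. indicator (cball z R) x *\<^sub>R \<bar>f0 x\<bar>) \<le> F * R powr (real CARD('n) - s)) \<and>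
      (\<forall>K. compact K \<and> K \<subseteq> \<Omega> \<longrightarrow> integrable lborel (\<lambda>x. indicator K x *\<^sub>R \<bar>f0 x\<bar>))"
    by blast
  obtain M where M: "\<And>f w W. energy \<Omega> \<beta> lam p s F f w (W :: real^'n \<Rightarrow> real^'n) \<Longrightarrow> AE x in lborel. x \<in> \<Omega> \<longrightarrow> w x \<le> M"
    using global_bound[OF \<Omega> \<beta> p lam F s] by blast
  show ?thesis
  \<comment> \<open>The \<open>1\<close> pays for the smooth truncation; the maximum makes the bound
    usable for the positive part.\<close>
  proof (intro exI[of _ "max 0 (1 + M)"] conjI allI impI)
    fix a f u assume A: "admissible \<Omega> \<beta> p lam q a f u \<and> Lnorm \<Omega> q f = L"
    have f: "f \<in> Lspace \<Omega> q" using A by (simp add: admissible_def)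
    have *: "u \<in> borel_measurable (lebesgue_on \<Omega>) \<and>
      (\<exists>f0 w W. energy \<Omega> \<beta> lam p s F f0 w W \<and> (AE x in lborel. x \<in> \<Omega> \<longrightarrow> u x \<le> 1 + w x))"
      by (rule admissible_energy[OF \<Omega>(1) \<beta> p lam, of q a f]) (use A f src in blast)+
    then show "u \<in> borel_measurable (lebesgue_on \<Omega>)" by blast
    from * obtain f0 w W where en: "energy \<Omega> \<beta> lam p s F f0 w W" and ae: "AE x in lborel. x \<in> \<Omega> \<longrightarrow> u x \<le> 1 + w x"
      by blast
    have "AE x in lborel. x \<in> \<Omega> \<longrightarrow> u x \<le> max 0 (1 + M)"
      using M[OF en] ae by eventually_elim auto
    then show "AE x in lebesgue_on \<Omega>. u x \<le> max 0 (1 + M)" using \<Omega>(1) by (simp add: AE_lebesgue_on_iff)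
  qed simp
qed

lemma Lspace_infinity_of_AE_le:
  fixes u :: "real^'n \<Rightarrow> real"
  assumes um: "u \<in> borel_measurable (lebesgue_on \<Omega>)" and ae: "AE x in lebesgue_on \<Omega>. u x \<le> M" and M: "M \<ge> 0"
  shows "(\<lambda>x. max (u x) 0) \<in> Lspace \<Omega> \<infinity> \<and> Lnorm \<Omega> \<infinity> (\<lambda>x. max (u x) 0) \<le> M"
proof -
  note [measurable] = um
  have "esssup (lebesgue_on \<Omega>) (\<lambda>x. ennreal (norm (max (u x) 0))) \<le> ennreal M"
  proof (rule esssup_I)
    show "(\<lambda>x. ennreal (norm (max (u x) 0))) \<in> borel_measurable (lebesgue_on \<Omega>)" by measurable
    show "AE x in lebesgue_on \<Omega>. ennreal (norm (max (u x) 0)) \<le> ennreal M"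
      using ae by eventually_elim (use M in \<open>auto intro!: ennreal_leI\<close>)
  qed
  moreover from this have "esssup (lebesgue_on \<Omega>) (\<lambda>x. ennreal (norm (max (u x) 0))) < \<infinity>"
    by (rule le_less_trans) simp
  ultimately show ?thesis
    using M enn2real_mono[of "esssup (lebesgue_on \<Omega>) (\<lambda>x. ennreal (norm (max (u x) 0)))" "ennreal M"]
    by (auto simp: Lspace_def Lnorm_def)
qed

theorem theorem1p2:
  shows "\<exists>M :: real \<Rightarrow> ennreal \<Rightarrow> real \<Rightarrow> nat \<Rightarrow> real \<Rightarrow> (real^'n) set \<Rightarrow> real \<Rightarrow> real.
    \<forall>(\<Omega> :: (real^'n) set) (a :: real^'n \<Rightarrow> real \<Rightarrow> real^'n \<Rightarrow> real^'n) (\<beta> :: real) (p :: real)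
      (lam :: real) (q :: ennreal) (f :: real^'n \<Rightarrow> real) (u :: real^'n \<Rightarrow> real).
      open \<Omega> \<and> bounded \<Omega> \<and> connected \<Omega> \<and> lipschitz_boundary \<Omega> \<and> uniform_interior_sphere \<Omega> \<and>
      caratheodory \<Omega> a \<and> \<beta> > 0 \<and>
      (\<forall>s \<xi>. AE x in lebesgue_on \<Omega>. norm (a x s \<xi>) \<le> \<beta> * (1 + norm \<xi>)) \<and>
      p > 2 \<and> lam > 0 \<and> q \<ge> 1 \<and> q > ennreal (real CARD('n) / p) \<and> f \<in> Lspace \<Omega> q \<and>
      u \<in> W1_loc \<Omega> p \<and> subsolution \<Omega> a lam p f u \<and>
      ((\<forall>s \<xi>. AE x in lebesgue_on \<Omega>. a x s \<xi> \<bullet> \<xi> \<ge> 0) \<or> (AE x in lebesgue_on \<Omega>. u x \<ge> 0))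
      \<longrightarrow> (\<lambda>x. max (u x) 0) \<in> Lspace \<Omega> \<infinity> \<and>
          Lnorm \<Omega> \<infinity> (\<lambda>x. max (u x) 0) \<le> M \<beta> q p CARD('n) (inverse lam) \<Omega> (Lnorm \<Omega> q f)"
proof -
  \<comment> \<open>The arguments of \<open>bd\<close> are quantities on which \<open>M\<close> may
    depend, so choosing \<open>M\<close> by \<open>SOME\<close> from \<open>bd\<close> makes it a
    function of them. The theorem passes the inverse of \<open>lam\<close>, and
    \<open>inverse li\<close> recovers \<open>lam\<close>.\<close>
  define bd where "bd \<beta> q p li \<Omega> L M \<longleftrightarrow> M \<ge> 0 \<and> (\<forall>a f u. admissible \<Omega> \<beta> p (inverse li) q a f u \<and> Lnorm \<Omega> q f = L \<longrightarrow>
    u \<in> borel_measurable (lebesgue_on \<Omega>) \<and> (AE x in lebesgue_on \<Omega>. u x \<le> M))"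
    for \<beta> q p li and \<Omega> :: "(real^'n) set" and L M :: real
  show ?thesis
  proof (intro exI[of _ "\<lambda>\<beta> q p n li \<Omega> L. SOME M. bd \<beta> q p li \<Omega> L M"] allI impI, elim conjE)
    fix \<Omega> :: "(real^'n) set" and a \<beta> p lam q f u
    assume \<Omega>: "open \<Omega>" "bounded \<Omega>" "lipschitz_boundary \<Omega>" and \<beta>: "\<beta> > 0" and p: "p > 2" and lam: "lam > 0"
      and q: "q \<ge> 1" "q > ennreal (real CARD('n) / p)"
      and adm: "caratheodory \<Omega> a" "\<forall>s \<xi>. AE x in lebesgue_on \<Omega>. norm (a x s \<xi>) \<le> \<beta> * (1 + norm \<xi>)"
        "f \<in> Lspace \<Omega> q" "u \<in> W1_loc \<Omega> p" "subsolution \<Omega> a lam p f u"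
        "(\<forall>s \<xi>. AE x in lebesgue_on \<Omega>. a x s \<xi> \<bullet> \<xi> \<ge> 0) \<or> (AE x in lebesgue_on \<Omega>. u x \<ge> 0)"
    let ?L = "Lnorm \<Omega> q f"
    have L: "?L \<ge> 0" by (simp add: Lnorm_def)
    have A: "admissible \<Omega> \<beta> p lam q a f u" using adm unfolding admissible_def by blast
    have "\<exists>M. bd \<beta> q p (inverse lam) \<Omega> ?L M"
      using admissible_bound[OF \<Omega> \<beta> p lam q L] unfolding bd_def by simp
    moreover define M where "M = (SOME M. bd \<beta> q p (inverse lam) \<Omega> ?L M)"
    ultimately have B: "bd \<beta> q p (inverse lam) \<Omega> ?L M" using someI_ex by metis
    have "u \<in> borel_measurable (lebesgue_on \<Omega>)" "AE x in lebesgue_on \<Omega>. u x \<le> M" "0 \<le> M"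
      using A B unfolding bd_def by auto
    then show "(\<lambda>x. max (u x) 0) \<in> Lspace \<Omega> \<infinity> \<and>
          Lnorm \<Omega> \<infinity> (\<lambda>x. max (u x) 0) \<le> (SOME M. bd \<beta> q p (inverse lam) \<Omega> ?L M)"
      unfolding M_def[symmetric] by (rule Lspace_infinity_of_AE_le)
  qed
qed

end
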